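(* Let $\mathbf{k}$ be a field of characteristic $0$, $\lambda\in\mathbf{k}$. (1) Let $(\mathfrak{g},\ell=[-,-],T)$ be a Rota-Baxter Lie algebra of weight $\lambda$, with $\mathfrak{g}$ regarded as a graded space concentrated in degree $0$. Twisting the $L_\infty$-algebra $\mathfrak{C}_{\mathrm{RBL}_\lambda}(\mathfrak{g})$ by the Maurer-Cartan element corresponding to $(\ell,T)$ recovers the suspension of the cochain complex of the Rota-Baxter Lie algebra: the underlying complex of the twisted $L_\infty$-algebra is precisely (under the natural identifications of cochain spaces) $s\,\mathrm{C}^\bullet_{\mathrm{RBL}_\lambda}(\mathfrak{g})$. (2) Let $(\mathfrak{g},\ell)$ be a Lie algebra. The graded space $\mathfrak{C}_{\mathrm{RBLO}_\lambda}(\mathfrak{g})=\prod_{n\ge1}\mathrm{Hom}(S^n(s\mathfrak{g}),\mathfrak{g})$ carries a dg Lie algebra structure whose Maurer-Cartan elements are exactly the Rota-Baxter operators of weight $\lambda$ on $(\mathfrak{g},\ell)$, an operator $T$ corresponding to $\tau=T\circ s^{-1}\in\mathrm{Hom}(s\mathfrak{g},\mathfrak{g})$. Moreover, for any Rota-Baxter operator $T$ of weight $\lambda$ on $(\mathfrak g,\ell)$, the underlying complex of the dg Lie algebra twisted by the corresponding Maurer-Cartan element is exactly (under the natural identifications of cochain spaces) the cochain complex $\mathrm{C}^\bullet_{\mathrm{RBLO}_\lambda}(\mathfrak{g})$ of the Rota-Baxter operator $T$.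
   Context: **Conventions.** Homological grading, Koszul sign rule; $(sV)_p=V_{p-1}$. A cochain complex $C^\bullet$ is viewed as homologically graded with $C^n$ in degree $-n$. $\varepsilon(\sigma;x_1,\dots,x_n)$ is the Koszul sign, $\chi=\mathrm{sgn}(\sigma)\varepsilon$, $r_\sigma(x_1\otimes\cdots\otimes x_n)=\varepsilon(\sigma;x_1,\dots,x_n)\,x_{\sigma(1)}\otimes\cdots\otimes x_{\sigma(n)}$. $\mathrm{sh}(n_1,\dots,n_p)$ denotes the permutations increasing on each of the consecutive blocks of sizes $n_1,\dots,n_p$. $S^n$ is the graded symmetric power. **Rota-Baxter Lie algebra of weight $\lambda$:** a Lie algebra $(\mathfrak{g},[-,-])$ with a linear map $T:\mathfrak g\to\mathfrak g$ (a Rota-Baxter operator of weight $\lambda$) satisfying $[T(a),T(b)]=T([a,T(b)]+[T(a),b]+\lambda[a,b])$. **$L_\infty$-algebras.** A graded space $L$ with maps $l_n:L^{\otimes n}\to L$ of degree $n-2$, with $l_n(x_{\sigma(1)}\otimes\cdots\otimes x_{\sigma(n)})=\chi(\sigma;x_1,\dots,x_n)l_n(x_1\otimes\cdots\otimes x_n)$ and $\sum_{i=1}^n\sum_{\sigma\in\mathrm{sh}(i,n-i)}\chi(\sigma;x_1,\dots,x_n)(-1)^{i(n-i)}l_{n-i+1}(l_i(x_{\sigma(1)}\otimes\cdots\otimes x_{\sigma(i)})\otimes x_{\sigma(i+1)}\otimes\cdots\otimes x_{\sigma(n)})=0$. It is a dg Lie algebra if $l_n=0$ for $n\ge3$. A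 Maurer-Cartan element is $\alpha\in L_{-1}$ with $\sum_{n\ge1}\frac1{n!}(-1)^{n(n-1)/2}l_n(\alpha^{\otimes n})=0$. The twisted structure is $l_n^\alpha(x_1\otimes\cdots\otimes x_n)=\sum_{i\ge0}\frac1{i!}(-1)^{in+i(i-1)/2}l_{n+i}(\alpha^{\otimes i}\otimes x_1\otimes\cdots\otimes x_n)$; its underlying complex is $(L,l_1^\alpha)$. **The $L_\infty$-algebra $\mathfrak{C}_{\mathrm{RBL}_\lambda}(V)$.** For a graded space $V$ put $\mathfrak{C}_{\mathrm{Lie}}(V)=\prod_{n\ge1}\mathrm{Hom}(S^n(sV),sV)$, $\mathfrak{C}_{\mathrm{RBLO}_\lambda}(V)=\prod_{n\ge1}\mathrm{Hom}(S^n(sV),V)$ and $\mathfrak{C}_{\mathrm{RBL}_\lambda}(V)=\mathfrak{C}_{\mathrm{Lie}}(V)\oplus\mathfrak{C}_{\mathrm{RBLO}_\lambda}(V)$. Elements of $\mathfrak{C}_{\mathrm{Lie}}(V)$ are written $sh$ with $h$ valued in $V$ (so $|sh|=|h|+1$); for $g\in \mathfrak{C}_{\mathrm{RBLO}_\lambda}(V)$, $sg$ is valued in $sV$. For $f\in\mathrm{Hom}(S^n(sV),sV)$, $g_i\in\mathrm{Hom}(S^{m_i}(sV),sV)$, $0\le k\le n$, the brace is $f\{g_1,\dots,g_k\}=\sum_\sigma f\circ(g_1\otimes\cdots\otimes g_k\otimes\mathrm{id}^{\otimes n-k})\circ r_\sigma$, over $\sigma\in\mathrm{sh}(m_1,\dots,m_k,n-k)$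 with $\sigma(1)<\sigma(m_1+1)<\cdots<\sigma(m_1+\cdots+m_{k-1}+1)$ (and $f\{\}=f$). The operations are: (I) $l_2(sf\otimes sh)=sf\{sh\}-(-1)^{|sf||sh|}sh\{sf\}$ on $\mathfrak{C}_{\mathrm{Lie}}(V)$. (II)(i) for $sh\in\mathrm{Hom}(S^n(sV),sV)$, $n\ge1$, and $g_1,\dots,g_n\in\mathfrak{C}_{\mathrm{RBLO}_\lambda}(V)$: $l_{n+1}(sh\otimes g_1\otimes\cdots\otimes g_n)=\sum_{\sigma\in S_n}(-1)^\eta\big(s^{-1}(sh)\{sg_{\sigma(1)},\dots,sg_{\sigma(n)}\}-(-1)^{(|g_{\sigma(1)}|+1)(|h|+1)}s^{-1}(sg_{\sigma(1)})\{sh\{sg_{\sigma(2)},\dots,sg_{\sigma(n)}\}\}\big)$, with $(-1)^\eta=\chi(\sigma;g_1,\dots,g_n)(-1)^{n(|h|+1)+\sum_{k=1}^{n-1}\sum_{j=1}^k|g_{\sigma(j)}|}$. (II)(ii) for $sh\in\mathrm{Hom}(S^n(sV),sV)$, $n\ge2$, and $g_1,\dots,g_m\in\mathfrak{C}_{\mathrm{RBLO}_\lambda}(V)$, $1\le m\le n-1$: $l_{m+1}(sh\otimes g_1\otimes\cdots\otimes g_m)=\sum_{\sigma\in S_m}(-1)^\xi\lambda^{n-m}s^{-1}(sg_{\sigma(1)})\{sh\{sg_{\sigma(2)},\dots,sg_{\sigma(m)}\}\}$, with $(-1)^\xi=\chi(\sigma;g_1,\dots,g_m)(-1)^{1+m(|h|+1)+\sum_{k=1}^{m-1}\sum_{j=1}^k|g_{\sigma(j)}|+(|h|+1)(|g_{\sigma(1)}|+1)}$.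 (III) for $sh\in\mathrm{Hom}(S^n(sV),sV)$, $g_1,\dots,g_m\in\mathfrak{C}_{\mathrm{RBLO}_\lambda}(V)$ and $1\le k\le m\le n$: $l_{m+1}(g_1\otimes\cdots\otimes g_k\otimes sh\otimes g_{k+1}\otimes\cdots\otimes g_m)=(-1)^{(|h|+1)\sum_{j=1}^k|g_j|+k}l_{m+1}(sh\otimes g_1\otimes\cdots\otimes g_m)$. (IV) All other components vanish. **Corresponding Maurer-Cartan element.** For $\mathfrak{g}$ in degree $0$ and $(\ell,T)$ a Rota-Baxter Lie structure, it is $\alpha=(s\widetilde\ell,\widetilde T)$ with $\widetilde\ell=-\ell\circ(s^{-1}\otimes s^{-1})$ and $\widetilde T=T\circ s^{-1}$, i.e. $\widetilde\ell(sx\otimes sy)=[x,y]$, $\widetilde T(sx)=T(x)$. **The dg Lie structure in (2).** With $\mathfrak g$ in degree $0$, the Lie bracket alone gives the Maurer-Cartan element $\alpha=(s\widetilde\ell,0)$ of $\mathfrak{C}_{\mathrm{RBL}_\lambda}(\mathfrak g)$; the dg Lie structure on $\mathfrak{C}_{\mathrm{RBLO}_\lambda}(\mathfrak g)$ is the restriction of the twisted operations, i.e. $l_1^\alpha(g)=-l_2(s\widetilde\ell\otimes g)$ and $l_2^\alpha(g_1\otimes g_2)=l_3(s\widetilde\ell\otimes g_1\otimes g_2)$, all other operations being zero. **Cochain complexes.** Let $M=\mathfrak{g}$ with the adjoint action and $T_M=T$. For $n\ge0$, $\mathrm{C}^n_{\mathrm{Lie}}(\mathfrak{g})=\mathrm{Hom}(\wedge^n\mathfrak{g},M)$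 with $\delta^n(f)(x_1\wedge\cdots\wedge x_{n+1})=\sum_i(-1)^{n+i}x_i\cdot f(x_1\wedge\cdots\widehat{x_i}\cdots\wedge x_{n+1})+\sum_{i<j}(-1)^{i+j+n+1}f([x_i,x_j]\wedge x_1\wedge\cdots\widehat{x_i}\cdots\widehat{x_j}\cdots\wedge x_{n+1})$. The cochain complex $\mathrm{C}^\bullet_{\mathrm{RBLO}_\lambda}(\mathfrak{g})$ of the Rota-Baxter operator $T$ has the same spaces $\mathrm{Hom}(\wedge^n\mathfrak{g},M)$, $n\ge0$, and differential $\partial^n$ given by the same formula with $[-,-]$ replaced by $[a,b]_\star=[a,T(b)]+[T(a),b]+\lambda[a,b]$ and $a\cdot m$ replaced by $a\rhd m=T(a)\cdot m-T_M(a\cdot m)$. Let $\Phi^0=\mathrm{id}$ and, for $n\ge1$, $\Phi^n(f)(x_1\wedge\cdots\wedge x_n)=f(T(x_1)\wedge\cdots\wedge T(x_n))-\sum_{I\subsetneq\{1,\dots,n\}}\lambda^{n-|I|-1}T_M\big(f(y^I_1\wedge\cdots\wedge y^I_n)\big)$, where $y^I_i=T(x_i)$ if $i\in I$ and $y_i^I=x_i$ otherwise. The cochain complex of the Rota-Baxter Lie algebra is $\mathrm{C}^0_{\mathrm{RBL}_\lambda}(\mathfrak{g})=\mathrm{C}^0_{\mathrm{Lie}}(\mathfrak{g})$, $\mathrm{C}^n_{\mathrm{RBL}_\lambda}(\mathfrak{g})=\mathrm{C}^n_{\mathrm{Lie}}(\mathfrak{g})\oplus\mathrm{C}^{n-1}_{\mathrm{RBLO}_\lambda}(\mathfrak{g})$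 for $n\ge1$, with $d^n(f,g)=(\delta^n(f),-\partial^{n-1}(g)-\Phi^n(f))$. **Identifications of cochain spaces.** $\mathrm{Hom}(S^n(s\mathfrak g),s\mathfrak g)\subset\mathfrak{C}_{\mathrm{Lie}}(\mathfrak g)$ is identified with $\mathrm{C}^n_{\mathrm{Lie}}(\mathfrak g)$, and $\mathrm{Hom}(S^n(s\mathfrak g),\mathfrak g)\subset\mathfrak{C}_{\mathrm{RBLO}_\lambda}(\mathfrak g)$ with $\mathrm{C}^n_{\mathrm{RBLO}_\lambda}(\mathfrak g)$.
   Formalization: The identifications of complexes are stated for the subcomplexes of cochains without arity-0 component (no Hom(∧^0 g, g) parts of C_Lie and C_RBLO), since the products defining the twisted algebras start at n = 1 and have no counterpart of these; with them the claim fails for g ≠ 0. *)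

theory Defs
  imports
    Complex_Main
    "HOL-Combinatorics.Permutations"
    "HOL-Library.Function_Algebras"
    "HOL-Library.Product_Plus"
    "HOL-Library.Groups_Big_Fun"
begin

section \<open>Graded spaces, signs and shuffles\<close>

text \<open>
  A graded space is a family \<open>V :: int \<Rightarrow> 'v set\<close> of subspaces of an ambient vector space; only
  homogeneous elements are used, and they are carried around as pairs \<open>(degree, element)\<close>.
  A tensor of homogeneous elements is a list of such pairs.  The suspension is the identity on
  underlying vectors and only shifts the degree.
\<close>

definition msign :: "int \<Rightarrow> 'k::comm_ring_1" where
  "msign e = (if even e then 1 else - 1)"

definition graded_space :: "('k::field \<Rightarrow> 'v::ab_group_add \<Rightarrow> 'v) \<Rightarrow> (int \<Rightarrow> 'v set) \<Rightarrow> bool" where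
  "graded_space scale V \<longleftrightarrow> vector_space scale \<and> (\<forall>p. module.subspace scale (V p))"

definition susp :: "(int \<Rightarrow> 'v set) \<Rightarrow> int \<Rightarrow> 'v set" where
  "susp V p = V (p - 1)"

definition deg0 :: "int \<Rightarrow> 'v::zero set" where
  "deg0 p = (if p = 0 then UNIV else {0})"

definition homs :: "(int \<Rightarrow> 'v set) \<Rightarrow> (int \<times> 'v) list \<Rightarrow> bool" where
  "homs V xs \<longleftrightarrow> (\<forall>(p, x) \<in> set xs. x \<in> V p)"

definition degs :: "(int \<times> 'v) list \<Rightarrow> int" where
  "degs xs = sum_list (map fst xs)"

text \<open>
  The Koszul sign of \<open>x\<^sub>1 \<otimes> \<dots> \<otimes> x\<^sub>n \<mapsto> x\<^bsub>\<sigma>(1)\<^esub> \<otimes> \<dots> \<otimes> x\<^bsub>\<sigma>(n)\<^esub>\<close> (here with indices starting at 0): one factor for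
  each pair whose order is reversed.  The permuted tensor is \<open>permute_list \<sigma> xs\<close>.
\<close>

definition koszul :: "(nat \<Rightarrow> nat) \<Rightarrow> int list \<Rightarrow> 'k::comm_ring_1" where
  "koszul \<sigma> ds =
     (\<Prod>(i, j) \<in> {(i, j). i < j \<and> j < length ds \<and> \<sigma> j < \<sigma> i}. msign (ds ! \<sigma> i * ds ! \<sigma> j))"

definition chi :: "(nat \<Rightarrow> nat) \<Rightarrow> int list \<Rightarrow> 'k::comm_ring_1" where
  "chi \<sigma> ds = of_int (sign \<sigma>) * koszul \<sigma> ds"

definition block_shuffles :: "nat list \<Rightarrow> (nat \<Rightarrow> nat) set" where
  "block_shuffles ns =
     {\<sigma>. \<sigma> permutes {..<sum_list ns} \<and>
         (\<forall>j < length ns. strict_mono_on {sum_list (take j ns)..<sum_list (take (Suc j) ns)} \<sigma>)}"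

definition multilinear_on ::
  "('k \<Rightarrow> 'v::ab_group_add \<Rightarrow> 'v) \<Rightarrow> ('k \<Rightarrow> 'w::ab_group_add \<Rightarrow> 'w) \<Rightarrow> (int \<Rightarrow> 'v set)
     \<Rightarrow> ((int \<times> 'v) list \<Rightarrow> 'w) \<Rightarrow> bool" where
  "multilinear_on scaleV scaleW V f \<longleftrightarrow>
     (\<forall>us ws p x y c. homs V us \<and> homs V ws \<and> x \<in> V p \<and> y \<in> V p \<longrightarrow>
        f (us @ (p, x + y) # ws) = f (us @ (p, x) # ws) + f (us @ (p, y) # ws) \<and>
        f (us @ (p, scaleV c x) # ws) = scaleW c (f (us @ (p, x) # ws)))"


section \<open>\<open>L\<^sub>\<infinity>\<close>-algebras\<close>

text \<open>
  The operation \<open>l\<^sub>n\<close> is the restriction of \<open>l\<close> to lists of length \<open>n \<ge> 1\<close>.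
\<close>

definition linf_algebra ::
  "('k::field \<Rightarrow> 'l::ab_group_add \<Rightarrow> 'l) \<Rightarrow> (int \<Rightarrow> 'l set) \<Rightarrow> ((int \<times> 'l) list \<Rightarrow> 'l) \<Rightarrow> bool" where
  "linf_algebra scale L l \<longleftrightarrow>
     graded_space scale L \<and>
     multilinear_on scale scale L l \<and>
     (\<forall>xs. xs \<noteq> [] \<and> homs L xs \<longrightarrow>
        l xs \<in> L (degs xs + int (length xs) - 2) \<and>
        (\<forall>\<sigma>. \<sigma> permutes {..<length xs} \<longrightarrow>
           l (permute_list \<sigma> xs) = scale (chi \<sigma> (map fst xs)) (l xs)) \<and>
        (\<Sum>i = 1..length xs. \<Sum>\<sigma> \<in> block_shuffles [i, length xs - i].
           let ys = permute_list \<sigma> xs; as = take i ys; bs = drop i ys in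
           scale (chi \<sigma> (map fst xs) * (- 1) ^ (i * (length xs - i)))
             (l ((degs as + int i - 2, l as) # bs))) = 0)"

definition dg_lie_algebra ::
  "('k::field \<Rightarrow> 'l::ab_group_add \<Rightarrow> 'l) \<Rightarrow> (int \<Rightarrow> 'l set) \<Rightarrow> ((int \<times> 'l) list \<Rightarrow> 'l) \<Rightarrow> bool" where
  "dg_lie_algebra scale L l \<longleftrightarrow>
     linf_algebra scale L l \<and> (\<forall>xs. 3 \<le> length xs \<and> homs L xs \<longrightarrow> l xs = 0)"

text \<open>
  The series below only have a meaning when finitely many of their terms are nonzero (\<open>Sum_any\<close> is 0
  otherwise); hence the explicit finiteness conditions in \<open>maurer_cartan\<close> and \<open>twist_converges\<close>.
\<close>

definition mc_term ::
  "('k::field_char_0 \<Rightarrow> 'l::ab_group_add \<Rightarrow> 'l) \<Rightarrow> ((int \<times> 'l) list \<Rightarrow> 'l) \<Rightarrow> 'l \<Rightarrow> nat \<Rightarrow> 'l" where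
  "mc_term scale l \<alpha> n =
     (if n = 0 then 0
      else scale ((- 1) ^ (n * (n - 1) div 2) / fact n) (l (replicate n (- 1, \<alpha>))))"

definition maurer_cartan ::
  "('k::field_char_0 \<Rightarrow> 'l::ab_group_add \<Rightarrow> 'l) \<Rightarrow> (int \<Rightarrow> 'l set) \<Rightarrow> ((int \<times> 'l) list \<Rightarrow> 'l)
     \<Rightarrow> 'l \<Rightarrow> bool" where
  "maurer_cartan scale L l \<alpha> \<longleftrightarrow>
     \<alpha> \<in> L (- 1) \<and> finite {n. mc_term scale l \<alpha> n \<noteq> 0} \<and> Sum_any (mc_term scale l \<alpha>) = 0"

definition twist_term ::
  "('k::field_char_0 \<Rightarrow> 'l::ab_group_add \<Rightarrow> 'l) \<Rightarrow> ((int \<times> 'l) list \<Rightarrow> 'l) \<Rightarrow> 'l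
     \<Rightarrow> (int \<times> 'l) list \<Rightarrow> nat \<Rightarrow> 'l" where
  "twist_term scale l \<alpha> xs i =
     scale ((- 1) ^ (i * length xs + i * (i - 1) div 2) / fact i) (l (replicate i (- 1, \<alpha>) @ xs))"

definition twist_converges ::
  "('k::field_char_0 \<Rightarrow> 'l::ab_group_add \<Rightarrow> 'l) \<Rightarrow> (int \<Rightarrow> 'l set) \<Rightarrow> ((int \<times> 'l) list \<Rightarrow> 'l)
     \<Rightarrow> 'l \<Rightarrow> bool" where
  "twist_converges scale L l \<alpha> \<longleftrightarrow>
     (\<forall>xs. xs \<noteq> [] \<and> homs L xs \<longrightarrow> finite {i. twist_term scale l \<alpha> xs i \<noteq> 0})"

definition twist ::
  "('k::field_char_0 \<Rightarrow> 'l::ab_group_add \<Rightarrow> 'l) \<Rightarrow> ((int \<times> 'l) list \<Rightarrow> 'l) \<Rightarrow> 'l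
     \<Rightarrow> (int \<times> 'l) list \<Rightarrow> 'l" where
  "twist scale l \<alpha> xs = Sum_any (twist_term scale l \<alpha> xs)"

definition twisted_diff ::
  "('k::field_char_0 \<Rightarrow> 'l::ab_group_add \<Rightarrow> 'l) \<Rightarrow> ((int \<times> 'l) list \<Rightarrow> 'l) \<Rightarrow> 'l
     \<Rightarrow> int \<Rightarrow> 'l \<Rightarrow> 'l" where
  "twisted_diff scale l \<alpha> p x = twist scale l \<alpha> [(p, x)]"


section \<open>The operations on \<open>\<CC>\<^bsub>RBL\<lambda>\<^esub>(V)\<close>\<close>

text \<open>
  Degree \<open>d\<close> part of \<open>\<Prod>\<^bsub>n\<ge>1\<^esub> Hom(S\<^sup>n A, B)\<close>.  The component of arity \<open>n\<close> of \<open>f\<close> is its restriction to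
  lists of length \<open>n\<close>; off tensors of positive length of elements of \<open>A\<close>, the function is fixed to be 0.
\<close>

definition sym_hom ::
  "('k::field \<Rightarrow> 'v::ab_group_add \<Rightarrow> 'v) \<Rightarrow> (int \<Rightarrow> 'v set) \<Rightarrow> (int \<Rightarrow> 'v set) \<Rightarrow> int
     \<Rightarrow> ((int \<times> 'v) list \<Rightarrow> 'v) set" where
  "sym_hom scale A B d =
     {f. (\<forall>xs. \<not> (xs \<noteq> [] \<and> homs A xs) \<longrightarrow> f xs = 0) \<and>
         (\<forall>xs. xs \<noteq> [] \<and> homs A xs \<longrightarrow> f xs \<in> B (d + degs xs)) \<and>
         multilinear_on scale scale A f \<and>
         (\<forall>xs \<sigma>. homs A xs \<and> \<sigma> permutes {..<length xs} \<longrightarrow>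
            f (permute_list \<sigma> xs) = scale (koszul \<sigma> (map fst xs)) (f xs))}"

definition fun_scale :: "('k \<Rightarrow> 'v \<Rightarrow> 'v) \<Rightarrow> 'k \<Rightarrow> ('a \<Rightarrow> 'v) \<Rightarrow> 'a \<Rightarrow> 'v" where
  "fun_scale scale c f = (\<lambda>xs. scale c (f xs))"

definition pair_scale ::
  "('k \<Rightarrow> 'v \<Rightarrow> 'v) \<Rightarrow> 'k \<Rightarrow> ('a \<Rightarrow> 'v) \<times> ('a \<Rightarrow> 'v) \<Rightarrow> ('a \<Rightarrow> 'v) \<times> ('a \<Rightarrow> 'v)" where
  "pair_scale scale c z = (fun_scale scale c (fst z), fun_scale scale c (snd z))"

definition rblo_space ::
  "('k::field \<Rightarrow> 'v::ab_group_add \<Rightarrow> 'v) \<Rightarrow> (int \<Rightarrow> 'v set) \<Rightarrow> int \<Rightarrow> ((int \<times> 'v) list \<Rightarrow> 'v) set" where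
  "rblo_space scale V d = sym_hom scale (susp V) V d"

text \<open>An element of \<open>\<CC>\<^bsub>RBL\<lambda>\<^esub>(V)\<close> is a pair \<open>(sh, g)\<close>; its degree is \<open>|sh| = |h| + 1\<close>, respectively \<open>|g|\<close>.\<close>

definition rbl_space ::
  "('k::field \<Rightarrow> 'v::ab_group_add \<Rightarrow> 'v) \<Rightarrow> (int \<Rightarrow> 'v set) \<Rightarrow> int
     \<Rightarrow> (((int \<times> 'v) list \<Rightarrow> 'v) \<times> ((int \<times> 'v) list \<Rightarrow> 'v)) set" where
  "rbl_space scale V d = sym_hom scale (susp V) (susp V) d \<times> rblo_space scale V d"

text \<open>
  \<open>plug gs ms ys\<close> lists the tensor factors of \<open>(g\<^sub>1 \<otimes> \<dots> \<otimes> g\<^sub>k \<otimes> id \<otimes> \<dots> \<otimes> id)(ys)\<close>, the \<open>g\<^sub>j\<close> being used in arity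
  \<open>m\<^sub>j\<close> and given with their degrees; \<open>plug_exp\<close> is the exponent of the Koszul sign of this evaluation.
\<close>

fun plug :: "(int \<times> ((int \<times> 'v) list \<Rightarrow> 'v)) list \<Rightarrow> nat list \<Rightarrow> (int \<times> 'v) list \<Rightarrow> (int \<times> 'v) list" where
  "plug ((q, g) # gs) (m # ms) ys = (q + degs (take m ys), g (take m ys)) # plug gs ms (drop m ys)"
| "plug _ _ ys = ys"

fun plug_exp :: "(int \<times> ((int \<times> 'v) list \<Rightarrow> 'v)) list \<Rightarrow> nat list \<Rightarrow> (int \<times> 'v) list \<Rightarrow> int" where
  "plug_exp ((q, g) # gs) (m # ms) ys = degs gs * degs (take m ys) + plug_exp gs ms (drop m ys)"
| "plug_exp _ _ ys = 0"

text \<open>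
  The brace \<open>f{g\<^sub>1,\<dots>,g\<^sub>k}\<close>, extended multilinearly to elements of the products: on \<open>N\<close> arguments, the arities
  \<open>m\<^sub>1,\<dots>,m\<^sub>k\<close> of the \<open>g\<^sub>j\<close> vary and the arity \<open>n\<close> of \<open>f\<close> is determined by \<open>n - k = N - m\<^sub>1 - \<dots> - m\<^sub>k\<close>.
\<close>

definition brace ::
  "('k::field \<Rightarrow> 'v::ab_group_add \<Rightarrow> 'v) \<Rightarrow> ((int \<times> 'v) list \<Rightarrow> 'v)
     \<Rightarrow> (int \<times> ((int \<times> 'v) list \<Rightarrow> 'v)) list \<Rightarrow> (int \<times> 'v) list \<Rightarrow> 'v" where
  "brace scale f gs xs =
     (\<Sum>ms \<in> {ms. length ms = length gs \<and> set ms \<subseteq> {1..length xs} \<and> sum_list ms \<le> length xs}.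
        \<Sum>\<sigma> \<in> {\<sigma> \<in> block_shuffles (ms @ [length xs - sum_list ms]).
                 \<forall>i j. i < j \<and> j < length ms \<longrightarrow>
                   \<sigma> (sum_list (take i ms)) < \<sigma> (sum_list (take j ms))}.
          scale (koszul \<sigma> (map fst xs) * msign (plug_exp gs ms (permute_list \<sigma> xs)))
            (f (plug gs ms (permute_list \<sigma> xs))))"

definition arity_part :: "nat \<Rightarrow> ((int \<times> 'v) list \<Rightarrow> 'v::zero) \<Rightarrow> (int \<times> 'v) list \<Rightarrow> 'v" where
  "arity_part n f = (\<lambda>xs. if length xs = n then f xs else 0)"

text \<open>\<open>g \<mapsto> sg\<close> on a list of elements of \<open>\<CC>\<^bsub>RBLO\<lambda>\<^esub>(V)\<close>\<close>

definition susp_list :: "(int \<times> 'f) list \<Rightarrow> (int \<times> 'f) list" where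
  "susp_list gs = map (\<lambda>(q, g). (q + 1, g)) gs"

definition op_lie ::
  "('k::field \<Rightarrow> 'v::ab_group_add \<Rightarrow> 'v) \<Rightarrow> int \<times> ((int \<times> 'v) list \<Rightarrow> 'v)
     \<Rightarrow> int \<times> ((int \<times> 'v) list \<Rightarrow> 'v) \<Rightarrow> (int \<times> 'v) list \<Rightarrow> 'v" where
  "op_lie scale a b =
     (\<lambda>xs. brace scale (snd a) [b] xs
           - scale (msign (fst a * fst b)) (brace scale (snd b) [a] xs))"

text \<open>
  In the following two definitions \<open>p = |sh| = |h| + 1\<close>, \<open>sh\<close> is of arity \<open>n\<close> and \<open>gs = g\<^sub>1,\<dots>,g\<^sub>m\<close>, with \<open>m \<ge> 1\<close>;
  \<open>nested\<close> is \<open>s\<^sup>-\<^sup>1(sg\<^sub>1){sh{sg\<^sub>2,\<dots>,sg\<^sub>m}}\<close>.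
\<close>

definition nested ::
  "('k::field \<Rightarrow> 'v::ab_group_add \<Rightarrow> 'v) \<Rightarrow> int \<Rightarrow> ((int \<times> 'v) list \<Rightarrow> 'v)
     \<Rightarrow> (int \<times> ((int \<times> 'v) list \<Rightarrow> 'v)) list \<Rightarrow> (int \<times> 'v) list \<Rightarrow> 'v" where
  "nested scale p sh gs =
     brace scale (snd (hd gs))
       [(p + degs (susp_list (tl gs)), brace scale sh (susp_list (tl gs)))]"

definition partial_degs :: "(int \<times> 'f) list \<Rightarrow> int" where
  "partial_degs gs = (\<Sum>k = 1..length gs - 1. degs (take k gs))"

definition op_top ::
  "('k::field \<Rightarrow> 'v::ab_group_add \<Rightarrow> 'v) \<Rightarrow> int \<Rightarrow> ((int \<times> 'v) list \<Rightarrow> 'v)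
     \<Rightarrow> (int \<times> ((int \<times> 'v) list \<Rightarrow> 'v)) list \<Rightarrow> (int \<times> 'v) list \<Rightarrow> 'v" where
  "op_top scale p sh gs xs =
     (\<Sum>\<sigma> | \<sigma> permutes {..<length gs}.
        let gs' = permute_list \<sigma> gs in
        scale (chi \<sigma> (map fst gs) * msign (int (length gs) * p + partial_degs gs'))
          (brace scale sh (susp_list gs') xs
           - scale (msign ((fst (hd gs') + 1) * p)) (nested scale p sh gs' xs)))"

definition op_lam ::
  "('k::field \<Rightarrow> 'v::ab_group_add \<Rightarrow> 'v) \<Rightarrow> 'k \<Rightarrow> nat \<Rightarrow> int \<Rightarrow> ((int \<times> 'v) list \<Rightarrow> 'v)
     \<Rightarrow> (int \<times> ((int \<times> 'v) list \<Rightarrow> 'v)) list \<Rightarrow> (int \<times> 'v) list \<Rightarrow> 'v" where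
  "op_lam scale lam n p sh gs xs =
     (\<Sum>\<sigma> | \<sigma> permutes {..<length gs}.
        let gs' = permute_list \<sigma> gs in
        scale (chi \<sigma> (map fst gs)
               * msign (1 + int (length gs) * p + partial_degs gs' + p * (fst (hd gs') + 1))
               * lam ^ (n - length gs))
          (nested scale p sh gs' xs))"

text \<open>
  \<open>l\<^bsub>m+1\<^esub>(sh \<otimes> g\<^sub>1 \<otimes> \<dots> \<otimes> g\<^sub>m)\<close> for \<open>sh\<close> in the product over all arities.  The components of \<open>sh\<close> of arity
  \<open>n > length xs\<close> do not contribute on \<open>xs\<close>, since \<open>nested\<close> then has arity at least \<open>n\<close>.
\<close>

definition op_mixed ::
  "('k::field \<Rightarrow> 'v::ab_group_add \<Rightarrow> 'v) \<Rightarrow> 'k \<Rightarrow> int \<Rightarrow> ((int \<times> 'v) list \<Rightarrow> 'v)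
     \<Rightarrow> (int \<times> ((int \<times> 'v) list \<Rightarrow> 'v)) list \<Rightarrow> (int \<times> 'v) list \<Rightarrow> 'v" where
  "op_mixed scale lam p sh gs xs =
     op_top scale p (arity_part (length gs) sh) gs xs
     + (\<Sum>n = length gs + 1..length xs. op_lam scale lam n p (arity_part n sh) gs xs)"

definition drop_nth :: "nat \<Rightarrow> 'a list \<Rightarrow> 'a list" where
  "drop_nth k xs = take k xs @ drop (Suc k) xs"

text \<open>
  The multilinear extension to pairs: in the second component, the summand \<open>k\<close> takes the
  \<open>\<CC>\<^bsub>Lie\<^esub>\<close>-component of the argument in position \<open>k\<close> and the \<open>\<CC>\<^bsub>RBLO\<lambda>\<^esub>\<close>-components of the others, with
  the sign \<open>(-1)\<^bsup>|sh|(|g\<^sub>1| + \<dots> + |g\<^sub>k|) + k\<^esup>\<close> of moving \<open>sh\<close> to the front.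
\<close>

definition rbl_op ::
  "('k::field \<Rightarrow> 'v::ab_group_add \<Rightarrow> 'v) \<Rightarrow> 'k
     \<Rightarrow> (int \<times> (((int \<times> 'v) list \<Rightarrow> 'v) \<times> ((int \<times> 'v) list \<Rightarrow> 'v))) list
     \<Rightarrow> ((int \<times> 'v) list \<Rightarrow> 'v) \<times> ((int \<times> 'v) list \<Rightarrow> 'v)" where
  "rbl_op scale lam zs =
     (if length zs = 2
        then op_lie scale (fst (zs ! 0), fst (snd (zs ! 0))) (fst (zs ! 1), fst (snd (zs ! 1)))
        else 0,
      if 2 \<le> length zs
        then (\<lambda>xs. \<Sum>k < length zs.
                scale (msign (fst (zs ! k) * degs (take k zs) + int k))
                  (op_mixed scale lam (fst (zs ! k)) (fst (snd (zs ! k)))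
                     (map (\<lambda>(q, z). (q, snd z)) (drop_nth k zs)) xs))
        else 0)"


section \<open>Rota-Baxter Lie algebras and their cochain complexes\<close>

definition lie_algebra ::
  "('k::field \<Rightarrow> 'g::ab_group_add \<Rightarrow> 'g) \<Rightarrow> ('g \<Rightarrow> 'g \<Rightarrow> 'g) \<Rightarrow> bool" where
  "lie_algebra scale br \<longleftrightarrow>
     vector_space scale \<and>
     (\<forall>x. Vector_Spaces.linear scale scale (br x)) \<and>
     (\<forall>y. Vector_Spaces.linear scale scale (\<lambda>x. br x y)) \<and>
     (\<forall>x. br x x = 0) \<and>
     (\<forall>x y z. br x (br y z) + br y (br z x) + br z (br x y) = 0)"

definition rota_baxter_operator ::
  "('k::field \<Rightarrow> 'g::ab_group_add \<Rightarrow> 'g) \<Rightarrow> 'k \<Rightarrow> ('g \<Rightarrow> 'g \<Rightarrow> 'g) \<Rightarrow> ('g \<Rightarrow> 'g) \<Rightarrow> bool" where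
  "rota_baxter_operator scale lam br T \<longleftrightarrow>
     Vector_Spaces.linear scale scale T \<and>
     (\<forall>a b. br (T a) (T b) = T (br a (T b) + br (T a) b + scale lam (br a b)))"

text \<open>\<open>Hom(\<Lambda>\<^sup>n \<gg>, \<gg>)\<close>, functions being 0 on lists of length other than \<open>n\<close>\<close>

definition alt_cochains ::
  "('k::field \<Rightarrow> 'g::ab_group_add \<Rightarrow> 'g) \<Rightarrow> nat \<Rightarrow> ('g list \<Rightarrow> 'g) set" where
  "alt_cochains scale n =
     {f. (\<forall>xs. length xs \<noteq> n \<longrightarrow> f xs = 0) \<and>
         (\<forall>us ws. length us + length ws + 1 = n \<longrightarrow>
            Vector_Spaces.linear scale scale (\<lambda>x. f (us @ x # ws))) \<and>
         (\<forall>xs i j. i < j \<and> j < length xs \<and> xs ! i = xs ! j \<longrightarrow> f xs = 0)}"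

text \<open>
  The Chevalley-Eilenberg differential on cochains of degree \<open>n\<close> for the bracket \<open>br\<close> and the
  action \<open>act\<close>; the positions \<open>i, j\<close> start at 0, hence \<open>Suc\<close> in the signs.
\<close>

definition ce_diff ::
  "('k::field \<Rightarrow> 'g::ab_group_add \<Rightarrow> 'g) \<Rightarrow> ('g \<Rightarrow> 'g \<Rightarrow> 'g) \<Rightarrow> ('g \<Rightarrow> 'g \<Rightarrow> 'g)
     \<Rightarrow> nat \<Rightarrow> ('g list \<Rightarrow> 'g) \<Rightarrow> 'g list \<Rightarrow> 'g" where
  "ce_diff scale br act n f xs =
     (if length xs \<noteq> n + 1 then 0
      else (\<Sum>i < n + 1. scale ((- 1) ^ (n + Suc i)) (act (xs ! i) (f (drop_nth i xs))))
         + (\<Sum>j < n + 1. \<Sum>i < j. scale ((- 1) ^ (Suc i + Suc j + n + 1))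
              (f (br (xs ! i) (xs ! j) # drop_nth i (drop_nth j xs)))))"

definition lie_diff ::
  "('k::field \<Rightarrow> 'g::ab_group_add \<Rightarrow> 'g) \<Rightarrow> ('g \<Rightarrow> 'g \<Rightarrow> 'g)
     \<Rightarrow> nat \<Rightarrow> ('g list \<Rightarrow> 'g) \<Rightarrow> 'g list \<Rightarrow> 'g" where
  "lie_diff scale br n f = ce_diff scale br br n f"

definition rblo_diff ::
  "('k::field \<Rightarrow> 'g::ab_group_add \<Rightarrow> 'g) \<Rightarrow> 'k \<Rightarrow> ('g \<Rightarrow> 'g \<Rightarrow> 'g) \<Rightarrow> ('g \<Rightarrow> 'g)
     \<Rightarrow> nat \<Rightarrow> ('g list \<Rightarrow> 'g) \<Rightarrow> 'g list \<Rightarrow> 'g" where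
  "rblo_diff scale lam br T n f =
     ce_diff scale
       (\<lambda>a b. br a (T b) + br (T a) b + scale lam (br a b))
       (\<lambda>a m. br (T a) m - T (br a m)) n f"

definition rb_Phi ::
  "('k::field \<Rightarrow> 'g::ab_group_add \<Rightarrow> 'g) \<Rightarrow> 'k \<Rightarrow> ('g \<Rightarrow> 'g)
     \<Rightarrow> nat \<Rightarrow> ('g list \<Rightarrow> 'g) \<Rightarrow> 'g list \<Rightarrow> 'g" where
  "rb_Phi scale lam T n f xs =
     (if length xs \<noteq> n then 0
      else if n = 0 then f xs
      else f (map T xs)
           - (\<Sum>I | I \<subset> {..<n}. scale (lam ^ (n - card I - 1))
                (T (f (map (\<lambda>i. if i \<in> I then T (xs ! i) else xs ! i) [0..<n])))))"

definition rbl_cochains ::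
  "('k::field \<Rightarrow> 'g::ab_group_add \<Rightarrow> 'g) \<Rightarrow> nat \<Rightarrow> (('g list \<Rightarrow> 'g) \<times> ('g list \<Rightarrow> 'g)) set" where
  "rbl_cochains scale n =
     alt_cochains scale n \<times> (if n = 0 then {0} else alt_cochains scale (n - 1))"

definition rbl_diff ::
  "('k::field \<Rightarrow> 'g::ab_group_add \<Rightarrow> 'g) \<Rightarrow> 'k \<Rightarrow> ('g \<Rightarrow> 'g \<Rightarrow> 'g) \<Rightarrow> ('g \<Rightarrow> 'g)
     \<Rightarrow> nat \<Rightarrow> ('g list \<Rightarrow> 'g) \<times> ('g list \<Rightarrow> 'g) \<Rightarrow> ('g list \<Rightarrow> 'g) \<times> ('g list \<Rightarrow> 'g)" where
  "rbl_diff scale lam br T n z =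
     (lie_diff scale br n (fst z),
      - (if n = 0 then 0 else rblo_diff scale lam br T (n - 1) (snd z))
      - rb_Phi scale lam T n (fst z))"

text \<open>
  A cochain complex as a homologically graded complex, its suspension (with the Koszul sign in
  the differential), and isomorphisms of complexes.
\<close>

definition homological :: "(nat \<Rightarrow> 'c::zero set) \<Rightarrow> int \<Rightarrow> 'c set" where
  "homological C p = (if p \<le> 0 then C (nat (- p)) else {0})"

definition homological_diff :: "(nat \<Rightarrow> 'c \<Rightarrow> 'c::zero) \<Rightarrow> int \<Rightarrow> 'c \<Rightarrow> 'c" where
  "homological_diff d p x = (if p \<le> 0 then d (nat (- p)) x else 0)"

definition susp_diff :: "(int \<Rightarrow> 'c \<Rightarrow> 'c::uminus) \<Rightarrow> int \<Rightarrow> 'c \<Rightarrow> 'c" where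
  "susp_diff d p x = - d (p - 1) x"

definition complex_iso ::
  "('k \<Rightarrow> 'c::ab_group_add \<Rightarrow> 'c) \<Rightarrow> ('k \<Rightarrow> 'l::ab_group_add \<Rightarrow> 'l) \<Rightarrow> ('c \<Rightarrow> 'l)
     \<Rightarrow> (int \<Rightarrow> 'c set) \<Rightarrow> (int \<Rightarrow> 'c \<Rightarrow> 'c) \<Rightarrow> (int \<Rightarrow> 'l set) \<Rightarrow> (int \<Rightarrow> 'l \<Rightarrow> 'l) \<Rightarrow> bool" where
  "complex_iso scaleC scaleL \<Psi> C dC L dL \<longleftrightarrow>
     (\<forall>p. bij_betw \<Psi> (C p) (L p) \<and>
          (\<forall>c \<in> C p. \<forall>c' \<in> C p. \<Psi> (c + c') = \<Psi> c + \<Psi> c') \<and>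
          (\<forall>a. \<forall>c \<in> C p. \<Psi> (scaleC a c) = scaleL a (\<Psi> c)) \<and>
          (\<forall>c \<in> C p. dC p c \<in> C (p - 1) \<and> \<Psi> (dC p c) = dL p (\<Psi> c)))"

text \<open>
  The products defining \<open>\<CC>\<^bsub>RBL\<lambda>\<^esub>\<close> and \<open>\<CC>\<^bsub>RBLO\<lambda>\<^esub>\<close> start in arity 1, the cochain complexes in arity 0.  The
  identification therefore concerns the subcomplexes of cochains without arity 0 component.
\<close>

definition rblo_positive ::
  "('k::field \<Rightarrow> 'g::ab_group_add \<Rightarrow> 'g) \<Rightarrow> nat \<Rightarrow> ('g list \<Rightarrow> 'g) set" where
  "rblo_positive scale n = {g \<in> alt_cochains scale n. g [] = 0}"

definition rbl_positive ::
  "('k::field \<Rightarrow> 'g::ab_group_add \<Rightarrow> 'g) \<Rightarrow> nat \<Rightarrow> (('g list \<Rightarrow> 'g) \<times> ('g list \<Rightarrow> 'g)) set" where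
  "rbl_positive scale n = {z \<in> rbl_cochains scale n. fst z [] = 0 \<and> snd z [] = 0}"

text \<open>
  For \<open>\<gg>\<close> in degree 0, a cochain \<open>f\<close> is identified with \<open>sx\<^sub>1 \<otimes> \<dots> \<otimes> sx\<^sub>n \<mapsto> f(x\<^sub>1,\<dots>,x\<^sub>n)\<close>, valued in \<open>\<gg>\<close> or in \<open>s\<gg>\<close>.
\<close>

definition ident :: "('g list \<Rightarrow> 'g) \<Rightarrow> (int \<times> 'g) list \<Rightarrow> 'g::zero" where
  "ident f zs = (if zs \<noteq> [] \<and> (\<forall>z \<in> set zs. fst z = 1) then f (map snd zs) else 0)"

definition ident_pair ::
  "('g list \<Rightarrow> 'g) \<times> ('g list \<Rightarrow> 'g)
     \<Rightarrow> ((int \<times> 'g) list \<Rightarrow> 'g) \<times> ((int \<times> 'g) list \<Rightarrow> 'g::zero)" where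
  "ident_pair z = (ident (fst z), ident (snd z))"

definition tilde_bracket :: "('g \<Rightarrow> 'g \<Rightarrow> 'g) \<Rightarrow> (int \<times> 'g) list \<Rightarrow> 'g::zero" where
  "tilde_bracket br zs = (case zs of [(p, x), (q, y)] \<Rightarrow> if p = 1 \<and> q = 1 then br x y else 0 | _ \<Rightarrow> 0)"

definition tilde_operator :: "('g \<Rightarrow> 'g) \<Rightarrow> (int \<times> 'g) list \<Rightarrow> 'g::zero" where
  "tilde_operator T zs = (case zs of [(p, x)] \<Rightarrow> if p = 1 then T x else 0 | _ \<Rightarrow> 0)"

text \<open>The dg Lie structure on \<open>\<CC>\<^bsub>RBLO\<lambda>\<^esub>(\<gg>)\<close> for a Lie algebra \<open>\<gg>\<close> in degree 0\<close>

definition rblo_incl :: "int \<times> ('a \<Rightarrow> 'g::zero) \<Rightarrow> int \<times> (('a \<Rightarrow> 'g) \<times> ('a \<Rightarrow> 'g))" where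
  "rblo_incl z = (fst z, (0, snd z))"

definition rblo_op ::
  "('k::field \<Rightarrow> 'g::ab_group_add \<Rightarrow> 'g) \<Rightarrow> 'k \<Rightarrow> ('g \<Rightarrow> 'g \<Rightarrow> 'g)
     \<Rightarrow> (int \<times> ((int \<times> 'g) list \<Rightarrow> 'g)) list \<Rightarrow> (int \<times> 'g) list \<Rightarrow> 'g" where
  "rblo_op scale lam br zs =
     (let r = snd (rbl_op scale lam ((- 1, (tilde_bracket br, 0)) # map rblo_incl zs)) in
      if length zs = 1 then - r else if length zs = 2 then r else 0)"

end

theory Submission
  imports Defs
begin

text \<open>
  An alternating map is a function on lists.  Contraction with the first argument acts as a graded
  derivation on each of the operations below, so identities between cochains follow by
  induction on the list of arguments.  Let \<open>K \<sqinter> L\<close> be the pointwise bracket of cochains, summed over shuffles,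
  and \<open>R\<^sub>K f = - f{\<ell>{K}}\<close>, where \<open>\<ell>\<close> is the bracket of \<open>\<gg>\<close>.  Then \<open>R\<^sub>K\<close> is a derivation for \<open>\<sqinter>\<close>, and
  \<open>[R\<^sub>K, R\<^sub>L]\<close> is \<open>R\<close> of \<open>\<lbrakk>K, L\<rbrakk> = K \<sqinter> L + R\<^sub>K L - (-1)\<^bsup>|K||L|\<^esup> R\<^sub>L K\<close> (the bracket of a transformation Lie
  algebra), from which the Jacobi identity for \<open>\<lbrakk>-, -\<rbrakk>\<close> is formal.  Up to signs, \<open>\<lbrakk>-, -\<rbrakk>\<close> is the operation
  \<open>l\<^sub>2\<close> on \<open>\<CC>\<^bsub>RBLO\<lambda>\<^esub>(\<gg>)\<close>, and \<open>l\<^sub>1\<close> is \<open>\<lambda>\<close> times insertion of \<open>\<ell> = 1/2 (id \<sqinter> id)\<close>.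

  Splitting a shuffle according to the preimage of 0 turns the sums over shuffles in the braces into
  the recursive operations above.  When the \<open>L\<^sub>\<infinity>\<close>-structure is twisted, the factorials cancel against the sums over
  permutations of equal arguments, and \<open>i\<close> copies of \<open>T\<close> contribute the summands with \<open>|I| = i - 1\<close> of \<open>\<Phi>\<close>.
\<close>

section \<open>Signed sums over splittings of a list\<close>

text \<open>Since \<gg> sits in degree 0, every argument taken from s\<gg> has degree 1. Koszul
  signs of permutations are then signatures, and an element of degree p of the operator part is a
  single alternating map of arity -p, so one integer records both degree and arity, and most sign
  identities reduce to a case split on parities. The obstacle is the shuffles: comparing iterated
  braces directly would require composing shuffles of several blocks. The Leibniz rules under
  contraction avoid this, leaving only values on the empty list to check, where nonzero values force
  arity 0. The bracket of the transformation Lie algebra arises as follows: for \<open>K\<close> and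
  \<open>L\<close>, the Nijenhuis-Richardson bracket of \<open>-(K \<sqinter> idc)\<close> and
  \<open>-(L \<sqinter> idc)\<close> is again of the form \<open>-(M \<sqinter> idc)\<close>, with
  \<open>M\<close> equal to \<open>lbr\<close> of \<open>K\<close> and \<open>L\<close>. The
  L-infinity relations are established on the operator part, where the two slots of the bracket
  leave no operation with three or more arguments. For the full algebra it suffices to evaluate the
  Maurer-Cartan series at the given element and the twisted differential on one argument.\<close>

definition sg :: "int \<Rightarrow> 'v::ab_group_add \<Rightarrow> 'v" where
  "sg e v = (if even e then v else - v)"

lemma sg_zero [simp]: "sg e 0 = 0"
  by (simp add: sg_def)

lemma sg_apply [simp]: "sg e f x = sg e (f x)"
  by (simp add: sg_def)

lemma sg_plus: "sg e (u + v) = sg e u + sg e v"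
  by (simp add: sg_def)

lemma sg_minus: "sg e (- v) = - sg e v"
  by (simp add: sg_def)

lemma sg_sg: "sg e (sg e' v) = sg (e + e') v"
  by (simp add: sg_def)

lemma sg_int_0 [simp]: "sg 0 v = v"
  by (simp add: sg_def)

text \<open>
  The sum over all splittings of \<open>xs\<close> into complementary subsequences \<open>A\<close> and \<open>B\<close>, with the sign of the
  shuffle that moves \<open>A\<close> in front of \<open>B\<close>.
\<close>

fun usum :: "('a list \<Rightarrow> 'a list \<Rightarrow> 'v::ab_group_add) \<Rightarrow> 'a list \<Rightarrow> 'v" where
  "usum F [] = F [] []"
| "usum F (x # xs) =
     usum (\<lambda>A B. F (x # A) B) xs + usum (\<lambda>A B. sg (int (length A)) (F A (x # B))) xs"

lemma usum_add: "usum (\<lambda>A B. F A B + G A B) xs = usum F xs + usum G xs"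
  by (induction xs arbitrary: F G) (simp_all add: sg_plus algebra_simps)

lemma usum_hom:
  assumes "\<And>u v. h (u + v) = h u + h v" "\<And>u. h (- u) = - h u"
  shows "usum (\<lambda>A B. h (F A B)) xs = h (usum F xs)"
proof (induction xs arbitrary: F)
  case (Cons x xs)
  have "sg e (h u) = h (sg e u)" for e u
    using assms by (simp add: sg_def)
  then show ?case
    by (simp add: Cons.IH assms)
qed simp

lemma usum_sg: "usum (\<lambda>A B. sg e (F A B)) xs = sg e (usum F xs)"
  by (rule usum_hom) (simp_all add: sg_plus sg_minus)

lemma usum_uminus: "usum (\<lambda>A B. - F A B) xs = - usum F xs"
  by (rule usum_hom) simp_all

lemma usum_cong:
  assumes "\<And>A B. length A + length B = length xs \<Longrightarrow> F A B = G A B"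
  shows "usum F xs = usum G xs"
  using assms
proof (induction xs arbitrary: F G)
  case (Cons x xs)
  show ?case
    by (simp, intro arg_cong2[where f = "(+)"] Cons.IH) (simp_all add: Cons.prems)
qed simp

lemma usum_zero [simp]: "usum (\<lambda>A B. 0) xs = 0"
  by (induction xs) simp_all

section \<open>Shuffle products, insertions and contractions\<close>

definition wedge :: "('v::ab_group_add \<Rightarrow> 'w::ab_group_add \<Rightarrow> 'u::ab_group_add) \<Rightarrow>
    ('a list \<Rightarrow> 'v) \<Rightarrow> ('a list \<Rightarrow> 'w) \<Rightarrow> 'a list \<Rightarrow> 'u" where
  "wedge B K L = usum (\<lambda>X Y. B (K X) (L Y))"

text \<open>The Nijenhuis-Richardson insertion: the output of \<open>H\<close> fills the first slot
  of \<open>f\<close>. For cochains it is the brace of \<open>f\<close> with the single argument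
  \<open>H\<close> (\<open>brace_one\<close>).\<close>

definition ins :: "('a list \<Rightarrow> 'a) \<Rightarrow> ('a list \<Rightarrow> 'v::ab_group_add) \<Rightarrow> 'a list \<Rightarrow> 'v" where
  "ins H f = usum (\<lambda>X Y. f (H X # Y))"

definition contr :: "'a \<Rightarrow> ('a list \<Rightarrow> 'v) \<Rightarrow> 'a list \<Rightarrow> 'v" where
  "contr x f = (\<lambda>ws. f (x # ws))"

lemma contr_apply: "contr x f ws = f (x # ws)"
  by (simp add: contr_def)

lemma contr_add: "contr x (f + g) = contr x f + contr x g"
  by (simp add: fun_eq_iff contr_apply)

lemma contr_sg: "contr x (sg e f) = sg e (contr x f)"
  by (simp add: fun_eq_iff contr_apply)

text \<open>The arity is an integer so that contraction can lower it without a side condition. A map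
  supported in negative arity is zero, and the zero map is supported in every arity.\<close>

definition supported :: "int \<Rightarrow> ('a list \<Rightarrow> 'v::zero) \<Rightarrow> bool" where
  "supported a f \<longleftrightarrow> (\<forall>ws. f ws \<noteq> 0 \<longrightarrow> int (length ws) = a)"

lemma supported_contr: "supported a f \<Longrightarrow> supported (a - 1) (contr x f)"
  by (fastforce simp: supported_def contr_apply)

text \<open>Replaces a sign depending on the length of the left block by a fixed one: where that
  length differs from \<open>a\<close>, both sides vanish.\<close>

lemma supported_sg: "supported a f \<Longrightarrow> sg (int (length X)) (f X) = sg a (f X)"
  by (cases "f X = 0") (auto simp: supported_def)

definition biadd :: "('v::ab_group_add \<Rightarrow> 'w::ab_group_add \<Rightarrow> 'u::ab_group_add) \<Rightarrow> bool" where
  "biadd B \<longleftrightarrow> (\<forall>x y z. B (x + y) z = B x z + B y z) \<and> (\<forall>x y z. B x (y + z) = B x y + B x z)"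

lemma biadd_zero:
  assumes "biadd B"
  shows "B 0 y = 0" "B x 0 = 0"
proof -
  have "B (0 + 0) y = B 0 y + B 0 y" "B x (0 + 0) = B x 0 + B x 0"
    using assms unfolding biadd_def by blast+
  then show "B 0 y = 0" "B x 0 = 0"
    by simp_all
qed

lemma biadd_minus:
  assumes "biadd B"
  shows "B (- x) y = - B x y" "B x (- y) = - B x y"
proof -
  have "B (x + - x) y = B x y + B (- x) y" "B x (y + - y) = B x y + B x (- y)"
    using assms unfolding biadd_def by blast+
  then show "B (- x) y = - B x y" "B x (- y) = - B x y"
    by (simp_all add: biadd_zero[OF assms] eq_neg_iff_add_eq_0 add.commute)
qed

lemma biadd_sg:
  assumes "biadd B"
  shows "B (sg e x) y = sg e (B x y)" "B x (sg e y) = sg e (B x y)"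
  using biadd_minus[OF assms] by (simp_all add: sg_def)

lemma wedge_Nil [simp]: "wedge B K L [] = B (K []) (L [])"
  by (simp add: wedge_def)

lemma wedge_add:
  assumes "biadd B"
  shows "wedge B (K + K') L = wedge B K L + wedge B K' L"
    "wedge B K (L + L') = wedge B K L + wedge B K L'"
  using assms by (simp_all add: wedge_def fun_eq_iff biadd_def usum_add)

lemma wedge_uminus:
  assumes "biadd B"
  shows "wedge B (- K) L = - wedge B K L" "wedge B K (- L) = - wedge B K L"
  by (simp_all add: wedge_def fun_eq_iff biadd_minus[OF assms] usum_uminus)

lemma wedge_sg:
  assumes "biadd B"
  shows "wedge B (sg e K) L = sg e (wedge B K L)" "wedge B K (sg e L) = sg e (wedge B K L)"
  by (simp_all add: sg_def wedge_uminus[OF assms])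

lemma wedge_zero:
  assumes "biadd B"
  shows "wedge B 0 L = 0" "wedge B K 0 = 0"
  by (simp_all add: wedge_def fun_eq_iff biadd_zero[OF assms])

text \<open>The two summands of \<open>usum\<close> put \<open>x\<close> into the left or the right
  block; in the second one \<open>x\<close> passes a left block whose length is \<open>a\<close>
  wherever \<open>K\<close> is nonzero.\<close>

lemma contr_wedge:
  assumes "biadd B" "supported a K"
  shows "contr x (wedge B K L) = wedge B (contr x K) L + sg a (wedge B K (contr x L))"
proof
  fix ws
  have "sg (int (length X)) (B (K X) u) = sg a (B (K X) u)" for X :: "'d list" and u
    using supported_sg[OF assms(2), of X] biadd_sg[OF assms(1)] by metis
  then show "contr x (wedge B K L) ws = (wedge B (contr x K) L + sg a (wedge B K (contr x L))) ws"
    by (simp add: wedge_def usum_sg contr_apply)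
qed

lemma supported_wedge:
  fixes K :: "'a list \<Rightarrow> _"
  assumes "biadd B" "supported a K" "supported b L"
  shows "supported (a + b) (wedge B K L)"
proof -
  have "wedge B K L ws = 0" if "int (length ws) \<noteq> a + b" for ws
    unfolding wedge_def
  proof (subst usum_cong[where G = "\<lambda>_ _. 0"])
    fix X Y :: "'a list" assume "length X + length Y = length ws"
    with that have "K X = 0 \<or> L Y = 0"
      using assms(2,3) unfolding supported_def by (metis of_nat_add)
    then show "B (K X) (L Y) = 0"
      using biadd_zero[OF assms(1)] by auto
  qed simp
  then show ?thesis
    by (auto simp: supported_def)
qed

text \<open>Contraction lowers one of the two arities and so changes \<open>a * b\<close> by the
  other one, which is the sign produced by the Leibniz rule. On the empty list nonzero values force
  \<open>a = b = 0\<close>, and the skew symmetry of \<open>B\<close> remains.\<close>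

lemma wedge_skew:
  assumes "biadd B" "\<And>x y. B x y = - B y x" "supported a K" "supported b L"
  shows "wedge B K L = - sg (a * b) (wedge B L K)"
proof
  fix ws
  show "wedge B K L ws = (- sg (a * b) (wedge B L K)) ws"
    using assms(3,4)
  proof (induction ws arbitrary: K L a b)
    case Nil
    then show ?case
      using assms(2)[of "K []" "L []"] biadd_zero[OF assms(1)]
      by (cases "K [] = 0 \<or> L [] = 0") (auto simp: supported_def)
  next
    case (Cons x ws)
    have "wedge B K L (x # ws) = (wedge B (contr x K) L + sg a (wedge B K (contr x L))) ws"
      using contr_wedge[OF assms(1) Cons.prems(1), of x L] by (metis contr_apply)
    moreover have "wedge B L K (x # ws) = (wedge B (contr x L) K + sg b (wedge B L (contr x K))) ws"
      using contr_wedge[OF assms(1) Cons.prems(2), of x K] by (metis contr_apply)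
    moreover note Cons.IH[OF supported_contr[OF Cons.prems(1)] Cons.prems(2), of x]
      Cons.IH[OF Cons.prems(1) supported_contr[OF Cons.prems(2)], of x]
    ultimately show ?case
      by (cases "even a"; cases "even b") (simp_all add: sg_def)
  qed
qed

text \<open>Same induction as for \<open>wedge_skew\<close>. The base case is the assumption on
  \<open>B\<close>, which says that every \<open>B x\<close> is a derivation of
  \<open>B\<close>.\<close>

lemma wedge_jacobi:
  assumes "biadd B" "\<And>x y z. B x (B y z) = B (B x y) z + B y (B x z)"
    "supported a K" "supported b L" "supported c M"
  shows "wedge B K (wedge B L M) =
    wedge B (wedge B K L) M + sg (a * b) (wedge B L (wedge B K M))"
proof
  fix ws
  show "wedge B K (wedge B L M) ws =
      (wedge B (wedge B K L) M + sg (a * b) (wedge B L (wedge B K M))) ws"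
    using assms(3-5)
  proof (induction ws arbitrary: K L M a b c)
    case Nil
    show ?case
    proof (cases "K [] = 0 \<or> L [] = 0")
      case True
      then show ?thesis
        by (auto simp: biadd_zero[OF assms(1)])
    next
      case False
      then have "a = 0" "b = 0"
        using Nil by (auto simp: supported_def)
      then show ?thesis
        by (simp add: assms(2)[of "K []" "L []" "M []"])
    qed
  next
    case (Cons x ws)
    note c = contr_wedge[OF assms(1) Cons.prems(1)] contr_wedge[OF assms(1) Cons.prems(2)]
      contr_wedge[OF assms(1) supported_wedge[OF assms(1) Cons.prems(1,2)]]
    note lin = wedge_add[OF assms(1)] wedge_sg[OF assms(1)] contr_add contr_sg
    note IH = Cons.IH[OF supported_contr[OF Cons.prems(1)] Cons.prems(2,3), of x]
      Cons.IH[OF Cons.prems(1) supported_contr[OF Cons.prems(2)] Cons.prems(3), of x]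
      Cons.IH[OF Cons.prems(1,2) supported_contr[OF Cons.prems(3)], of x]
    have "contr x (wedge B K (wedge B L M)) ws =
      contr x (wedge B (wedge B K L) M + sg (a * b) (wedge B L (wedge B K M))) ws"
      unfolding c lin plus_fun_apply sg_apply IH
      by (cases "even a"; cases "even b") (simp_all add: sg_def)
    then show ?case
      by (simp add: contr_apply)
  qed
qed

lemma supportedD: "supported a f \<Longrightarrow> f ws \<noteq> 0 \<Longrightarrow> int (length ws) = a"
  by (simp add: supported_def)

section \<open>Alternating cochains on a Lie algebra\<close>

locale lie_alg =
  fixes scale :: "'k::field_char_0 \<Rightarrow> 'g::ab_group_add \<Rightarrow> 'g"
    and br :: "'g \<Rightarrow> 'g \<Rightarrow> 'g"
  assumes lie: "lie_algebra scale br"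
begin

lemma vector_space: "vector_space scale"
  using lie by (simp add: lie_algebra_def)

sublocale vector_space scale
  by (rule vector_space)

lemma br_add: "br (x + y) z = br x z + br y z" "br x (y + z) = br x y + br x z"
  and br_scale: "br (scale c x) y = scale c (br x y)" "br x (scale c y) = scale c (br x y)"
  using lie unfolding lie_algebra_def linear_iff_module_hom module_hom_iff by auto

lemma biadd_br: "biadd br"
  by (simp add: biadd_def br_add)

lemma br_self [simp]: "br x x = 0"
  using lie by (simp add: lie_algebra_def)

lemma br_skew: "br x y = - br y x"
proof -
  have "br (x + y) (x + y) = 0"
    by (rule br_self)
  then show ?thesis
    by (simp add: br_add del: br_self) (simp add: add_eq_0_iff)
qed

text \<open>The derivation form of the Jacobi identity, as required by
  \<open>wedge_jacobi\<close>.\<close>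

lemma br_jacobi: "br x (br y z) = br (br x y) z + br y (br x z)"
proof -
  have "br x (br y z) + br y (br z x) + br z (br x y) = 0"
    using lie by (simp add: lie_algebra_def)
  moreover have "br y (br z x) = - br y (br x z)"
    by (subst br_skew[of z x]) (rule biadd_minus(2)[OF biadd_br])
  moreover have "br z (br x y) = - br (br x y) z"
    by (rule br_skew)
  ultimately show ?thesis
    by (simp add: algebra_simps)
qed

text \<open>The working form of \<open>alt_cochains\<close>. Conditions with an arbitrary prefix
  \<open>us\<close> pass to contractions by taking \<open>x # us\<close>, and asking for equal
  neighbours only keeps the inductions on \<open>us\<close> short; equal entries at a distance
  follow in \<open>cochain_alt_far\<close>.\<close>

definition cochain :: "int \<Rightarrow> ('g list \<Rightarrow> 'g) \<Rightarrow> bool" where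
  "cochain a f \<longleftrightarrow> supported a f \<and>
     (\<forall>us x y ws. f (us @ (x + y) # ws) = f (us @ x # ws) + f (us @ y # ws)) \<and>
     (\<forall>us c x ws. f (us @ scale c x # ws) = scale c (f (us @ x # ws))) \<and>
     (\<forall>us x ws. f (us @ x # x # ws) = 0)"

lemma cochainI:
  assumes "supported a f"
    "\<And>us x y ws. f (us @ (x + y) # ws) = f (us @ x # ws) + f (us @ y # ws)"
    "\<And>us c x ws. f (us @ scale c x # ws) = scale c (f (us @ x # ws))"
    "\<And>us x ws. f (us @ x # x # ws) = 0"
  shows "cochain a f"
  using assms by (simp add: cochain_def)

lemma cochain_supported: "cochain a f \<Longrightarrow> supported a f"
  by (simp add: cochain_def)

lemma cochain_add: "cochain a f \<Longrightarrow> f (us @ (x + y) # ws) = f (us @ x # ws) + f (us @ y # ws)"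
  and cochain_scale: "cochain a f \<Longrightarrow> f (us @ scale c x # ws) = scale c (f (us @ x # ws))"
  and cochain_alt: "cochain a f \<Longrightarrow> f (us @ x # x # ws) = 0"
  by (simp_all add: cochain_def)

lemma cochain_zero: "cochain a f \<Longrightarrow> f (us @ 0 # ws) = 0"
  using cochain_add[of a f us 0 0 ws] by simp

lemma cochain_minus: "cochain a f \<Longrightarrow> f (us @ (- x) # ws) = - f (us @ x # ws)"
  using cochain_add[of a f us x "- x" ws] by (simp add: cochain_zero eq_neg_iff_add_eq_0 add.commute)

lemma cochain_swap:
  assumes "cochain a f"
  shows "f (us @ x # y # ws) = - f (us @ y # x # ws)"
proof -
  have "f (us @ (x + y) # (x + y) # ws) = 0"
    by (rule cochain_alt[OF assms])
  then have "f (us @ x # y # ws) + f (us @ y # x # ws) = 0"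
    using cochain_add[OF assms, of us x y "x # ws"] cochain_add[OF assms, of us x y "y # ws"]
      cochain_add[OF assms, of "us @ [x + y]" x y ws] cochain_alt[OF assms]
    by (simp add: add.commute)
  then show ?thesis
    by (simp add: eq_neg_iff_add_eq_0)
qed

lemmas cochain_Cons =
  cochain_add[where us = "[]", simplified] cochain_zero[where us = "[]", simplified]
  cochain_minus[where us = "[]", simplified] cochain_scale[where us = "[]", simplified]
  cochain_alt[where us = "[]", simplified]

lemma cochain_contr:
  assumes "cochain a f"
  shows "cochain (a - 1) (contr x f)"
  by (rule cochainI; (simp add: contr_apply supported_contr cochain_supported[OF assms])?)
    (use cochain_add[OF assms, of "x # _"] cochain_scale[OF assms, of "x # _"]
      cochain_alt[OF assms, of "x # _"] in simp_all)

lemma cochain_zero_fun: "cochain a 0"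
  by (simp add: cochain_def supported_def)

lemma supported_plus:
  fixes f g :: "'g list \<Rightarrow> 'g"
  assumes "supported a f" "supported a g"
  shows "supported a (f + g)"
  unfolding supported_def
proof (intro allI impI)
  fix ws assume "(f + g) ws \<noteq> 0"
  then have "f ws \<noteq> 0 \<or> g ws \<noteq> 0"
    by auto
  then show "int (length ws) = a"
    using assms by (auto simp: supported_def)
qed

lemma cochain_plus:
  assumes "cochain a f" "cochain a g"
  shows "cochain a (f + g)"
  by (rule cochainI, rule supported_plus[OF cochain_supported[OF assms(1)] cochain_supported[OF assms(2)]])
    (simp_all add: cochain_add[OF assms(1)] cochain_add[OF assms(2)] cochain_scale[OF assms(1)]
      cochain_scale[OF assms(2)] cochain_alt[OF assms(1)] cochain_alt[OF assms(2)]
      scale_right_distrib)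

lemma cochain_uminus: "cochain a f \<Longrightarrow> cochain a (- f)"
  by (simp add: cochain_def supported_def)

lemma cochain_sg: "cochain a f \<Longrightarrow> cochain a (sg e f)"
  by (simp add: sg_def cochain_uminus)

lemma cochain_fun_scale: "cochain a f \<Longrightarrow> cochain a (fun_scale scale c f)"
  by (simp add: cochain_def supported_def fun_scale_def scale_right_distrib scale_left_commute)

lemma contr_twice: "cochain a f \<Longrightarrow> contr x (contr x f) = 0"
  using cochain_alt[of a f "[]"] by (simp add: fun_eq_iff contr_apply)

lemma contr_cochain_add: "cochain a f \<Longrightarrow> contr (x + y) f = contr x f + contr y f"
  and contr_cochain_scale: "cochain a f \<Longrightarrow> contr (scale c x) f = fun_scale scale c (contr x f)"
  by (simp_all add: fun_eq_iff contr_apply cochain_Cons fun_scale_def)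

lemma sg_scale: "sg e (scale c v) = scale c (sg e v)"
  by (simp add: sg_def)

lemma usum_scale: "usum (\<lambda>A B. scale c (F A B)) xs = scale c (usum F xs)"
  by (rule usum_hom) (simp_all add: scale_right_distrib)

section \<open>The wedge product along the Lie bracket\<close>

abbreviation wed (infixl "\<sqinter>" 70) where "wed \<equiv> wedge br"

lemmas wed_add = wedge_add[OF biadd_br]
  and wed_sg = wedge_sg[OF biadd_br]
  and wed_uminus = wedge_uminus[OF biadd_br]
  and wed_zero = wedge_zero[OF biadd_br]

lemma wed_scale:
  "fun_scale scale c K \<sqinter> L = fun_scale scale c (K \<sqinter> L)"
  "K \<sqinter> fun_scale scale c L = fun_scale scale c (K \<sqinter> L)"
  by (simp_all add: wedge_def fun_scale_def fun_eq_iff br_scale usum_scale)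

lemma contr_wed: "cochain a K \<Longrightarrow> contr x (K \<sqinter> L) = contr x K \<sqinter> L + sg a (K \<sqinter> contr x L)"
  by (rule contr_wedge[OF biadd_br cochain_supported])

lemma wed_Cons:
  "cochain a K \<Longrightarrow> (K \<sqinter> L) (x # ws) = (contr x K \<sqinter> L) ws + sg a ((K \<sqinter> contr x L) ws)"
  using fun_cong[OF contr_wed[of a K x L], of ws] by (simp add: contr_apply)

text \<open>The Leibniz rule peels off the prefix \<open>us\<close> one argument at a time, each
  time replacing one factor by its contraction. Only the case of an empty prefix uses the
  corresponding property of \<open>K\<close> and \<open>L\<close>.\<close>

lemma cochain_wed:
  assumes "cochain a K" "cochain b L"
  shows "cochain (a + b) (K \<sqinter> L)"
proof (rule cochainI)
  show "supported (a + b) (K \<sqinter> L)"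
    by (intro supported_wedge biadd_br cochain_supported assms)
  show "(K \<sqinter> L) (us @ (x + y) # ws) = (K \<sqinter> L) (us @ x # ws) + (K \<sqinter> L) (us @ y # ws)" for us x y ws
    using assms
  proof (induction us arbitrary: K L a b)
    case Nil
    then show ?case
      by (simp add: wed_Cons[OF Nil(1)] contr_cochain_add[OF Nil(1)] contr_cochain_add[OF Nil(2)]
          wed_add sg_plus)
  next
    case (Cons u us)
    show ?case
      using Cons.IH[OF cochain_contr[OF Cons.prems(1)] Cons.prems(2), of u]
        Cons.IH[OF Cons.prems(1) cochain_contr[OF Cons.prems(2)], of u]
      by (simp add: wed_Cons[OF Cons.prems(1)] sg_plus)
  qed
  show "(K \<sqinter> L) (us @ scale c x # ws) = scale c ((K \<sqinter> L) (us @ x # ws))" for us c x ws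
    using assms
  proof (induction us arbitrary: K L a b)
    case Nil
    then show ?case
      by (simp add: wed_Cons[OF Nil(1)] contr_cochain_scale[OF Nil(1)] contr_cochain_scale[OF Nil(2)]
          wed_scale sg_scale scale_right_distrib) (simp add: fun_scale_def sg_scale)
  next
    case (Cons u us)
    show ?case
      using Cons.IH[OF cochain_contr[OF Cons.prems(1)] Cons.prems(2), of u]
        Cons.IH[OF Cons.prems(1) cochain_contr[OF Cons.prems(2)], of u]
      by (simp add: wed_Cons[OF Cons.prems(1)] sg_scale scale_right_distrib)
  qed
  show "(K \<sqinter> L) (us @ x # x # ws) = 0" for us x ws
    using assms
  proof (induction us arbitrary: K L a b)
    \<comment> \<open>Contracting twice by \<open>x\<close> leaves the mixed term
      \<open>contr x K \<sqinter> contr x L\<close> with the signs of \<open>a - 1\<close> and of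
      \<open>a\<close>, which cancel; the other two terms contain a double contraction.\<close>
    case Nil
    then show ?case
      by (simp add: wed_Cons[OF Nil(1)] wed_Cons[OF cochain_contr[OF Nil(1)]]
          contr_twice[OF Nil(1)] contr_twice[OF Nil(2)] wed_zero) (simp add: sg_def)
  next
    case (Cons u us)
    show ?case
      using Cons.IH[OF cochain_contr[OF Cons.prems(1)] Cons.prems(2), of u]
        Cons.IH[OF Cons.prems(1) cochain_contr[OF Cons.prems(2)], of u]
      by (simp add: wed_Cons[OF Cons.prems(1)])
  qed
qed

section \<open>Insertion of cochains\<close>

lemma ins_add_right: "ins H (f + g) = ins H f + ins H g"
  by (simp add: ins_def fun_eq_iff usum_add)

lemma ins_uminus_right: "ins H (- f) = - ins H f"
  by (simp add: ins_def fun_eq_iff usum_uminus)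

lemma ins_sg_right: "ins H (sg e f) = sg e (ins H f)"
  by (simp add: sg_def ins_uminus_right)

lemma ins_zero_right: "ins H 0 = 0"
  by (simp add: ins_def fun_eq_iff)

lemma ins_scale_right: "ins H (fun_scale scale c f) = fun_scale scale c (ins H f)"
  by (simp add: ins_def fun_eq_iff fun_scale_def usum_scale)

lemma ins_add_left: "cochain a f \<Longrightarrow> ins (H + H') f = ins H f + ins H' f"
  by (simp add: ins_def fun_eq_iff cochain_Cons usum_add)

lemma ins_uminus_left: "cochain a f \<Longrightarrow> ins (- H) f = - ins H f"
  by (simp add: ins_def fun_eq_iff cochain_Cons usum_uminus)

lemma ins_sg_left: "cochain a f \<Longrightarrow> ins (sg e H) f = sg e (ins H f)"
  by (simp add: sg_def ins_uminus_left)

lemma ins_zero_left: "cochain a f \<Longrightarrow> ins 0 f = 0"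
  by (simp add: ins_def fun_eq_iff cochain_Cons)

lemma ins_scale_left: "cochain a f \<Longrightarrow> ins (fun_scale scale c H) f = fun_scale scale c (ins H f)"
  by (simp add: ins_def fun_eq_iff fun_scale_def cochain_Cons usum_scale)

lemma ins_Nil [simp]: "ins H f [] = f [H []]"
  by (simp add: ins_def)

text \<open>Either \<open>x\<close> becomes the first argument of \<open>H\<close>, or it stays
  outside. In the second case it passes the \<open>h\<close> arguments of \<open>H\<close> by the
  sign in \<open>usum\<close>, and then the output of \<open>H\<close> by one swap inside
  \<open>f\<close>, which explains the exponent \<open>h + 1\<close>.\<close>

lemma ins_Cons:
  assumes "supported h H" "cochain a f"
  shows "ins H f (x # ws) = ins (contr x H) f ws + sg (h + 1) (ins H (contr x f) ws)"
proof -
  have "sg (int (length X)) (f (H X # x # Y)) = sg (h + 1) (f (x # H X # Y))" for X Y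
  proof (cases "H X = 0")
    case True
    then show ?thesis
      using cochain_zero[OF assms(2), of "[]"] cochain_zero[OF assms(2), of "[x]"] by simp
  next
    case False
    then have "h = int (length X)"
      using assms(1) by (simp add: supported_def)
    then show ?thesis
      using cochain_swap[OF assms(2), of "[]" "H X" x Y] by (simp add: sg_def)
  qed
  then show ?thesis
    by (simp add: ins_def contr_apply usum_sg)
qed

lemma contr_ins:
  assumes "supported h H" "cochain a f"
  shows "contr x (ins H f) = ins (contr x H) f + sg (h + 1) (ins H (contr x f))"
  by (simp add: fun_eq_iff contr_apply ins_Cons[OF assms])

text \<open>Inductions on the prefix as in \<open>cochain_wed\<close>. For alternation the mixed
  term \<open>ins (contr x H) (contr x f)\<close> occurs with the signs of \<open>h\<close> and
  \<open>h + 1\<close>.\<close>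

lemma cochain_ins:
  assumes "cochain h H" "cochain a f"
  shows "cochain (h + a - 1) (ins H f)"
proof (rule cochainI)
  show "supported (h + a - 1) (ins H f)"
  proof -
    have "ins H f ws = 0" if "int (length ws) \<noteq> h + a - 1" for ws
      unfolding ins_def
    proof (subst usum_cong[where G = "\<lambda>_ _. 0"])
      fix X Y :: "'g list" assume "length X + length Y = length ws"
      with that have "int (length X) \<noteq> h \<or> int (length (H X # Y)) \<noteq> a"
        by auto
      then have "H X = 0 \<or> f (H X # Y) = 0"
        using cochain_supported[OF assms(1)] cochain_supported[OF assms(2)]
        unfolding supported_def by blast
      then show "f (H X # Y) = 0"
        using cochain_zero[OF assms(2), of "[]"] by auto
    qed simp
    then show ?thesis
      by (auto simp: supported_def)
  qed
  show "ins H f (us @ (x + y) # ws) = ins H f (us @ x # ws) + ins H f (us @ y # ws)" for us x y ws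
    using assms
  proof (induction us arbitrary: H f h a)
    case Nil
    then show ?case
      by (simp add: ins_Cons[OF cochain_supported[OF Nil(1)] Nil(2)] contr_cochain_add[OF Nil(1)]
          contr_cochain_add[OF Nil(2)] ins_add_left[OF Nil(2)] ins_add_right sg_plus)
  next
    case (Cons u us)
    show ?case
      using Cons.IH[OF cochain_contr[OF Cons.prems(1)] Cons.prems(2), of u]
        Cons.IH[OF Cons.prems(1) cochain_contr[OF Cons.prems(2)], of u]
      by (simp add: ins_Cons[OF cochain_supported[OF Cons.prems(1)] Cons.prems(2)] sg_plus)
  qed
  show "ins H f (us @ scale c x # ws) = scale c (ins H f (us @ x # ws))" for us c x ws
    using assms
  proof (induction us arbitrary: H f h a)
    case Nil
    then show ?case
      by (simp add: ins_Cons[OF cochain_supported[OF Nil(1)] Nil(2)] contr_cochain_scale[OF Nil(1)]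
          contr_cochain_scale[OF Nil(2)] ins_scale_left[OF Nil(2)] ins_scale_right sg_scale
          scale_right_distrib) (simp add: fun_scale_def sg_scale)
  next
    case (Cons u us)
    show ?case
      using Cons.IH[OF cochain_contr[OF Cons.prems(1)] Cons.prems(2), of u]
        Cons.IH[OF Cons.prems(1) cochain_contr[OF Cons.prems(2)], of u]
      by (simp add: ins_Cons[OF cochain_supported[OF Cons.prems(1)] Cons.prems(2)] sg_scale
          scale_right_distrib)
  qed
  show "ins H f (us @ x # x # ws) = 0" for us x ws
    using assms
  proof (induction us arbitrary: H f h a)
    case Nil
    note s = cochain_supported[OF Nil(1)] cochain_supported[OF cochain_contr[OF Nil(1)]]
    show ?case
      by (simp add: ins_Cons[OF s(1) Nil(2)] ins_Cons[OF s(2) Nil(2)]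
          ins_Cons[OF s(1) cochain_contr[OF Nil(2)]] contr_twice[OF Nil(1)] contr_twice[OF Nil(2)]
          ins_zero_left[OF Nil(2)] ins_zero_right) (simp add: sg_def)
  next
    case (Cons u us)
    show ?case
      using Cons.IH[OF cochain_contr[OF Cons.prems(1)] Cons.prems(2), of u]
        Cons.IH[OF Cons.prems(1) cochain_contr[OF Cons.prems(2)], of u]
      by (simp add: ins_Cons[OF cochain_supported[OF Cons.prems(1)] Cons.prems(2)])
  qed
qed

text \<open>Inserting a map of arity \<open>h\<close> changes the arity by \<open>h - 1\<close>, so
  it is a derivation of degree \<open>h - 1\<close>, which has the parity of \<open>h + 1\<close>.
  Every term of the contracted identity has exactly one of \<open>H\<close>, \<open>K\<close>,
  \<open>L\<close> contracted, so three instances of the induction hypothesis suffice.\<close>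

lemma ins_wed:
  assumes "cochain h H" "cochain a K" "cochain b L"
  shows "ins H (K \<sqinter> L) = ins H K \<sqinter> L + sg ((h + 1) * a) (K \<sqinter> ins H L)"
proof
  fix ws
  show "ins H (K \<sqinter> L) ws = (ins H K \<sqinter> L + sg ((h + 1) * a) (K \<sqinter> ins H L)) ws"
    using assms
  proof (induction ws arbitrary: H K L h a b)
    case Nil
    show ?case
    proof (cases "K [] = 0")
      case True
      then show ?thesis
        by (simp add: wed_Cons[OF Nil(2)] contr_apply biadd_zero[OF biadd_br])
    next
      case False
      then have "a = 0"
        using cochain_supported[OF Nil(2)] by (auto simp: supported_def)
      then show ?thesis
        by (simp add: wed_Cons[OF Nil(2)] contr_apply)
    qed
  next
    case (Cons x ws)
    note s = cochain_supported[OF Cons.prems(1)]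
    note IH = Cons.IH[OF cochain_contr[OF Cons.prems(1)] Cons.prems(2,3), of x]
      Cons.IH[OF Cons.prems(1) cochain_contr[OF Cons.prems(2)] Cons.prems(3), of x]
      Cons.IH[OF Cons.prems(1,2) cochain_contr[OF Cons.prems(3)], of x]
    note c = contr_wed[OF Cons.prems(2)] contr_wed[OF cochain_ins[OF Cons.prems(1,2)]]
      contr_ins[OF s cochain_wed[OF Cons.prems(2,3)]] contr_ins[OF s Cons.prems(2)]
      contr_ins[OF s Cons.prems(3)]
    note lin = wed_add wed_sg contr_add contr_sg ins_add_right ins_sg_right
    have "contr x (ins H (K \<sqinter> L)) ws =
      contr x (ins H K \<sqinter> L + sg ((h + 1) * a) (K \<sqinter> ins H L)) ws"
      unfolding c lin plus_fun_apply sg_apply IH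
      by (cases "even a"; cases "even h") (simp_all add: sg_def)
    then show ?case
      by (simp add: contr_apply)
  qed
qed

text \<open>The graded pre-Lie identity. The terms in which \<open>H\<close> and \<open>G\<close>
  occupy different slots of \<open>f\<close> cancel in the graded commutator of the two insertions,
  and what remains is the insertion of the Nijenhuis-Richardson bracket of \<open>H\<close> and
  \<open>G\<close>. The degrees are \<open>h - 1\<close> and \<open>a - 1\<close>, and
  \<open>h * a + h + a\<close> has the parity of \<open>(h - 1) * (a - 1) + 1\<close>.\<close>

lemma ins_ins:
  assumes "cochain h H" "cochain a G" "cochain b f"
  shows "ins H (ins G f) + sg (h * a + h + a) (ins G (ins H f))
    = ins (ins H G) f + sg (h * a + h + a) (ins (ins G H) f)"
proof
  fix ws
  show "(ins H (ins G f) + sg (h * a + h + a) (ins G (ins H f))) ws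
    = (ins (ins H G) f + sg (h * a + h + a) (ins (ins G H) f)) ws"
    using assms
  proof (induction ws arbitrary: H G f h a b)
    case Nil
    note s = cochain_supported[OF Nil(1)] cochain_supported[OF Nil(2)]
    have sw: "f [H [], G []] = - f [G [], H []]"
      using cochain_swap[OF Nil(3), of "[]" "H []" "G []" "[]"] by simp
    have z: "f [0, u] = 0" "f [u, 0] = 0" for u
      using cochain_zero[OF Nil(3), of "[]"] cochain_zero[OF Nil(3), of "[u]"] by simp_all
    consider "H [] = 0" | "G [] = 0" | "h = 0" "a = 0"
      using supportedD[OF s(1), of "[]"] supportedD[OF s(2), of "[]"] by auto
    then show ?case
      by cases (simp_all add: ins_Cons[OF s(1) Nil(3)] ins_Cons[OF s(2) Nil(3)] contr_apply z sg_plus,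
        simp_all add: sw sg_def)
  next
    case (Cons x ws)
    note s = cochain_supported[OF Cons.prems(1)] cochain_supported[OF Cons.prems(2)]
    note i = cochain_ins[OF Cons.prems(1,2)] cochain_ins[OF Cons.prems(2,1)]
    note j = cochain_ins[OF Cons.prems(1,3)] cochain_ins[OF Cons.prems(2,3)]
    note IH = Cons.IH[OF cochain_contr[OF Cons.prems(1)] Cons.prems(2,3), of x]
      Cons.IH[OF Cons.prems(1) cochain_contr[OF Cons.prems(2)] Cons.prems(3), of x]
      Cons.IH[OF Cons.prems(1,2) cochain_contr[OF Cons.prems(3)], of x]
    note c = contr_ins[OF s(1) Cons.prems(3)] contr_ins[OF s(2) Cons.prems(3)]
      contr_ins[OF s(1) Cons.prems(2)] contr_ins[OF s(2) Cons.prems(1)]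
      contr_ins[OF cochain_supported[OF i(1)] Cons.prems(3)]
      contr_ins[OF cochain_supported[OF i(2)] Cons.prems(3)]
      contr_ins[OF s(1) j(2)] contr_ins[OF s(2) j(1)]
    note lin = contr_add contr_sg ins_add_right ins_sg_right
      ins_add_left[OF Cons.prems(3)] ins_sg_left[OF Cons.prems(3)]
    have "contr x (ins H (ins G f) + sg (h * a + h + a) (ins G (ins H f))) ws
      = contr x (ins (ins H G) f + sg (h * a + h + a) (ins (ins G H) f)) ws"
      \<comment> \<open>The induction hypotheses have a sum on the left; solving each of them for
        its first summand makes them usable as rewrite rules.\<close>
      unfolding c lin plus_fun_apply sg_apply IH[unfolded plus_fun_apply sg_apply, folded eq_diff_eq]
      by (cases "even a"; cases "even h") (simp_all add: sg_def algebra_simps)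
    then show ?case
      by (simp add: contr_apply)
  qed
qed

end

lemma usum_all_left: "usum (\<lambda>A B. if B = [] then F A else 0) xs = F xs"
proof (induction xs arbitrary: F)
  case (Cons x xs)
  then show ?case
    using Cons.IH[of "\<lambda>A. F (x # A)"] by simp
qed simp

context lie_alg
begin

section \<open>The identity and the bracket as cochains\<close>

lemma double_eq_0D: "u + u = 0 \<Longrightarrow> u = (0::'g)"
  and triple_eq_0D: "u + u + u = 0 \<Longrightarrow> u = (0::'g)"
proof -
  have "scale (1 + 1) u = u + u" "scale (1 + 1 + 1) u = u + u + u"
    by (simp_all only: scale_left_distrib scale_one)
  then show "u + u = 0 \<Longrightarrow> u = (0::'g)" "u + u + u = 0 \<Longrightarrow> u = (0::'g)"
    by (simp_all del: one_add_one)
qed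

lemma double_cancel: "u + u = v + v \<Longrightarrow> u = (v::'g)"
  using double_eq_0D[of "u - v"] by (simp add: algebra_simps)

lemma double_cancel_fun:
  fixes f g :: "'g list \<Rightarrow> 'g"
  shows "f + f = g + g \<Longrightarrow> f = g"
  by (rule ext, rule double_cancel) (metis plus_fun_apply)

text \<open>The identity of \<gg> as a 1-cochain. Through it the bracket becomes half of
  \<open>idc \<sqinter> idc\<close>, so that statements on insertion into or of the bracket reduce
  to the derivation rule \<open>ins_wed\<close>.\<close>

definition idc :: "'g list \<Rightarrow> 'g" where
  "idc xs = (case xs of [x] \<Rightarrow> x | _ \<Rightarrow> 0)"

definition brc :: "'g list \<Rightarrow> 'g" where
  "brc xs = (case xs of [x, y] \<Rightarrow> br x y | _ \<Rightarrow> 0)"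

lemma idc_simps [simp]: "idc [] = 0" "idc [x] = x" "idc (x # y # ws) = 0"
  by (simp_all add: idc_def)

lemma idc_Cons: "idc (x # ws) = (if ws = [] then x else 0)"
  by (simp add: idc_def split: list.split)

lemma brc_simps [simp]: "brc [] = 0" "brc [x] = 0" "brc [x, y] = br x y" "brc (x # y # z # ws) = 0"
  by (simp_all add: brc_def)

lemma cochain_idc: "cochain 1 idc"
proof (rule cochainI)
  show "supported 1 idc"
    by (auto simp: supported_def idc_def split: list.splits)
  show "idc (us @ (x + y) # ws) = idc (us @ x # ws) + idc (us @ y # ws)" for us x y ws
    by (cases us) (auto simp: idc_Cons)
  show "idc (us @ scale c x # ws) = scale c (idc (us @ x # ws))" for us c x ws
    by (cases us) (auto simp: idc_Cons)
  show "idc (us @ x # x # ws) = 0" for us x ws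
    by (cases us) (auto simp: idc_Cons)
qed

lemma ins_idc: "ins H idc = H"
  by (simp add: fun_eq_iff ins_def idc_Cons usum_all_left)

section \<open>The action of cochains by derivations and the bracket \<open>lbr\<close>\<close>

lemma wed_skew:
  assumes "cochain a K" "cochain b L"
  shows "K \<sqinter> L = - sg (a * b) (L \<sqinter> K)"
  by (rule wedge_skew[OF biadd_br br_skew]; rule cochain_supported, rule assms)

lemma wed_jacobi:
  assumes "cochain a K" "cochain b L" "cochain c M"
  shows "K \<sqinter> (L \<sqinter> M) = (K \<sqinter> L) \<sqinter> M + sg (a * b) (L \<sqinter> (K \<sqinter> M))"
  by (rule wedge_jacobi[OF biadd_br br_jacobi]; rule cochain_supported, rule assms)

text \<open>With this sign, \<open>deriv\<close> is a Lie action rather than an anti-action (\<open>deriv_lbr\<close> below).\<close>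

definition deriv :: "('g list \<Rightarrow> 'g) \<Rightarrow> ('g list \<Rightarrow> 'g) \<Rightarrow> 'g list \<Rightarrow> 'g" where
  "deriv K f = - ins (K \<sqinter> idc) f"

lemma cochain_wed_idc: "cochain a K \<Longrightarrow> cochain (a + 1) (K \<sqinter> idc)"
  by (rule cochain_wed[OF _ cochain_idc])

lemma cochain_deriv:
  assumes "cochain a K" "cochain b f"
  shows "cochain (a + b) (deriv K f)"
  using cochain_uminus[OF cochain_ins[OF cochain_wed_idc[OF assms(1)] assms(2)]]
  by (simp add: deriv_def algebra_simps)

lemma deriv_right:
  "deriv K (f + g) = deriv K f + deriv K g"
  "deriv K (- f) = - deriv K f"
  "deriv K (sg e f) = sg e (deriv K f)"
  by (simp_all add: deriv_def ins_add_right ins_uminus_right ins_sg_right sg_minus)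

lemma deriv_left:
  assumes "cochain b f"
  shows "deriv (K + L) f = deriv K f + deriv L f"
    "deriv (- K) f = - deriv K f"
    "deriv (sg e K) f = sg e (deriv K f)"
  by (simp_all add: deriv_def wed_add wed_uminus wed_sg ins_add_left[OF assms]
      ins_uminus_left[OF assms] ins_sg_left[OF assms] sg_minus)

text \<open>\<open>K \<sqinter> idc\<close> has arity \<open>a + 1\<close>, so inserting it is a
  derivation of degree \<open>a\<close>.\<close>

lemma deriv_wed:
  assumes "cochain a K" "cochain b L" "cochain c M"
  shows "deriv K (L \<sqinter> M) = deriv K L \<sqinter> M + sg (a * b) (L \<sqinter> deriv K M)"
  unfolding deriv_def ins_wed[OF cochain_wed_idc[OF assms(1)] assms(2,3)]
  by (simp add: wed_uminus sg_minus) (simp add: sg_def)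

lemma deriv_idc: "deriv K idc = - (K \<sqinter> idc)"
  by (simp add: deriv_def ins_idc)

text \<open>\<open>a\<close> and \<open>b\<close> are the degrees of \<open>K\<close> and \<open>L\<close>; they only enter through the sign.\<close>

definition lbr :: "int \<Rightarrow> int \<Rightarrow> ('g list \<Rightarrow> 'g) \<Rightarrow> ('g list \<Rightarrow> 'g) \<Rightarrow> 'g list \<Rightarrow> 'g" where
  "lbr a b K L = K \<sqinter> L + deriv K L + (- sg (a * b) (deriv L K))"

lemma cochain_lbr:
  assumes "cochain a K" "cochain b L"
  shows "cochain (a + b) (lbr a b K L)"
proof -
  have "cochain (a + b) (deriv L K)"
    using cochain_deriv[OF assms(2,1)] by (simp add: add.commute)
  then show ?thesis
    unfolding lbr_def
    by (intro cochain_plus cochain_uminus cochain_sg cochain_wed[OF assms] cochain_deriv[OF assms])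
qed

text \<open>By \<open>ins_ins\<close>, the commutator of the two insertions is the insertion of the
  Nijenhuis-Richardson bracket of \<open>K \<sqinter> idc\<close> and
  \<open>L \<sqinter> idc\<close>. The derivation rule and the Jacobi identity for \<sqinter> bring
  this bracket into the form \<open>-(M \<sqinter> idc)\<close> with
  \<open>M = lbr a b K L\<close>.\<close>

lemma deriv_lbr:
  assumes "cochain a K" "cochain b L" "cochain c f"
  shows "deriv (lbr a b K L) f = deriv K (deriv L f) + (- sg (a * b) (deriv L (deriv K f)))"
proof -
  note i = cochain_wed_idc[OF assms(1)] cochain_wed_idc[OF assms(2)]
  have "ins (K \<sqinter> idc) (L \<sqinter> idc) = - deriv K (L \<sqinter> idc)"
    "ins (L \<sqinter> idc) (K \<sqinter> idc) = - deriv L (K \<sqinter> idc)"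
    by (simp_all add: deriv_def)
  then have e: "ins (K \<sqinter> idc) (L \<sqinter> idc)
      = - (deriv K L \<sqinter> idc) + sg (a * b) (L \<sqinter> (K \<sqinter> idc))"
    "ins (L \<sqinter> idc) (K \<sqinter> idc) = - (deriv L K \<sqinter> idc) + sg (a * b) (K \<sqinter> (L \<sqinter> idc))"
    by (simp_all add: deriv_wed[OF assms(1,2) cochain_idc] deriv_wed[OF assms(2,1) cochain_idc]
        deriv_idc wed_uminus sg_minus mult.commute)
  show ?thesis
    using ins_ins[OF i assms(3)]
    unfolding e wed_jacobi[OF assms(1,2) cochain_idc] deriv_def lbr_def wed_add wed_uminus wed_sg
      ins_add_left[OF assms(3)] ins_uminus_left[OF assms(3)] ins_sg_left[OF assms(3)]
      ins_uminus_right
    by (cases "even a"; cases "even b") (simp_all add: sg_def algebra_simps eq_diff_eq)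
qed

text \<open>After expansion, iterated wedges are matched by \<open>wed_jacobi\<close>, iterated
  actions by \<open>deriv_lbr\<close>, and the mixed terms by the derivation rule.\<close>

lemma lbr_jacobi:
  assumes "cochain a K" "cochain b L" "cochain c M"
  shows "lbr a (b + c) K (lbr b c L M)
    = lbr (a + b) c (lbr a b K L) M + sg (a * b) (lbr b (a + c) L (lbr a c K M))"
proof -
  note d = deriv_lbr[OF assms] deriv_lbr[OF assms(1,3,2)] deriv_lbr[OF assms(2,3,1)]
  \<comment> \<open>The mixed product that the expansion produces in both orders.\<close>
  have s: "deriv M K \<sqinter> L = - sg ((c + a) * b) (L \<sqinter> deriv M K)"
    by (rule wed_skew[OF cochain_deriv[OF assms(3,1)] assms(2)])
  show ?thesis
    unfolding lbr_def[of a "b + c"] lbr_def[of "a + b" c] lbr_def[of b "a + c"] d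
    unfolding lbr_def wed_add wed_uminus wed_sg deriv_right deriv_wed[OF assms]
      deriv_wed[OF assms(2,1,3)] deriv_wed[OF assms(3,1,2)] s wed_jacobi[OF assms]
    by (cases "even a"; cases "even b"; cases "even c") (simp_all add: sg_def)
qed

lemma lbr_skew:
  assumes "cochain a K" "cochain b L"
  shows "lbr a b K L = - sg (a * b) (lbr b a L K)"
  unfolding lbr_def wed_skew[OF assms] by (cases "even a"; cases "even b") (simp_all add: sg_def)

text \<open>The two ways to distribute a pair of arguments contribute \<open>br x y\<close> and
  \<open>- br y x\<close>, hence the factor 2.\<close>

lemma idc_wed_idc: "idc \<sqinter> idc = brc + brc"
proof
  fix ws
  have c0: "(contr x idc \<sqinter> L) ws = br x (L ws)" for x L and ws :: "'g list"
    by (induction ws arbitrary: L)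
      (simp_all add: wed_Cons[OF cochain_contr[OF cochain_idc]] contr_apply,
        simp add: wedge_def contr_apply biadd_zero[OF biadd_br])
  have c1: "(idc \<sqinter> contr x idc) ws = br (idc ws) x" for x and ws :: "'g list"
    by (simp add: wedge_def contr_apply idc_Cons if_distrib[of "br _"] biadd_zero[OF biadd_br]
        usum_all_left cong: if_cong)
  show "(idc \<sqinter> idc) ws = (brc + brc) ws"
  proof (cases ws)
    case (Cons x xs)
    have "(idc \<sqinter> idc) (x # xs) = br x (idc xs) + br x (idc xs)"
      unfolding wed_Cons[OF cochain_idc] c0 c1 using br_skew[of "idc xs" x] by (simp add: sg_def)
    then show ?thesis
      unfolding Cons by (cases xs; cases "tl xs") (simp_all add: biadd_zero[OF biadd_br])
  qed (simp add: biadd_zero[OF biadd_br])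
qed

text \<open>Halving \<open>idc \<sqinter> idc\<close> transfers the closure of cochains under
  \<sqinter> to the bracket, without a case analysis on positions.\<close>

lemma cochain_brc: "cochain 2 brc"
proof -
  have c: "cochain 2 (brc + brc)"
    using cochain_wed[OF cochain_idc cochain_idc] by (simp add: idc_wed_idc)
  have "brc = fun_scale scale (1 / 2) (brc + brc)"
  proof
    fix ws
    have "scale (1 / 2) (brc ws + brc ws) = scale (1 / 2 + 1 / 2) (brc ws)"
      by (simp only: scale_right_distrib scale_left_distrib)
    then show "brc ws = fun_scale scale (1 / 2) (brc + brc) ws"
      by (simp add: fun_scale_def)
  qed
  then show ?thesis
    using cochain_fun_scale[OF c] by metis
qed

text \<open>Doubled, the left-hand side is an insertion into \<open>idc \<sqinter> idc\<close>. The
  derivation rule gives two terms, which coincide by skew symmetry.\<close>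

lemma ins_brc:
  assumes "cochain h H"
  shows "ins H brc = H \<sqinter> idc"
proof (rule double_cancel_fun)
  have "ins H brc + ins H brc = ins H (idc \<sqinter> idc)"
    by (simp add: idc_wed_idc ins_add_right)
  also have "\<dots> = H \<sqinter> idc + sg (h + 1) (idc \<sqinter> H)"
    by (simp add: ins_wed[OF assms cochain_idc cochain_idc] ins_idc)
  also have "idc \<sqinter> H = - sg (1 * h) (H \<sqinter> idc)"
    by (rule wed_skew[OF cochain_idc assms])
  finally show "ins H brc + ins H brc = H \<sqinter> idc + H \<sqinter> idc"
    by (cases "even h") (simp_all add: sg_def fun_eq_iff)
qed

text \<open>Doubling again: the Jacobi identity splits
  \<open>K \<sqinter> (idc \<sqinter> idc)\<close> into two terms that coincide by skew
  symmetry.\<close>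

lemma wed_brc:
  assumes "cochain a K"
  shows "K \<sqinter> brc = (K \<sqinter> idc) \<sqinter> idc"
proof (rule double_cancel_fun)
  have "K \<sqinter> brc + K \<sqinter> brc = K \<sqinter> (idc \<sqinter> idc)"
    by (simp add: idc_wed_idc wed_add)
  also have "\<dots> = (K \<sqinter> idc) \<sqinter> idc + sg a (idc \<sqinter> (K \<sqinter> idc))"
    using wed_jacobi[OF assms cochain_idc cochain_idc] by simp
  also have "idc \<sqinter> (K \<sqinter> idc) = - sg (1 * (a + 1)) ((K \<sqinter> idc) \<sqinter> idc)"
    by (rule wed_skew[OF cochain_idc cochain_wed_idc[OF assms]])
  finally show "K \<sqinter> brc + K \<sqinter> brc = (K \<sqinter> idc) \<sqinter> idc + (K \<sqinter> idc) \<sqinter> idc"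
    by (cases "even a") (simp_all add: sg_def fun_eq_iff)
qed

text \<open>Computing \<open>idc \<sqinter> brc\<close> in two ways gives \<open>3 (brc \<sqinter> idc) = 0\<close>.\<close>

lemma ins_brc_brc: "ins brc brc = 0"
proof -
  have "idc \<sqinter> brc = (brc + brc) \<sqinter> idc"
    by (simp add: wed_brc[OF cochain_idc] idc_wed_idc)
  moreover have "idc \<sqinter> brc = - sg (1 * 2) (brc \<sqinter> idc)"
    by (rule wed_skew[OF cochain_idc cochain_brc])
  ultimately have "brc \<sqinter> idc + brc \<sqinter> idc = - (brc \<sqinter> idc)"
    by (simp add: wed_add sg_def)
  then have "(brc \<sqinter> idc) ws + (brc \<sqinter> idc) ws = - (brc \<sqinter> idc) ws" for ws
    by (metis plus_fun_apply uminus_apply)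
  then have "(brc \<sqinter> idc) ws + (brc \<sqinter> idc) ws + (brc \<sqinter> idc) ws = 0" for ws
    by simp
  then have "(brc \<sqinter> idc) ws = 0" for ws
    by (rule triple_eq_0D)
  then show ?thesis
    by (simp add: ins_brc[OF cochain_brc] fun_eq_iff)
qed

text \<open>\<open>ins_ins\<close> with \<open>H = G = brc\<close> has an even exponent, so it reads
  twice the iterated insertion equals twice the insertion of \<open>ins brc brc\<close>, which is
  zero by the Jacobi identity.\<close>

lemma ins_brc_twice:
  assumes "cochain a f"
  shows "ins brc (ins brc f) = 0"
proof (rule double_cancel_fun)
  show "ins brc (ins brc f) + ins brc (ins brc f) = 0 + 0"
    using ins_ins[OF cochain_brc cochain_brc assms]
    by (simp add: ins_brc_brc ins_zero_left[OF assms]) (simp add: sg_def)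
qed

lemma cochain_ins_brc: "cochain a f \<Longrightarrow> cochain (a + 1) (ins brc f)"
  using cochain_ins[OF cochain_brc, of a f] by (simp add: add.commute)

text \<open>The commutator of the two insertions is governed by \<open>brc\<close> and
  \<open>K \<sqinter> idc\<close>. The contributions \<open>K \<sqinter> brc\<close> of the two
  mutual insertions cancel, by \<open>wed_brc\<close>, and only
  \<open>ins brc K \<sqinter> idc\<close> survives.\<close>

lemma ins_brc_deriv:
  assumes "cochain a K" "cochain b f"
  shows "ins brc (deriv K f) = deriv (ins brc K) f + sg a (deriv K (ins brc f))"
proof -
  note i = cochain_wed_idc[OF assms(1)]
  have e: "ins brc (K \<sqinter> idc) = ins brc K \<sqinter> idc + sg a (K \<sqinter> brc)"
    using ins_wed[OF cochain_brc assms(1) cochain_idc] by (simp add: ins_idc) (simp add: sg_def)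
  have e': "ins (K \<sqinter> idc) brc = K \<sqinter> brc"
    by (simp add: ins_brc[OF i] wed_brc[OF assms(1)])
  show ?thesis
    using ins_ins[OF cochain_brc i assms(2)]
    unfolding e e' deriv_def ins_uminus_right ins_add_left[OF assms(2)] ins_sg_left[OF assms(2)]
    by (cases "even a") (simp_all add: sg_def algebra_simps)
qed

text \<open>Insertion of \<open>brc\<close> is an odd derivation for \<sqinter> and is compatible
  with the action, hence it is one for \<open>lbr\<close>. This is the Leibniz rule of the dg Lie
  algebra, up to the factor \<open>lam\<close>.\<close>

lemma ins_brc_lbr:
  assumes "cochain a K" "cochain b L"
  shows "ins brc (lbr a b K L)
    = lbr (a + 1) b (ins brc K) L + sg a (lbr a (b + 1) K (ins brc L))"
  unfolding lbr_def ins_add_right ins_uminus_right ins_sg_right ins_brc_deriv[OF assms]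
    ins_brc_deriv[OF assms(2,1)] ins_wed[OF cochain_brc assms]
  by (cases "even a"; cases "even b") (simp_all add: sg_def)

end

section \<open>Signs of permutations and shuffles\<close>

definition inversions :: "nat \<Rightarrow> (nat \<Rightarrow> nat) \<Rightarrow> (nat \<times> nat) set" where
  "inversions n p = {(i, j). i < j \<and> j < n \<and> p j < p i}"

lemma finite_inversions [simp]: "finite (inversions n p)"
  by (rule finite_subset[of _ "{..<n} \<times> {..<n}"]) (auto simp: inversions_def)

definition inv_factor :: "(nat \<Rightarrow> nat) \<Rightarrow> nat \<times> nat \<Rightarrow> int" where
  "inv_factor p = (\<lambda>(i, j). if p j < p i then - 1 else 1)"

definition index_pairs :: "nat \<Rightarrow> (nat \<times> nat) set" where
  "index_pairs n = {(i, j). i < j \<and> j < n}"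

lemma finite_index_pairs [simp]: "finite (index_pairs n)"
  by (rule finite_subset[of _ "{..<n} \<times> {..<n}"]) (auto simp: index_pairs_def)

lemma minus_one_power_inversions: "(- 1) ^ card (inversions n p) = (\<Prod>x\<in>index_pairs n. inv_factor p x)"
proof -
  have "(\<Prod>x\<in>index_pairs n. inv_factor p x)
      = (\<Prod>x\<in>index_pairs n. if x \<in> inversions n p then - 1 else 1)"
    by (intro prod.cong) (auto simp: index_pairs_def inv_factor_def inversions_def split: if_splits)
  also have "\<dots> = (\<Prod>x\<in>index_pairs n \<inter> inversions n p. - 1)"
    by (rule prod.inter_restrict[symmetric]) simp
  also have "index_pairs n \<inter> inversions n p = inversions n p"
    by (auto simp: index_pairs_def inversions_def)
  finally show ?thesis
    by simp
qed

text \<open>The inversions are the pairs \<open>(a, j)\<close> with \<open>a < j\<close>,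
  \<open>j \<le> b\<close>, and \<open>(i, b)\<close> with \<open>a < i\<close>,
  \<open>i < b\<close>; their number is \<open>2 * (b - a) - 1\<close>.\<close>

lemma inversions_transpose:
  assumes "a < b" "b < n"
  shows "(- 1) ^ card (inversions n (transpose a b)) = (- 1 :: int)"
proof -
  have "inversions n (transpose a b) = Pair a ` {a<..b} \<union> (\<lambda>i. (i, b)) ` {a<..<b}"
    using assms by (auto simp: inversions_def transpose_def split: if_splits)
  moreover have "card (Pair a ` {a<..b} \<union> (\<lambda>i. (i, b)) ` {a<..<b}) = (b - a) + (b - Suc a)"
    by (subst card_Un_disjoint) (auto simp: card_image inj_on_def)
  moreover have "odd ((b - a) + (b - Suc a))"
    using assms by presburger
  ultimately show ?thesis
    by simp
qed

text \<open>A pair is inverted by \<open>p \<circ> q\<close> if and only if exactly one of the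
  following holds: \<open>q\<close> inverts it, or \<open>p\<close> inverts its image under
  \<open>q\<close>. Since \<open>q\<close> permutes the unordered pairs, the product of the second
  factors is that for \<open>p\<close>.\<close>

lemma minus_one_power_inversions_compose:
  assumes p: "p permutes {..<n}" and q: "q permutes {..<n}"
  shows "(- 1 :: int) ^ card (inversions n (p \<circ> q))
    = (- 1) ^ card (inversions n p) * (- 1) ^ card (inversions n q)"
proof -
  \<comment> \<open>The image of a pair under \<open>r\<close>, put back in increasing
    order.\<close>
  define srt where "srt r = (\<lambda>(i, j). (min (r i) (r j), max (r i) (r j)))" for r :: "nat \<Rightarrow> nat"
  have bij: "bij_betw (srt q) (index_pairs n) (index_pairs n)"
  proof (rule bij_betwI[where g = "srt (inv q)"])
    have m: "srt r \<in> index_pairs n \<rightarrow> index_pairs n" if "r permutes {..<n}" for r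
    proof -
      have "r i < n" if "i < n" for i
        using permutes_in_image[OF \<open>r permutes {..<n}\<close>, of i] that by simp
      moreover have "r i \<noteq> r j" if "i < j" for i j
        using permutes_inj[OF \<open>r permutes {..<n}\<close>] that by (auto dest: injD)
      ultimately show ?thesis
        by (force simp: index_pairs_def srt_def min_def max_def)
    qed
    show "srt q \<in> index_pairs n \<rightarrow> index_pairs n" "srt (inv q) \<in> index_pairs n \<rightarrow> index_pairs n"
      by (intro m q permutes_inv)+
    show "srt (inv q) (srt q x) = x" "srt q (srt (inv q) x) = x" if "x \<in> index_pairs n" for x
      using that permutes_inverses[OF q]
      by (auto simp: index_pairs_def srt_def min_def max_def)
  qed
  have "inv_factor (p \<circ> q) x = inv_factor p (srt q x) * inv_factor q x" if "x \<in> index_pairs n" for x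
  proof -
    obtain i j where x: "x = (i, j)" "i < j"
      using \<open>x \<in> index_pairs n\<close> by (auto simp: index_pairs_def)
    then have "q i \<noteq> q j" "p (q i) \<noteq> p (q j)"
      using permutes_inj[OF p] permutes_inj[OF q] by (auto dest: injD)
    then show ?thesis
      using x by (auto simp: inv_factor_def srt_def min_def max_def)
  qed
  then have "(\<Prod>x\<in>index_pairs n. inv_factor (p \<circ> q) x)
      = (\<Prod>x\<in>index_pairs n. inv_factor p (srt q x)) * (\<Prod>x\<in>index_pairs n. inv_factor q x)"
    by (simp add: prod.distrib)
  also have "(\<Prod>x\<in>index_pairs n. inv_factor p (srt q x)) = (\<Prod>x\<in>index_pairs n. inv_factor p x)"
    by (rule prod.reindex_bij_betw[OF bij])
  finally show ?thesis
    unfolding minus_one_power_inversions .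
qed

text \<open>Relates the signature, multiplicative in transpositions, to Koszul signs, which are
  products over inversions. Both sides are multiplicative, so induction over transpositions
  applies.\<close>

lemma sign_eq_inversions:
  assumes "p permutes {..<n}"
  shows "sign p = (- 1) ^ card (inversions n p)"
  using assms finite_lessThan
proof (induction rule: permutes_induct)
  case id
  have "inversions n id = {}"
    by (auto simp: inversions_def)
  then show ?case
    by (simp only: card.empty power_0 sign_id)
next
  case (swap a b p)
  have t: "transpose a b permutes {..<n}"
    by (rule permutes_swap_id) (use swap.hyps in auto)
  have "(- 1) ^ card (inversions n (transpose a b)) = (- 1 :: int)"
    using inversions_transpose[of a b n] inversions_transpose[of b a n] swap.hyps
    by (cases "a < b") (auto simp: transpose_commute)
  moreover have "sign (transpose a b \<circ> p) = - sign p"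
    using swap.hyps by (simp add: sign_compose permutation_swap_id
        permutes_imp_permutation[OF finite_lessThan swap.hyps(4)] sign_swap_id)
  ultimately show ?case
    unfolding minus_one_power_inversions_compose[OF t swap.hyps(4)]
    using swap.IH by (simp only: mult_minus_left mult_1)
qed

text \<open>The product of two odd degrees is odd, so every inversion contributes -1. This is
  applied to arguments of degree 1 from s\<gg>.\<close>

lemma koszul_odd:
  assumes "p permutes {..<length ds}" "\<forall>d\<in>set ds. odd d"
  shows "koszul p ds = of_int (sign p)"
proof -
  have "koszul p ds = (\<Prod>(i, j)\<in>inversions (length ds) p. - 1 :: 'a::comm_ring_1)"
    unfolding koszul_def inversions_def[symmetric]
  proof (intro prod.cong refl, clarsimp)
    fix i j assume "(i, j) \<in> inversions (length ds) p"
    then have "p i < length ds" "p j < length ds"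
      using permutes_in_image[OF assms(1)] by (auto simp: inversions_def)
    then show "msign (ds ! p i * ds ! p j) = (- 1 :: 'a)"
      using assms(2) by (simp add: msign_def)
  qed
  also have "\<dots> = of_int (sign p)"
    unfolding sign_eq_inversions[OF assms(1)] by (simp add: case_prod_unfold)
  finally show ?thesis .
qed

text \<open>The Koszul sign and the signature cancel. Hence permuting copies of an element of degree
  -1 costs no sign, and the permutations of such copies all contribute equally.\<close>

lemma chi_odd:
  assumes "p permutes {..<length ds}" "\<forall>d\<in>set ds. odd d"
  shows "chi p ds = 1"
  unfolding chi_def koszul_odd[OF assms] by (metis of_int_1 of_int_mult sign_idempotent)

definition psg :: "(nat \<Rightarrow> nat) \<Rightarrow> 'v::ab_group_add \<Rightarrow> 'v" where
  "psg p v = (if sign p = 1 then v else - v)"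

lemma psg_id [simp]: "psg id v = v"
  by (simp add: psg_def)

lemma psg_ident [simp]: "psg (\<lambda>x. x) v = v"
  by (simp add: psg_def)

lemma psg_compose:
  assumes "p permutes {..<m}" "q permutes {..<n}"
  shows "psg (p \<circ> q) v = psg p (psg q v)"
  using sign_compose[of p q] permutes_imp_permutation[OF finite_lessThan] assms
  by (cases p rule: sign_cases; cases q rule: sign_cases) (auto simp: psg_def)

text \<open>
  A shuffle of two blocks, the first one of length \<open>m\<close>, is either \<open>shift q\<close>, when it sends 0 to 0, or
  \<open>shift q \<circ> rot m\<close>, when it sends \<open>m\<close> to 0.
\<close>

definition shift :: "(nat \<Rightarrow> nat) \<Rightarrow> nat \<Rightarrow> nat" where
  "shift p i = (case i of 0 \<Rightarrow> 0 | Suc j \<Rightarrow> Suc (p j))"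

lemma shift_simps [simp]: "shift p 0 = 0" "shift p (Suc j) = Suc (p j)"
  by (simp_all add: shift_def)

lemma inj_shift: "inj shift"
  by (rule injI) (metis ext old.nat.inject shift_simps(2))

lemma shift_permutes:
  assumes "p permutes {..<n}"
  shows "shift p permutes {..<Suc n}"
proof (rule bij_imp_permutes)
  have pq: "p i < n" "inv p i < n" if "i < n" for i
    using permutes_in_image[OF assms, of i] permutes_in_image[OF permutes_inv[OF assms], of i] that
    by simp_all
  show "bij_betw (shift p) {..<Suc n} {..<Suc n}"
    by (rule bij_betwI[where g = "shift (inv p)"])
      (auto simp: shift_def permutes_inverses[OF assms] pq split: nat.splits)
  show "shift p x = x" if "x \<notin> {..<Suc n}" for x
    using that permutes_not_in[OF assms] by (auto simp: shift_def split: nat.splits)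
qed

lemma shiftE:
  assumes "p permutes {..<Suc n}" "p 0 = 0"
  obtains q where "q permutes {..<n}" "p = shift q"
proof
  have ne: "p (Suc j) \<noteq> 0" for j
    using permutes_inj[OF assms(1)] assms(2) by (metis injD nat.simps(3))
  show e: "p = shift (\<lambda>j. p (Suc j) - 1)"
    using ne assms(2) by (auto simp: fun_eq_iff shift_def split: nat.splits)
  show "(\<lambda>j. p (Suc j) - 1) permutes {..<n}"
  proof (rule inj_imp_permutes)
    show "inj_on (\<lambda>j. p (Suc j) - 1) {..<n}"
    proof (rule inj_onI)
      fix i j assume "p (Suc i) - 1 = p (Suc j) - 1"
      then have "p (Suc i) = p (Suc j)"
        using ne[of i] ne[of j] by linarith
      then show "i = j"
        using permutes_inj[OF assms(1)] by (auto dest: injD)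
    qed
    show "p (Suc j) - 1 \<in> {..<n}" if "j \<in> {..<n}" for j
      using that permutes_in_image[OF assms(1), of "Suc j"] ne[of j] by simp
    show "p (Suc j) - 1 = j" if "j \<notin> {..<n}" for j
      using that permutes_not_in[OF assms(1), of "Suc j"] by simp
  qed simp
qed

lemma psg_shift:
  assumes "p permutes {..<n}"
  shows "psg (shift p) v = psg p v"
proof -
  have "inversions (Suc n) (shift p) = map_prod Suc Suc ` inversions n p"
    by (auto simp: inversions_def shift_def image_iff split: nat.splits)
      (metis less_Suc_eq_0_disj not_less_zero old.nat.exhaust)+
  moreover have "inj_on (map_prod Suc Suc) (inversions n p)"
    by (rule map_prod_inj_on[THEN inj_on_subset, of _ UNIV _ UNIV]) simp_all
  ultimately have "card (inversions (Suc n) (shift p)) = card (inversions n p)"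
    by (simp only: card_image)
  then show ?thesis
    by (simp add: psg_def sign_eq_inversions[OF assms] sign_eq_inversions[OF shift_permutes[OF assms]])
qed

lemma permute_list_shift: "permute_list (shift p) (x # ws) = x # permute_list p ws"
  by (simp add: permute_list_def upt_conv_Cons map_Suc_upt[symmetric] del: upt_Suc map_Suc_upt)

definition rot :: "nat \<Rightarrow> nat \<Rightarrow> nat" where
  "rot m i = (if i < m then Suc i else if i = m then 0 else i)"

lemma rot_permutes:
  assumes "m < n"
  shows "rot m permutes {..<n}"
proof (rule bij_imp_permutes)
  show "bij_betw (rot m) {..<n} {..<n}"
    by (rule bij_betwI[where g = "\<lambda>i. if i = 0 then m else if i \<le> m then i - 1 else i"])
      (use assms in \<open>auto simp: rot_def\<close>)
qed (use assms in \<open>auto simp: rot_def\<close>)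

lemma psg_rot: "psg (rot m) v = sg (int m) v"
proof -
  have "inversions (Suc m) (rot m) = (\<lambda>i. (i, m)) ` {..<m}"
    by (auto simp: inversions_def rot_def split: if_splits)
  then have "card (inversions (Suc m) (rot m)) = m"
    by (simp add: card_image inj_on_def)
  then show ?thesis
    by (auto simp: psg_def sg_def sign_eq_inversions[OF rot_permutes[OF lessI]] uminus_power_if)
qed

lemma permute_list_rot:
  assumes "m \<le> length ys"
  shows "permute_list (rot m) (x # ys) = take m ys @ x # drop m ys"
proof (rule nth_equalityI)
  fix i assume "i < length (permute_list (rot m) (x # ys))"
  then show "permute_list (rot m) (x # ys) ! i = (take m ys @ x # drop m ys) ! i"
    using assms by (auto simp: permute_list_nth[OF rot_permutes] rot_def nth_append nth_Cons'
        Suc_diff_le not_less)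
qed (use assms in simp)

section \<open>Recursion for shuffles of two blocks\<close>

lemma block_shuffles_two:
  "block_shuffles [m, k] = {p. p permutes {..<m + k} \<and>
     strict_mono_on {..<m} p \<and> strict_mono_on {m..<m + k} p}"
  by (auto simp: block_shuffles_def less_Suc_eq atLeast0LessThan)

lemma permutes_strict_mono_id:
  fixes n :: nat
  assumes "p permutes {..<n}" "strict_mono_on {..<n} p"
  shows "p = id"
proof (rule permutes_natset_ge[OF assms(1)])
  have "i < n \<Longrightarrow> i \<le> p i" for i
  proof (induction i)
    case (Suc i)
    then show ?case
      using strict_mono_onD[OF assms(2), of i "Suc i"] by simp
  qed simp
  then show "\<forall>i\<in>{..<n}. i \<le> p i"
    by simp
qed

lemma block_shuffles_0: "block_shuffles [0, n] = {id}" "block_shuffles [n, 0] = {id}"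
  "block_shuffles [n] = {id}"
  using permutes_strict_mono_id[of _ n]
  by (auto simp: block_shuffles_def less_Suc_eq atLeast0LessThan permutes_id strict_mono_on_def)

lemma usum_left_0: "usum (\<lambda>A B. if length A = 0 then F A B else 0) xs = F [] xs"
proof (induction xs arbitrary: F)
  case (Cons x xs)
  have "usum (\<lambda>A B. sg (int (length A)) (if length A = 0 then F A (x # B) else 0)) xs
      = usum (\<lambda>A B. if length A = 0 then F A (x # B) else 0) xs"
    by (rule usum_cong) simp
  then show ?case
    using Cons.IH[of "\<lambda>A B. F A (x # B)"] by simp
qed simp

lemma usum_right_0:
  "usum (\<lambda>A B. if length A = length xs then F A B else 0) xs = F xs []"
proof -
  have "usum (\<lambda>A B. if length A = length xs then F A B else 0) xs
      = usum (\<lambda>A B. if B = [] then F A [] else 0) xs"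
    by (rule usum_cong) auto
  then show ?thesis
    by (simp add: usum_all_left)
qed

lemma block_shuffles_fix_0:
  "{p \<in> block_shuffles [Suc m, k]. p 0 = 0} = shift ` block_shuffles [m, k]"
proof (intro equalityI subsetI)
  fix p assume "p \<in> {p \<in> block_shuffles [Suc m, k]. p 0 = 0}"
  then have p: "p permutes {..<Suc (m + k)}" "p 0 = 0" "strict_mono_on {..<Suc m} p"
    "strict_mono_on {Suc m..<Suc (m + k)} p"
    by (auto simp: block_shuffles_two)
  obtain q where q: "q permutes {..<m + k}" "p = shift q"
    using shiftE[OF p(1,2)] .
  have "q i < q j" if "i < j" "j < m" for i j
    using strict_mono_onD[OF p(3), of "Suc i" "Suc j"] that q by simp
  moreover have "q i < q j" if "i < j" "m \<le> i" "j < m + k" for i j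
    using strict_mono_onD[OF p(4), of "Suc i" "Suc j"] that q by simp
  ultimately have "q \<in> block_shuffles [m, k]"
    using q by (auto simp: block_shuffles_two strict_mono_on_def)
  then show "p \<in> shift ` block_shuffles [m, k]"
    using q by blast
next
  fix p assume "p \<in> shift ` block_shuffles [m, k]"
  then obtain q where q: "p = shift q" "q permutes {..<m + k}" "strict_mono_on {..<m} q"
    "strict_mono_on {m..<m + k} q"
    by (auto simp: block_shuffles_two)
  then show "p \<in> {p \<in> block_shuffles [Suc m, k]. p 0 = 0}"
    using shift_permutes[OF q(2)]
    by (auto simp: block_shuffles_two strict_mono_on_def shift_def split: nat.splits)
qed

lemma block_shuffles_fix_block:
  "{p \<in> block_shuffles [m, Suc k]. p m = 0} = (\<lambda>q. shift q \<circ> rot m) ` block_shuffles [m, k]"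
proof (intro equalityI subsetI)
  fix p assume "p \<in> {p \<in> block_shuffles [m, Suc k]. p m = 0}"
  then have p: "p permutes {..<Suc (m + k)}" "p m = 0" "strict_mono_on {..<m} p"
    "strict_mono_on {m..<Suc (m + k)} p"
    by (auto simp: block_shuffles_two)
  have r: "rot m permutes {..<Suc (m + k)}"
    by (rule rot_permutes) simp
  have m: "inv (rot m) 0 = m"
    by (subst permutes_inv_eq[OF r]) (simp add: rot_def)
  obtain q where q: "q permutes {..<m + k}" "p \<circ> inv (rot m) = shift q"
    using shiftE[OF permutes_compose[OF permutes_inv[OF r] p(1)]] m p(2) by auto
  have pq: "p = shift q \<circ> rot m"
    unfolding q(2)[symmetric] using permutes_inv_o(2)[OF r] by (simp add: comp_assoc)
  have "q i < q j" if "i < j" "j < m" for i j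
    using strict_mono_onD[OF p(3), of i j] that pq by (simp add: rot_def)
  moreover have "q i < q j" if "i < j" "m \<le> i" "j < m + k" for i j
    using strict_mono_onD[OF p(4), of "Suc i" "Suc j"] that pq by (simp add: rot_def)
  ultimately have "q \<in> block_shuffles [m, k]"
    using q by (auto simp: block_shuffles_two strict_mono_on_def)
  then show "p \<in> (\<lambda>q. shift q \<circ> rot m) ` block_shuffles [m, k]"
    using pq by blast
next
  fix p assume "p \<in> (\<lambda>q. shift q \<circ> rot m) ` block_shuffles [m, k]"
  then obtain q where q: "p = shift q \<circ> rot m" "q permutes {..<m + k}" "strict_mono_on {..<m} q"
    "strict_mono_on {m..<m + k} q"
    by (auto simp: block_shuffles_two)
  have "p permutes {..<Suc (m + k)}"
    unfolding q(1) by (intro permutes_compose rot_permutes shift_permutes q(2)) simp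
  moreover have "strict_mono_on {..<m} p"
    using q(3) by (auto simp: strict_mono_on_def q(1) rot_def)
  moreover have "strict_mono_on {m..<Suc (m + k)} p"
    using q(4) by (auto simp: strict_mono_on_def q(1) rot_def shift_def split: nat.splits)
  ultimately show "p \<in> {p \<in> block_shuffles [m, Suc k]. p m = 0}"
    by (auto simp: block_shuffles_two q(1) rot_def)
qed

text \<open>A shuffle is increasing on each block, so the position sent to 0 is the start of a
  block.\<close>

lemma block_shuffles_Suc_Suc:
  "block_shuffles [Suc m, Suc k] = shift ` block_shuffles [m, Suc k] \<union>
     (\<lambda>q. shift q \<circ> rot (Suc m)) ` block_shuffles [Suc m, k]"
proof -
  have "p 0 = 0 \<or> p (Suc m) = 0" if "p \<in> block_shuffles [Suc m, Suc k]" for p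
  proof -
    have p: "p permutes {..<Suc m + Suc k}" "strict_mono_on {..<Suc m} p"
      "strict_mono_on {Suc m..<Suc m + Suc k} p"
      using that by (auto simp: block_shuffles_two)
    obtain i where "p i = 0"
      using permutes_surj[OF p(1)] by (metis surjD)
    moreover from this have "i < Suc m + Suc k"
      using permutes_in_image[OF p(1), of i] by simp
    ultimately have i: "p i = 0" "i < Suc m + Suc k" .
    show ?thesis
      using strict_mono_onD[OF p(2), of 0 i] strict_mono_onD[OF p(3), of "Suc m" i] i
      by (cases "i = 0"; cases "i = Suc m"; cases "i < Suc m") auto
  qed
  then show ?thesis
    unfolding block_shuffles_fix_0[symmetric] block_shuffles_fix_block[symmetric] by blast
qed

lemma finite_block_shuffles [simp]: "finite (block_shuffles ns)"
  by (rule finite_subset[OF _ finite_permutations[of "{..<sum_list ns}"]])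
    (auto simp: block_shuffles_def)

lemma block_shuffles_permutes: "p \<in> block_shuffles ns \<Longrightarrow> p permutes {..<sum_list ns}"
  by (simp add: block_shuffles_def)

text \<open>The condition on \<open>length A\<close> selects one block size; summing over
  \<open>m\<close> then gives the whole of \<open>usum\<close>. The shuffles that send 0 to 0
  correspond to the first summand in the recursion of \<open>usum\<close>. The others carry the
  \<open>m\<close> inversions of \<open>rot m\<close>, which match the sign
  \<open>sg (int (length A))\<close> of the second summand.\<close>

lemma sum_block_shuffles:
  assumes "length ws = m + k"
  shows "(\<Sum>p\<in>block_shuffles [m, k].
      psg p (F (take m (permute_list p ws)) (drop m (permute_list p ws))))
    = usum (\<lambda>A B. if length A = m then F A B else 0) ws"
  using assms
proof (induction ws arbitrary: m k F)
  case Nil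
  then show ?case
    by (simp add: block_shuffles_0)
next
  case (Cons x ws)
  consider "m = 0" | "k = 0" | m' k' where "m = Suc m'" "k = Suc k'"
    by (cases m; cases k) auto
  then show ?case
  proof cases
    case 1
    then show ?thesis
      using usum_left_0[of F "x # ws"] by (simp add: block_shuffles_0)
  next
    case 2
    then have m: "m = length (x # ws)"
      using Cons.prems by simp
    show ?thesis
      unfolding 2 block_shuffles_0 unfolding m usum_right_0 by simp
  next
    case 3
    let ?T = "\<lambda>p. psg p (F (take m (permute_list p (x # ws))) (drop m (permute_list p (x # ws))))"
    have n: "length ws = m' + k" "length ws = m + k'" "m \<le> length ws"
      using Cons.prems 3 by auto
    have inj: "inj_on shift X" "inj_on (\<lambda>q. shift q \<circ> rot m) X" for X
    proof -
      show "inj_on shift X"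
        using inj_shift by (rule inj_on_subset) simp
      have "surj (rot m)"
        using rot_permutes[OF lessI] by (rule permutes_surj)
      then have "shift q = shift q'" if "shift q \<circ> rot m = shift q' \<circ> rot m" for q q'
        using that by (simp add: fun_eq_iff) (metis surjD)
      then show "inj_on (\<lambda>q. shift q \<circ> rot m) X"
        using inj_shift by (intro inj_onI) (auto dest: injD)
    qed
    have disj: "shift ` block_shuffles [m', k] \<inter> (\<lambda>q. shift q \<circ> rot m) ` block_shuffles [m, k'] = {}"
    proof -
      have "shift q 0 \<noteq> (shift q' \<circ> rot m) 0" for q q'
        using 3 by (simp add: rot_def)
      then have "shift q \<noteq> shift q' \<circ> rot m" for q q'
        by metis
      then show ?thesis
        by blast
    qed
    have "(\<Sum>p\<in>block_shuffles [m, k]. ?T p)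
        = (\<Sum>q\<in>block_shuffles [m', k]. ?T (shift q))
          + (\<Sum>q\<in>block_shuffles [m, k']. ?T (shift q \<circ> rot m))"
    proof -
      have U: "block_shuffles [m, k] = shift ` block_shuffles [m', k] \<union>
          (\<lambda>q. shift q \<circ> rot m) ` block_shuffles [m, k']"
        unfolding 3 block_shuffles_Suc_Suc ..
      show ?thesis
        unfolding U
        by (subst sum.union_disjoint[OF _ _ disj])
          (simp_all only: finite_block_shuffles finite_imageI sum.reindex_cong[OF inj(1) refl refl]
            sum.reindex_cong[OF inj(2) refl refl])
    qed
    also have "(\<Sum>q\<in>block_shuffles [m', k]. ?T (shift q))
        = usum (\<lambda>A B. if length A = m' then F (x # A) B else 0) ws"
      unfolding Cons.IH[OF n(1), of "\<lambda>A B. F (x # A) B", symmetric]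
    proof (rule sum.cong[OF refl])
      fix q assume "q \<in> block_shuffles [m', k]"
      then have q: "q permutes {..<m' + k}"
        using block_shuffles_permutes by fastforce
      show "?T (shift q) = psg q (F (x # take m' (permute_list q ws)) (drop m' (permute_list q ws)))"
        by (simp add: psg_shift[OF q] permute_list_shift 3)
    qed
    also have "(\<Sum>q\<in>block_shuffles [m, k']. ?T (shift q \<circ> rot m))
        = usum (\<lambda>A B. if length A = m then sg (int m) (F A (x # B)) else 0) ws"
      unfolding Cons.IH[OF n(2), of "\<lambda>A B. sg (int m) (F A (x # B))", symmetric]
    proof (rule sum.cong[OF refl])
      fix q assume "q \<in> block_shuffles [m, k']"
      then have q: "q permutes {..<m + k'}"
        using block_shuffles_permutes by fastforce
      have r: "rot m permutes {..<length (x # ws)}"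
        by (rule rot_permutes) (use n in simp)
      have "permute_list (shift q \<circ> rot m) (x # ws)
          = take m (permute_list q ws) @ x # drop m (permute_list q ws)"
        unfolding permute_list_compose[OF r] permute_list_shift
        by (rule permute_list_rot) (use n in simp)
      then show "?T (shift q \<circ> rot m)
          = psg q (sg (int m) (F (take m (permute_list q ws)) (x # drop m (permute_list q ws))))"
        using n by (simp add: psg_compose[OF shift_permutes[OF q] r] psg_shift[OF q] psg_rot)
    qed
    also have "usum (\<lambda>A B. if length A = m then sg (int m) (F A (x # B)) else 0) ws
        = usum (\<lambda>A B. sg (int (length A)) (if length A = m then F A (x # B) else 0)) ws"
      by (rule usum_cong) simp
    finally show ?thesis
      by (simp add: 3)
  qed
qed

section \<open>Evaluation of braces\<close>

lemma usum_sum: "usum (\<lambda>A B. \<Sum>i\<in>I. F i A B) xs = (\<Sum>i\<in>I. usum (F i) xs)"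
  by (induction I rule: infinite_finite_induct) (simp_all add: usum_add)

lemma degs_ones [simp]: "degs (map (Pair (1::int)) ws) = int (length ws)"
  by (induction ws) (simp_all add: degs_def)

lemma all_ones: "\<forall>z\<in>set zs. fst z = d \<Longrightarrow> \<exists>ws. zs = map (Pair d) ws"
  by (rule exI[of _ "map snd zs"], induction zs) auto

lemma ident_ones: "ident f (map (Pair 1) ws) = (if ws = [] then 0 else f ws)"
  by (simp add: ident_def comp_def)

lemma ident_Nil [simp]: "ident f [] = 0"
  by (simp add: ident_def)

lemma ident_not_ones: "\<exists>z\<in>set zs. fst z \<noteq> 1 \<Longrightarrow> ident f zs = 0"
  by (auto simp: ident_def)

lemma ident_eqI:
  assumes "\<And>zs. \<exists>z\<in>set zs. fst z \<noteq> 1 \<Longrightarrow> F zs = 0" "F [] = 0"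
    "\<And>ws. ws \<noteq> [] \<Longrightarrow> F (map (Pair 1) ws) = f ws"
  shows "F = ident f"
proof
  fix zs
  show "F zs = ident f zs"
  proof (cases "\<forall>z\<in>set zs. fst z = 1")
    case True
    obtain ws where "zs = map (Pair 1) ws"
      using all_ones[OF True] ..
    then show ?thesis
      using assms(2) assms(3)[of ws] by (cases "ws = []") (simp_all add: ident_ones)
  next
    case False
    then have "\<exists>z\<in>set zs. fst z \<noteq> 1"
      by simp
    then show ?thesis
      by (simp only: assms(1) ident_not_ones)
  qed
qed

lemma ident_add: "ident (f + g) = ident f + ident (g :: 'a list \<Rightarrow> 'a::ab_group_add)"
  and ident_uminus: "ident (- f) = - ident f"
  and ident_zero: "ident (0 :: 'a list \<Rightarrow> 'a) = 0"
  by (simp_all add: fun_eq_iff ident_def)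

lemma ident_sg: "ident (sg e f) = sg e (ident f)"
  by (simp add: sg_def ident_uminus)

text \<open>An entry of degree other than 1 either remains as an identity factor or is fed to one of
  the maps, which then vanishes.\<close>

lemma plug_degree_or_zero:
  assumes "\<And>q g l. (q, g) \<in> set gs \<Longrightarrow> \<exists>z\<in>set l. fst z \<noteq> 1 \<Longrightarrow> g l = 0"
    "\<exists>z\<in>set ys. fst z \<noteq> 1"
  shows "\<exists>z\<in>set (plug gs ms ys). fst z \<noteq> 1 \<or> snd z = 0"
  using assms
proof (induction gs ms ys rule: plug.induct)
  case (1 q g gs m ms ys)
  show ?case
  proof (cases "\<exists>z\<in>set (take m ys). fst z \<noteq> 1")
    case True
    then show ?thesis
      using "1.prems"(1) by auto
  next
    case False
    moreover have "set ys = set (take m ys) \<union> set (drop m ys)"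
      by (metis append_take_drop_id set_append)
    ultimately have "\<exists>z\<in>set (drop m ys). fst z \<noteq> 1"
      using "1.prems"(2) by blast
    then show ?thesis
      using "1.IH" "1.prems"(1) by auto
  qed
qed auto

text \<open>The suspension of an operator of degree -1 has degree 0 and passes all arguments
  freely.\<close>

lemma plug_exp_degree_0: "plug_exp (replicate i (0, h)) ms ys = 0"
proof (induction i arbitrary: ms ys)
  case (Suc i)
  have "degs (replicate i (0, h)) = 0"
    by (induction i) (simp_all add: degs_def)
  then show ?case
    by (cases ms) (simp_all add: Suc.IH)
qed simp

text \<open>For blocks of size 1, the ordering of block starts required by the brace is monotonicity
  on their union. They merge into a single block.\<close>

lemma block_shuffles_singles:
  "{p \<in> block_shuffles (replicate i 1 @ [k]). \<forall>a b. a < b \<and> b < i \<longrightarrow>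
      p (sum_list (take a (replicate i 1))) < p (sum_list (take b (replicate i 1)))}
    = block_shuffles [i, k]"
proof -
  have s: "sum_list (take j (replicate i (Suc 0) @ [k])) = (if j \<le> i then j else i + k)" for j
    by (simp add: sum_list_replicate min_def)
  have t: "sum_list (take j (replicate i (Suc 0))) = min j i" for j
    by (simp add: sum_list_replicate)
  have "strict_mono_on {j..<Suc j} p" for p :: "nat \<Rightarrow> nat" and j
    by (simp add: strict_mono_on_def)
  then have "(\<forall>j<Suc i. strict_mono_on {if j \<le> i then j else i + k..<if Suc j \<le> i then Suc j else i + k} p)
      \<longleftrightarrow> strict_mono_on {i..<i + k} p" for p :: "nat \<Rightarrow> nat"
    by (auto simp: less_Suc_eq)
  moreover have "(\<forall>a b. a < b \<and> b < i \<longrightarrow> p (min a i) < p (min b i)) \<longleftrightarrow> strict_mono_on {..<i} p" for p :: "nat \<Rightarrow> nat"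
    by (auto simp: strict_mono_on_def)
  ultimately show ?thesis
    unfolding block_shuffles_two unfolding block_shuffles_def One_nat_def s t length_append length_replicate
    by (auto simp: sum_list_replicate)
qed

text \<open>The trailing block is empty, as for a brace that fills every slot of a binary map. One
  of the two block starts is sent to 0, and the ordering makes it the first one.\<close>

lemma block_shuffles_ordered:
  "{p \<in> block_shuffles [Suc m, Suc k, 0]. \<forall>a b. a < b \<and> b < 2 \<longrightarrow>
      p (sum_list (take a [Suc m, Suc k])) < p (sum_list (take b [Suc m, Suc k]))}
    = shift ` block_shuffles [m, Suc k]"
proof -
  have "block_shuffles [Suc m, Suc k, 0] = block_shuffles [Suc m, Suc k]"
  proof -
    have "strict_mono_on {n..<n} p" for n :: nat and p :: "nat \<Rightarrow> nat"
      by (simp add: strict_mono_on_def)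
    moreover have "(\<forall>j<length [a, b, c]. P j) \<longleftrightarrow> P 0 \<and> P 1 \<and> P 2" for a b c :: nat and P
      by (auto simp: less_Suc_eq numeral_2_eq_2)
    moreover have "(\<forall>j<length [a, b]. P j) \<longleftrightarrow> P 0 \<and> P 1" for a b :: nat and P
      by (auto simp: less_Suc_eq)
    ultimately show ?thesis
      unfolding block_shuffles_def by simp
  qed
  moreover have "(\<forall>a b. a < b \<and> b < 2 \<longrightarrow>
      p (sum_list (take a [Suc m, Suc k])) < p (sum_list (take b [Suc m, Suc k]))) \<longleftrightarrow> p 0 < p (Suc m)"
    for p :: "nat \<Rightarrow> nat"
  proof
    assume "p 0 < p (Suc m)"
    moreover have "a = 0 \<and> b = 1" if "a < b \<and> b < 2" for a b :: nat
      using that by linarith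
    ultimately show "\<forall>a b. a < b \<and> b < 2 \<longrightarrow>
      p (sum_list (take a [Suc m, Suc k])) < p (sum_list (take b [Suc m, Suc k]))"
      by fastforce
  qed (erule allE[of _ 0], erule allE[of _ 1], simp)
  moreover have "p 0 < p (Suc m) \<longleftrightarrow> p 0 = 0" if "p \<in> block_shuffles [Suc m, Suc k]" for p
  proof -
    have "p permutes {..<Suc m + Suc k}"
      using that by (simp add: block_shuffles_two)
    then have "p 0 \<noteq> p (Suc m)"
      using permutes_inj by (fastforce dest: injD)
    moreover have "p 0 = 0 \<or> p (Suc m) = 0"
      using that unfolding block_shuffles_Suc_Suc by (auto simp: rot_def)
    ultimately show ?thesis
      by auto
  qed
  ultimately show ?thesis
    unfolding block_shuffles_fix_0[symmetric] by auto
qed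

context lie_alg
begin

lemma ident_fun_scale: "ident (fun_scale scale c f) = fun_scale scale c (ident f)"
  by (simp add: fun_eq_iff ident_def fun_scale_def)

lemma scale_sign: "scale (of_int (sign p)) v = psg p v"
  by (cases p rule: sign_cases) (simp_all add: psg_def)

lemma scale_msign: "scale (msign e) v = sg e v"
  by (simp add: msign_def sg_def)

lemma cochain_zero_mem: "cochain a f \<Longrightarrow> 0 \<in> set ws \<Longrightarrow> f ws = 0"
  by (auto simp: cochain_zero dest: split_list)

lemma ident_zero_mem:
  assumes "cochain a f" "\<exists>z\<in>set zs. fst z \<noteq> 1 \<or> snd z = 0"
  shows "ident f zs = 0"
proof (cases "\<exists>z\<in>set zs. fst z \<noteq> 1")
  case False
  then have "0 \<in> set (map snd zs)"
    using assms(2) by force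
  then show ?thesis
    using cochain_zero_mem[OF assms(1)] by (simp add: ident_def)
qed (rule ident_not_ones)

lemma brace_eq_0_of_degree:
  assumes "cochain a f" "\<And>q g l. (q, g) \<in> set gs \<Longrightarrow> \<exists>z\<in>set l. fst z \<noteq> 1 \<Longrightarrow> g l = 0"
    "\<exists>z\<in>set zs. fst z \<noteq> 1"
  shows "brace scale (ident f) gs zs = 0"
  unfolding brace_def
proof (intro sum.neutral ballI)
  fix ms p
  assume "ms \<in> {ms. length ms = length gs \<and> set ms \<subseteq> {1..length zs} \<and> sum_list ms \<le> length zs}"
    "p \<in> {p \<in> block_shuffles (ms @ [length zs - sum_list ms]). \<forall>i j. i < j \<and> j < length ms \<longrightarrow>
      p (sum_list (take i ms)) < p (sum_list (take j ms))}"
  then have "p permutes {..<length zs}"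
    using block_shuffles_permutes[of p "ms @ [length zs - sum_list ms]"] by simp
  then have "\<exists>z\<in>set (permute_list p zs). fst z \<noteq> 1"
    using assms(3) by simp
  then have "ident f (plug gs ms (permute_list p zs)) = 0"
    by (intro ident_zero_mem[OF assms(1)] plug_degree_or_zero assms(2))
  then show "scale (koszul p (map fst zs) * msign (plug_exp gs ms (permute_list p zs)))
      (ident f (plug gs ms (permute_list p zs))) = 0"
    by simp
qed

lemma koszul_ones:
  assumes "p permutes {..<length ws}"
  shows "koszul p (map fst (map (Pair (1::int)) ws)) = of_int (sign p)"
  by (rule koszul_odd) (use assms in auto)

text \<open>The condition \<open>q + a = 1\<close> says that the output of \<open>g\<close> on
  \<open>a\<close> vectors of degree 1 again has degree 1, so that \<open>ident f\<close> accepts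
  it.\<close>

lemma brace_one:
  assumes "cochain b f" "supported a g" "g [] = 0" "q + a = 1"
  shows "brace scale (ident f) [(q, ident g)] = ident (ins g f)"
proof (rule ident_eqI)
  show "brace scale (ident f) [(q, ident g)] zs = 0" if "\<exists>z\<in>set zs. fst z \<noteq> 1" for zs
    by (rule brace_eq_0_of_degree[OF assms(1) _ that]) (auto intro: ident_not_ones)
  show "brace scale (ident f) [(q, ident g)] [] = 0"
    by (simp add: brace_def)
next
  fix ws :: "'g list" assume "ws \<noteq> []"
  let ?N = "length ws"
  let ?zs = "map (Pair (1::int)) ws"
  have ms: "{ms. length ms = length [(q, ident g)] \<and> set ms \<subseteq> {1..length ?zs} \<and> sum_list ms \<le> length ?zs}
      = (\<lambda>m. [m]) ` {1..?N}"
    by (auto simp: length_Suc_conv)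
  have "brace scale (ident f) [(q, ident g)] ?zs
      = (\<Sum>m\<in>{1..?N}. \<Sum>p\<in>block_shuffles [m, ?N - m].
          psg p (f (g (take m (permute_list p ws)) # drop m (permute_list p ws))))"
    unfolding brace_def ms
  proof (rule sum.reindex_cong[OF _ refl])
    show "inj_on (\<lambda>m. [m]) {1..?N}"
      by (simp add: inj_on_def)
  next
    fix m assume m: "m \<in> {1..?N}"
    have B: "{p \<in> block_shuffles ([m] @ [length ?zs - sum_list [m]]).
        \<forall>i j. i < j \<and> j < length [m] \<longrightarrow> p (sum_list (take i [m])) < p (sum_list (take j [m]))}
        = block_shuffles [m, ?N - m]"
      by auto
    show "(\<Sum>p\<in>{p \<in> block_shuffles ([m] @ [length ?zs - sum_list [m]]).
        \<forall>i j. i < j \<and> j < length [m] \<longrightarrow> p (sum_list (take i [m])) < p (sum_list (take j [m]))}.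
        scale (koszul p (map fst ?zs) * msign (plug_exp [(q, ident g)] [m] (permute_list p ?zs)))
          (ident f (plug [(q, ident g)] [m] (permute_list p ?zs))))
      = (\<Sum>p\<in>block_shuffles [m, ?N - m].
          psg p (f (g (take m (permute_list p ws)) # drop m (permute_list p ws))))"
      unfolding B
    proof (rule sum.cong[OF refl])
      fix p assume "p \<in> block_shuffles [m, ?N - m]"
      then have p: "p permutes {..<?N}"
        using block_shuffles_permutes[of p "[m, ?N - m]"] m by simp
      let ?us = "permute_list p ws"
      have ps: "permute_list p ?zs = map (Pair 1) ?us"
        by (rule permute_list_map[OF p])
      have ne: "take m ?us \<noteq> []"
        using m \<open>ws \<noteq> []\<close> by (metis atLeastAtMost_iff length_permute_list length_0_conv
            not_one_le_zero take_eq_Nil)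
      have "ident f ((q + int (length (take m ?us)), g (take m ?us)) # map (Pair 1) (drop m ?us))
          = f (g (take m ?us) # drop m ?us)"
      proof (cases "g (take m ?us) = 0")
        case True
        then show ?thesis
          using cochain_zero_mem[OF assms(1)] ident_zero_mem[OF assms(1)] by simp
      next
        case False
        then have "q + int (length (take m ?us)) = 1"
          using supportedD[OF assms(2) False] assms(4) by simp
        then show ?thesis
          using ident_ones[of f "g (take m ?us) # drop m ?us"] by simp
      qed
      then have pl: "ident f (plug [(q, ident g)] [m] (permute_list p ?zs))
          = f (g (take m ?us) # drop m ?us)"
        using ident_ones[of g "take m ?us"] ne by (simp add: ps take_map drop_map)
      have pe: "plug_exp [(q, ident g)] [m] (permute_list p ?zs) = 0"
        by (simp add: degs_def)
      show "scale (koszul p (map fst ?zs) * msign (plug_exp [(q, ident g)] [m] (permute_list p ?zs)))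
          (ident f (plug [(q, ident g)] [m] (permute_list p ?zs)))
        = psg p (f (g (take m ?us) # drop m ?us))"
        unfolding koszul_ones[OF p] pl pe by (simp add: scale_sign msign_def)
    qed
  qed
  also have "\<dots> = (\<Sum>m\<in>{1..?N}. usum (\<lambda>A B. if length A = m then f (g A # B) else 0) ws)"
    by (intro sum.cong refl sum_block_shuffles) simp
  \<comment> \<open>The brace admits arities from 1 on, while \<open>ins\<close> also has an empty
    left block; that term vanishes because \<open>g [] = 0\<close>.\<close>
  also have "\<dots> = ins g f ws"
    unfolding usum_sum[symmetric] ins_def
  proof (rule usum_cong)
    fix A B :: "'g list" assume "length A + length B = length ws"
    then show "(\<Sum>m = 1..?N. if length A = m then f (g A # B) else 0) = f (g A # B)"
      using assms(3) cochain_zero_mem[OF assms(1), of "0 # B"] by (cases A) simp_all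
  qed
  finally show "brace scale (ident f) [(q, ident g)] ?zs = ins g f ws" .
qed

text \<open>\<open>f\<close> with \<open>T\<close> applied to \<open>i\<close> of its arguments, in all possible ways (\<open>opsub_eq_sum\<close> below)\<close>

definition opsub :: "nat \<Rightarrow> ('g \<Rightarrow> 'g) \<Rightarrow> ('g list \<Rightarrow> 'g) \<Rightarrow> 'g list \<Rightarrow> 'g" where
  "opsub i T f = usum (\<lambda>A B. if length A = i then f (map T A @ B) else 0)"

lemma tilde_operator_length: "length l \<noteq> 1 \<Longrightarrow> tilde_operator T l = 0"
  by (auto simp: tilde_operator_def split: list.splits)

lemma plug_operator_zero:
  assumes "\<exists>m\<in>set ms. m \<noteq> 1" "sum_list ms \<le> length ys" "length ms = i"
  shows "\<exists>z\<in>set (plug (replicate i (0, tilde_operator T)) ms ys). snd z = 0"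
  using assms
proof (induction ms arbitrary: i ys)
  case (Cons m ms)
  obtain i' where i: "i = Suc i'"
    using Cons.prems(3) by (cases i) auto
  show ?case
  proof (cases "m = 1")
    case True
    then show ?thesis
      using Cons.IH[of "drop m ys" i'] Cons.prems i by auto
  next
    case False
    then show ?thesis
      using tilde_operator_length[of "take m ys" T] Cons.prems(2) i by auto
  qed
qed simp

lemma plug_operator_ones:
  "i \<le> length ws \<Longrightarrow> plug (replicate i (0, tilde_operator T)) (replicate i 1) (map (Pair 1) ws)
    = map (Pair 1) (map T (take i ws) @ drop i ws)"
proof (induction i arbitrary: ws)
  case (Suc i)
  then show ?case
    by (cases ws) (simp_all add: degs_def tilde_operator_def)
qed simp

text \<open>\<open>tilde_operator T\<close> lives in arity 1, so among all choices of arities only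
  the constant 1 contributes, and the sum runs over the \<open>i\<close> arguments to which
  \<open>T\<close> is applied.\<close>

lemma brace_operator:
  assumes "cochain b f" "T 0 = 0"
  shows "brace scale (ident f) (replicate i (0, tilde_operator T)) = ident (opsub i T f)"
proof (rule ident_eqI)
  have "tilde_operator T l = 0" if "\<exists>z\<in>set l. fst z \<noteq> 1" for l
    using that by (auto simp: tilde_operator_def split: list.splits)
  then show "brace scale (ident f) (replicate i (0, tilde_operator T)) zs = 0" if "\<exists>z\<in>set zs. fst z \<noteq> 1" for zs
    by (intro brace_eq_0_of_degree[OF assms(1) _ that]) auto
  show "brace scale (ident f) (replicate i (0, tilde_operator T)) [] = 0"
    unfolding brace_def by (rule sum.neutral) (auto simp: block_shuffles_0)
next
  fix ws :: "'g list" assume "ws \<noteq> []"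
  let ?N = "length ws"
  let ?zs = "map (Pair (1::int)) ws"
  let ?gs = "replicate i (0::int, tilde_operator T)"
  let ?M = "{ms. length ms = length ?gs \<and> set ms \<subseteq> {1..length ?zs} \<and> sum_list ms \<le> length ?zs}"
  let ?P = "\<lambda>ms. {p \<in> block_shuffles (ms @ [length ?zs - sum_list ms]). \<forall>i j. i < j \<and> j < length ms \<longrightarrow>
      p (sum_list (take i ms)) < p (sum_list (take j ms))}"
  let ?V = "\<lambda>ms. \<Sum>p\<in>?P ms. scale (koszul p (map fst ?zs) * msign (plug_exp ?gs ms (permute_list p ?zs)))
          (ident f (plug ?gs ms (permute_list p ?zs)))"
  have fin: "finite ?M"
    by (rule finite_subset[OF _ finite_lists_length_eq[of "{1..?N}" i]]) auto
  have zero: "?V ms = 0" if "ms \<in> ?M" "ms \<noteq> replicate i 1" for ms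
  proof (rule sum.neutral, rule ballI)
    fix p
    have "\<exists>m\<in>set ms. m \<noteq> 1"
      using that by (metis (mono_tags, lifting) length_replicate mem_Collect_eq replicate_length_same)
    then have "\<exists>z\<in>set (plug ?gs ms (permute_list p ?zs)). snd z = 0"
      using that by (intro plug_operator_zero) auto
    then have "ident f (plug ?gs ms (permute_list p ?zs)) = 0"
      by (intro ident_zero_mem[OF assms(1)]) blast
    then show "scale (koszul p (map fst ?zs) * msign (plug_exp ?gs ms (permute_list p ?zs)))
          (ident f (plug ?gs ms (permute_list p ?zs))) = 0"
      by simp
  qed
  have "brace scale (ident f) ?gs ?zs = (\<Sum>ms\<in>?M. ?V ms)"
    by (simp only: brace_def)
  also have "\<dots> = (\<Sum>ms\<in>?M \<inter> {replicate i 1}. ?V ms)"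
    by (rule sum.mono_neutral_right) (use fin zero in auto)
  also have "\<dots> = opsub i T f ws"
  proof (cases "i \<le> ?N")
    case False
    then have "?M \<inter> {replicate i 1} = {}"
      by (auto simp: sum_list_replicate)
    moreover have "opsub i T f ws = usum (\<lambda>A B. 0) ws"
      unfolding opsub_def by (rule usum_cong) (use False in auto)
    ultimately show ?thesis
      by simp
  next
    case True
    then have M: "?M \<inter> {replicate i 1} = {replicate i 1}"
      using \<open>ws \<noteq> []\<close> by (auto simp: sum_list_replicate Suc_le_eq)
    have P: "?P (replicate i 1) = block_shuffles [i, ?N - i]"
      using block_shuffles_singles[of i "?N - i"] by (simp add: sum_list_replicate)
    have "?V (replicate i 1) = (\<Sum>p\<in>block_shuffles [i, ?N - i].
        psg p (f (map T (take i (permute_list p ws)) @ drop i (permute_list p ws))))"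
      unfolding P
    proof (rule sum.cong[OF refl])
      fix p assume "p \<in> block_shuffles [i, ?N - i]"
      then have p: "p permutes {..<?N}"
        using block_shuffles_permutes[of p "[i, ?N - i]"] True by simp
      let ?us = "permute_list p ws"
      have ps: "permute_list p ?zs = map (Pair 1) ?us"
        by (rule permute_list_map[OF p])
      have le: "i \<le> length ?us"
        using True by simp
      have "map T (take i ?us) @ drop i ?us \<noteq> []"
        using \<open>ws \<noteq> []\<close> by (metis append_is_Nil_conv append_take_drop_id length_0_conv
            length_permute_list map_is_Nil_conv)
      then have pl: "ident f (plug ?gs (replicate i 1) (permute_list p ?zs))
          = f (map T (take i ?us) @ drop i ?us)"
        unfolding ps plug_operator_ones[OF le] ident_ones by (simp only: if_False)
      show "scale (koszul p (map fst ?zs) * msign (plug_exp ?gs (replicate i 1) (permute_list p ?zs)))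
          (ident f (plug ?gs (replicate i 1) (permute_list p ?zs)))
        = psg p (f (map T (take i ?us) @ drop i ?us))"
        unfolding koszul_ones[OF p] plug_exp_degree_0 pl by (simp add: scale_sign msign_def)
    qed
    also have "\<dots> = opsub i T f ws"
      unfolding opsub_def by (rule sum_block_shuffles) (use True in simp)
    finally show ?thesis
      unfolding M by simp
  qed
  finally show "brace scale (ident f) ?gs ?zs = opsub i T f ws" .
qed

text \<open>The case of zero copies of an operator; the identity serves as a dummy.\<close>

lemma brace_Nil: "cochain b f \<Longrightarrow> brace scale (ident f) [] = ident f"
proof -
  assume f: "cochain b f"
  have "opsub 0 (\<lambda>x. x) f = f"
    unfolding opsub_def fun_eq_iff using usum_left_0[of "\<lambda>A B. f (map (\<lambda>x. x) A @ B)"] by simp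
  then show ?thesis
    using brace_operator[OF f, of "\<lambda>x. x" 0] by simp
qed

lemma tilde_bracket_ident: "tilde_bracket br = ident brc"
  by (auto simp: fun_eq_iff tilde_bracket_def ident_def brc_def split: list.splits)

lemma tilde_operator_ident: "T 0 = 0 \<Longrightarrow> tilde_operator T = ident (\<lambda>ws. T (idc ws))"
  by (auto simp: fun_eq_iff tilde_operator_def ident_def idc_def split: list.splits)

end

section \<open>Identification of the cochain spaces\<close>

text \<open>Outside degree 1 the space s\<gg> still contains the zero vector, so a homogeneous list
  may have entries of any degree, as long as those are zero.\<close>

lemma homs_ones_iff: "homs (susp deg0) zs \<longleftrightarrow> (\<forall>z\<in>set zs. fst z = 1 \<or> snd z = 0)"
  by (auto simp: homs_def susp_def deg0_def split: if_splits)

lemma take_nth_split: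
  assumes "i < j" "j < length xs"
  obtains us vs ws where "xs = us @ xs ! i # vs @ xs ! j # ws" "length us = i" "j = i + Suc (length vs)"
proof
  have "xs = take i xs @ xs ! i # drop (Suc i) xs"
    using assms by (intro id_take_nth_drop) simp
  also have "drop (Suc i) xs = take (j - Suc i) (drop (Suc i) xs)
      @ drop (Suc i) xs ! (j - Suc i) # drop (Suc (j - Suc i)) (drop (Suc i) xs)"
    using assms by (intro id_take_nth_drop) simp
  also have "drop (Suc i) xs ! (j - Suc i) = xs ! j"
    using assms by simp
  finally show "xs = take i xs @ xs ! i # take (j - Suc i) (drop (Suc i) xs)
      @ xs ! j # drop (Suc (j - Suc i)) (drop (Suc i) xs)" .
qed (use assms in auto)

lemma permute_list_transpose:
  "permute_list (transpose (length us) (length us + Suc (length vs))) (us @ x # vs @ y # ws)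
    = us @ y # vs @ x # ws"
proof -
  have p: "transpose (length us) (length us + Suc (length vs)) permutes {..<length (us @ x # vs @ y # ws)}"
    by (rule permutes_swap_id) auto
  show ?thesis
  proof (rule nth_equalityI)
    fix i assume "i < length (permute_list (transpose (length us) (length us + Suc (length vs))) (us @ x # vs @ y # ws))"
    then have "i < length (us @ x # vs @ y # ws)"
      by simp
    then show "permute_list (transpose (length us) (length us + Suc (length vs))) (us @ x # vs @ y # ws) ! i
        = (us @ y # vs @ x # ws) ! i"
      by (subst permute_list_nth[OF p]) (auto simp: transpose_def nth_append nth_Cons' split: if_splits)
  qed simp
qed

context lie_alg
begin

text \<open>The first copy of \<open>x\<close> is swapped past \<open>vs\<close> until the two
  copies are neighbours.\<close>

lemma cochain_alt_far:
  assumes "cochain a f"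
  shows "f (us @ x # vs @ x # ws) = 0"
proof (induction vs arbitrary: us)
  case Nil
  then show ?case
    using cochain_alt[OF assms] by simp
next
  case (Cons v vs)
  have "f (us @ x # v # vs @ x # ws) = - f (us @ v # x # vs @ x # ws)"
    by (rule cochain_swap[OF assms])
  then show ?case
    using Cons.IH[of "us @ [v]"] by simp
qed

lemma cochain_swap_far:
  assumes "cochain a f"
  shows "f (us @ x # vs @ y # ws) = - f (us @ y # vs @ x # ws)"
proof -
  note c = cochain_add[OF assms, of us x y "vs @ (x + y) # ws"]
    cochain_add[OF assms, of "us @ x # vs" x y ws] cochain_add[OF assms, of "us @ y # vs" x y ws]
  have "f (us @ x # vs @ y # ws) + f (us @ y # vs @ x # ws) = 0"
    using c cochain_alt_far[OF assms] by simp
  then show ?thesis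
    by (simp add: eq_neg_iff_add_eq_0)
qed

lemma cochain_permute:
  assumes f: "cochain a f" and p: "p permutes {..<length ws}"
  shows "f (permute_list p ws) = psg p (f ws)"
proof -
  have "f (permute_list p xs) = psg p (f xs)" if "length xs = length ws" for xs
    using p finite_lessThan that
  proof (induction arbitrary: xs rule: permutes_induct)
    case (swap i j p)
    have t: "f (permute_list (transpose i j) xs) = - f xs" if ij: "i < j" "j < length xs" for i j xs
    proof -
      obtain us vs rs where s: "xs = us @ xs ! i # vs @ xs ! j # rs" "length us = i"
        "j = i + Suc (length vs)"
        using take_nth_split[OF ij] .
      have "permute_list (transpose i j) xs = us @ xs ! j # vs @ xs ! i # rs"
        using permute_list_transpose[of us vs "xs ! i" "xs ! j" rs] s by simp
      then show ?thesis
        using cochain_swap_far[OF f, of us "xs ! j" vs "xs ! i" rs] s(1) by simp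
    qed
    have "i < length xs" "j < length xs"
      using swap by auto
    then have "f (permute_list (transpose i j) xs) = - f xs"
      using t[of i j xs] t[of j i xs] \<open>i \<noteq> j\<close> by (cases "i < j") (auto simp: transpose_commute)
    moreover have "permute_list (transpose i j \<circ> p) xs = permute_list p (permute_list (transpose i j) xs)"
      by (rule permute_list_compose) (use swap in simp)
    moreover have "psg (transpose i j \<circ> p) (f xs) = psg (transpose i j) (psg p (f xs))"
      by (rule psg_compose[OF permutes_swap_id \<open>p permutes _\<close>]) (use swap in auto)
    moreover have "psg (transpose i j) v = - v" for v :: 'g
      using \<open>i \<noteq> j\<close> by (simp add: psg_def sign_swap_id)
    moreover have "f (permute_list p (permute_list (transpose i j) xs))
        = psg p (f (permute_list (transpose i j) xs))"
      using swap.IH[of "permute_list (transpose i j) xs"] swap.prems by simp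
    ultimately show ?case
      by (simp only:) (simp add: psg_def)
  qed simp
  then show ?thesis
    by simp
qed

lemma linear_scale_iff:
  "Vector_Spaces.linear scale scale h \<longleftrightarrow>
    (\<forall>x y. h (x + y) = h x + h y) \<and> (\<forall>c x. h (scale c x) = scale c (h x))"
  by (auto simp: linear_iff_module_hom module_hom_iff module_axioms)

lemma alt_cochains_iff: "f \<in> alt_cochains scale n \<longleftrightarrow> cochain (int n) f"
proof
  assume f: "f \<in> alt_cochains scale n"
  have s: "f ws = 0" if "length ws \<noteq> n" for ws
    using f that by (auto simp: alt_cochains_def)
  have l: "f (us @ (x + y) # ws) = f (us @ x # ws) + f (us @ y # ws)"
    "f (us @ scale c x # ws) = scale c (f (us @ x # ws))" for us x y ws c
    using f s[of "us @ _ # ws"] by (cases "length us + length ws + 1 = n";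
        auto simp: alt_cochains_def linear_scale_iff)+
  show "cochain (int n) f"
  proof (rule cochainI)
    show "supported (int n) f"
      using s by (auto simp: supported_def)
    show "f (us @ x # x # ws) = 0" for us x ws
    proof -
      have "\<forall>xs i j. i < j \<and> j < length xs \<and> xs ! i = xs ! j \<longrightarrow> f xs = 0"
        using f by (simp add: alt_cochains_def)
      from this[rule_format, of "length us" "Suc (length us)" "us @ x # x # ws"] show ?thesis
        by (simp add: nth_append)
    qed
  qed (fact l)+
next
  assume f: "cochain (int n) f"
  have "f xs = 0" if "i < j" "j < length xs" "xs ! i = xs ! j" for xs i j
    using take_nth_split[OF that(1,2)] cochain_alt_far[OF f] that(3) by metis
  then show "f \<in> alt_cochains scale n"
    using f by (auto simp: alt_cochains_def linear_scale_iff cochain_def supported_def)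
qed

text \<open>Reconciles integer arities with \<open>homological\<close>, which is zero in positive
  degrees.\<close>

lemma cochain_negative: "cochain a f \<Longrightarrow> a < 0 \<Longrightarrow> f = 0"
  unfolding fun_eq_iff using cochain_supported[of a f] by (force simp: supported_def)

text \<open>A map of degree \<open>d\<close> sends \<open>n\<close> vectors of degree 1 to degree
  \<open>d + n\<close>, and \<gg> is concentrated in degree 0; so only the arity \<open>- d\<close>
  occurs. The Koszul symmetry is alternation by \<open>koszul_ones\<close>.\<close>

lemma ident_in_sym_hom:
  assumes f: "cochain (- d) f" and n: "f [] = 0"
  shows "ident f \<in> sym_hom scale (susp deg0) deg0 d"
proof -
  have ones: "\<forall>z\<in>set zs. fst z = 1" if "ident f zs \<noteq> 0" for zs
    using that by (auto simp: ident_def split: if_splits)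
  have 1: "ident f zs = 0" if "\<not> (zs \<noteq> [] \<and> homs (susp deg0) zs)" for zs
    using that ones[of zs] by (auto simp: homs_ones_iff)
  have 2: "ident f zs \<in> deg0 (d + degs zs)" for zs
  proof (cases "ident f zs = 0")
    case False
    then obtain ws where w: "zs = map (Pair 1) ws"
      using all_ones[OF ones] by metis
    then have "f ws \<noteq> 0"
      using False by (auto simp: ident_ones split: if_splits)
    then show ?thesis
      using supportedD[OF cochain_supported[OF f]] w by (simp add: deg0_def)
  qed (simp add: deg0_def)
  have 3: "multilinear_on scale scale (susp deg0) (ident f)"
    unfolding multilinear_on_def
  proof (intro allI impI)
    fix us ws :: "(int \<times> 'g) list" and p x y c
    show "ident f (us @ (p, x + y) # ws) = ident f (us @ (p, x) # ws) + ident f (us @ (p, y) # ws) \<and>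
      ident f (us @ (p, scale c x) # ws) = scale c (ident f (us @ (p, x) # ws))"
    proof (cases "\<forall>z\<in>set (us @ (p, x) # ws). fst z = 1")
      case True
      then show ?thesis
        using cochain_add[OF f] cochain_scale[OF f] by (simp add: ident_def)
    next
      case False
      then have "\<exists>z\<in>set (us @ (p, w) # ws). fst z \<noteq> 1" for w
        by auto
      then show ?thesis
        by (simp add: ident_not_ones)
    qed
  qed
  have 4: "ident f (permute_list p zs) = scale (koszul p (map fst zs)) (ident f zs)"
    if "p permutes {..<length zs}" for zs p
  proof (cases "\<forall>z\<in>set zs. fst z = 1")
    case True
    then obtain ws where w: "zs = map (Pair 1) ws"
      using all_ones by metis
    then have p: "p permutes {..<length ws}"
      using that by simp
    show ?thesis
    proof (cases "ws = []")
      case False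
      then have "permute_list p ws \<noteq> []"
        by (metis length_0_conv length_permute_list)
      then show ?thesis
        using False cochain_permute[OF f p] unfolding w permute_list_map[OF p] koszul_ones[OF p] ident_ones scale_sign
        by simp
    qed (simp add: w)
  next
    case False
    then have "\<exists>z\<in>set zs. fst z \<noteq> 1" "\<exists>z\<in>set (permute_list p zs). fst z \<noteq> 1"
      using that by auto
    then show ?thesis
      by (simp add: ident_not_ones)
  qed
  show ?thesis
    unfolding sym_hom_def using 1 2 3 4 by blast
qed

text \<open>Evaluation on vectors of degree 1 recovers the cochain. Exchanging two equal neighbours
  has Koszul sign -1, so the value is its own negative and vanishes in characteristic 0.\<close>

lemma sym_homE:
  assumes "F \<in> sym_hom scale (susp deg0) deg0 d"
  obtains f where "cochain (- d) f" "f [] = 0" "F = ident f"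
proof
  define f where "f = (\<lambda>ws. F (map (Pair 1) ws))"
  have off: "F zs = 0" if "\<not> (zs \<noteq> [] \<and> homs (susp deg0) zs)" for zs
    using assms that unfolding sym_hom_def by blast
  have deg: "F zs \<in> deg0 (d + degs zs)" if "zs \<noteq> []" "homs (susp deg0) zs" for zs
    using assms that unfolding sym_hom_def by blast
  have ml: "F (us @ (p, x + y) # ws) = F (us @ (p, x) # ws) + F (us @ (p, y) # ws)"
    "F (us @ (p, scale c x) # ws) = scale c (F (us @ (p, x) # ws))"
    if "homs (susp deg0) us" "homs (susp deg0) ws" "x \<in> susp deg0 p" "y \<in> susp deg0 p" for us ws p x y c
    using assms that unfolding sym_hom_def multilinear_on_def by blast+
  have sym: "F (permute_list p zs) = scale (koszul p (map fst zs)) (F zs)"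
    if "homs (susp deg0) zs" "p permutes {..<length zs}" for zs p
    using assms that unfolding sym_hom_def by blast
  have h: "homs (susp deg0) (map (Pair 1) ws)" for ws :: "'g list"
    by (auto simp: homs_ones_iff)
  have one: "x \<in> susp deg0 1" for x :: 'g
    by (simp add: susp_def deg0_def)
  show "f [] = 0"
    by (simp add: f_def off)
  then show "F = ident f"
  proof (intro ident_eqI)
    fix zs :: "(int \<times> 'g) list" assume "\<exists>z\<in>set zs. fst z \<noteq> 1"
    then obtain z where z: "z \<in> set zs" "fst z \<noteq> 1" ..
    show "F zs = 0"
    proof (cases "homs (susp deg0) zs")
      case True
      then have "snd z = 0"
        using z by (auto simp: homs_ones_iff)
      obtain us ws where zs: "zs = us @ z # ws"
        using z(1) by (auto dest: split_list)
      have "homs (susp deg0) us" "homs (susp deg0) ws" "(0 :: 'g) \<in> susp deg0 (fst z)"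
        using True by (auto simp: homs_ones_iff zs susp_def deg0_def)
      \<comment> \<open>Additivity at \<open>0 + 0\<close>: a zero entry annihilates the
        value.\<close>
      from ml(1)[OF this this(3)] have "F (us @ (fst z, 0) # ws) = 0"
        by simp
      then show ?thesis
        using \<open>snd z = 0\<close> zs by (metis prod.collapse)
    qed (simp add: off)
  qed (simp_all add: f_def off)
  show "cochain (- d) f"
  proof (rule cochainI)
    show "supported (- d) f"
      unfolding supported_def
    proof (intro allI impI)
      fix ws assume "f ws \<noteq> 0"
      then have "map (Pair (1::int)) ws \<noteq> []" "F (map (Pair 1) ws) \<noteq> 0"
        using off[of "[]"] by (auto simp: f_def)
      then show "int (length ws) = - d"
        using deg[OF _ h, of ws] by (auto simp: deg0_def split: if_splits)
    qed
    show "f (us @ (x + y) # ws) = f (us @ x # ws) + f (us @ y # ws)"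
      "f (us @ scale c x # ws) = scale c (f (us @ x # ws))" for us x y ws c
      using ml[OF h h one one] by (simp_all add: f_def)
    show "f (us @ x # x # ws) = 0" for us x ws
    proof -
      let ?p = "transpose (length us) (length us + Suc (length ([] :: 'g list)))"
      let ?ws = "us @ x # [] @ x # ws"
      have p: "?p permutes {..<length ?ws}"
        by (rule permutes_swap_id) auto
      have "permute_list ?p (map (Pair 1) ?ws) = map (Pair (1::int)) ?ws"
        unfolding permute_list_map[OF p] permute_list_transpose ..
      then have "f ?ws = scale (koszul ?p (map fst (map (Pair (1::int)) ?ws))) (f ?ws)"
        using sym[OF h, of ?p ?ws] p unfolding f_def by simp
      also have "\<dots> = - f ?ws"
        unfolding koszul_ones[OF p] scale_sign by (simp add: psg_def sign_swap_id)
      finally have "f ?ws + f ?ws = 0"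
        by (simp add: eq_neg_iff_add_eq_0)
      then have "f ?ws = 0"
        by (rule double_eq_0D)
      then show ?thesis
        by simp
    qed
  qed
qed

lemma sym_hom_susp: "sym_hom scale A (susp B) d = sym_hom scale A B (d - 1)"
  by (simp add: sym_hom_def susp_def algebra_simps)

text \<open>Both slots of \<open>brc\<close> are filled, so no argument is left for an identity
  factor. The ordering of the blocks sends the first argument \<open>x\<close> to \<open>g\<close>,
  so the brace is the half of \<open>g \<sqinter> h\<close> with \<open>x\<close> on the left. The
  sign moves the second entry, of degree \<open>q\<close>, past the \<open>a\<close> arguments of
  \<open>g\<close>.\<close>

lemma brace_two:
  assumes g: "supported a g" "g [] = 0" "p + a = 1" and h: "supported b h" "h [] = 0" "q + b = 1"
  shows "brace scale (ident brc) [(p, ident g), (q, ident h)]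
    = ident (\<lambda>ws. case ws of [] \<Rightarrow> 0 | x # xs \<Rightarrow> sg (q * a) ((contr x g \<sqinter> h) xs))"
proof (rule ident_eqI)
  let ?gs = "[(p, ident g), (q, ident h)]"
  show "brace scale (ident brc) ?gs zs = 0" if "\<exists>z\<in>set zs. fst z \<noteq> 1" for zs
    by (rule brace_eq_0_of_degree[OF cochain_brc _ that]) (auto intro: ident_not_ones)
  show "brace scale (ident brc) ?gs [] = 0"
    by (simp add: brace_def)
  fix ws :: "'g list" assume "ws \<noteq> []"
  then obtain x xs where ws: "ws = x # xs"
    by (cases ws) auto
  let ?n = "length xs"
  let ?N = "Suc ?n"
  let ?zs = "map (Pair (1::int)) (x # xs)"
  let ?M = "{ms. length ms = length ?gs \<and> set ms \<subseteq> {1..length ?zs} \<and> sum_list ms \<le> length ?zs}"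
  let ?P = "\<lambda>ms. {r \<in> block_shuffles (ms @ [length ?zs - sum_list ms]). \<forall>i j. i < j \<and> j < length ms \<longrightarrow>
      r (sum_list (take i ms)) < r (sum_list (take j ms))}"
  let ?V = "\<lambda>ms r. scale (koszul r (map fst ?zs) * msign (plug_exp ?gs ms (permute_list r ?zs)))
          (ident brc (plug ?gs ms (permute_list r ?zs)))"
  have fin: "finite ?M"
    by (rule finite_subset[OF _ finite_lists_length_eq[of "{1..?N}" 2]]) auto
  have zero: "(\<Sum>r\<in>?P ms. ?V ms r) = 0" if ms: "ms \<in> ?M" "ms \<notin> (\<lambda>m. [Suc m, ?n - m]) ` {..<?n}" for ms
  proof (rule sum.neutral, rule ballI)
    fix r
    obtain m k where mk: "ms = [m, k]" "m + k \<le> ?N" "m \<ge> 1" "k \<ge> 1"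
      using ms(1) by (auto simp: length_Suc_conv)
    have "m + k \<noteq> ?N"
    proof
      assume "m + k = ?N"
      then have "ms = (\<lambda>m. [Suc m, ?n - m]) (m - 1)" "m - 1 \<in> {..<?n}"
        using mk by auto
      then show False
        using ms(2) by blast
    qed
    then have "length (plug ?gs ms (permute_list r ?zs)) \<noteq> 2"
      using mk by simp
    then have "ident brc (plug ?gs ms (permute_list r ?zs)) = 0"
      unfolding ident_def brc_def by (auto split: list.splits)
    then show "?V ms r = 0"
      by simp
  qed
  have main: "(\<Sum>r\<in>?P [Suc m, ?n - m]. ?V [Suc m, ?n - m] r)
      = usum (\<lambda>A B. if length A = m then sg (q * a) (br (g (x # A)) (h B)) else 0) xs"
    if m: "m < ?n" for m
  proof -
    obtain k where k: "?n - m = Suc k"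
      using m by (metis Suc_diff_Suc)
    have n: "?n = m + Suc k"
      using k m by linarith
    have P: "?P [Suc m, ?n - m] = shift ` block_shuffles [m, Suc k]"
      using block_shuffles_ordered[of m k] n by (simp add: numeral_2_eq_2)
    have "(\<Sum>r\<in>shift ` block_shuffles [m, Suc k]. ?V [Suc m, ?n - m] r)
      = (\<Sum>r\<in>block_shuffles [m, Suc k]. psg r (sg (q * a)
          (br (g (x # take m (permute_list r xs))) (h (drop m (permute_list r xs))))))"
    proof (rule sum.reindex_cong[OF inj_on_subset[OF inj_shift subset_UNIV] refl])
      fix r assume "r \<in> block_shuffles [m, Suc k]"
      then have r: "r permutes {..<?n}"
        using block_shuffles_permutes[of r "[m, Suc k]"] n by simp
      have r': "shift r permutes {..<length (x # xs)}"
        using shift_permutes[OF r] by simp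
      let ?us = "permute_list r xs"
      let ?A = "x # take m ?us" and ?B = "drop m ?us"
      have ps: "permute_list (shift r) ?zs = map (Pair 1) (x # ?us)"
        unfolding permute_list_map[OF r'] permute_list_shift ..
      have B: "length ?B = Suc k" "length ?A = Suc m"
        using n by simp_all
      then have "?B \<noteq> []"
        by auto
      then have pl: "plug ?gs [Suc m, ?n - m] (permute_list (shift r) ?zs)
          = [(p + int (Suc m), g ?A), (q + int (Suc k), h ?B)]"
        using ident_ones[of g ?A] ident_ones[of h ?B] degs_ones[of ?A] degs_ones[of ?B] B n
        unfolding ps by (simp add: take_map drop_map)
      have pe: "plug_exp ?gs [Suc m, ?n - m] (permute_list (shift r) ?zs) = q * int (Suc m)"
        using degs_ones[of ?A] B n unfolding ps by (simp add: take_map degs_def)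
      have "sg (q * int (Suc m)) (ident brc [(p + int (Suc m), g ?A), (q + int (Suc k), h ?B)])
          = sg (q * a) (br (g ?A) (h ?B))"
      proof (cases "g ?A = 0 \<or> h ?B = 0")
        case True
        then show ?thesis
          using biadd_zero[OF biadd_br] by (auto simp: ident_def)
      next
        case False
        then have "int (Suc m) = a" "int (Suc k) = b"
          using supportedD[OF g(1), of ?A] supportedD[OF h(1), of ?B] B by auto
        then show ?thesis
          using g(3) h(3) by (simp add: ident_def)
      qed
      then show "?V [Suc m, ?n - m] (shift r) = psg r (sg (q * a) (br (g ?A) (h ?B)))"
        unfolding pl pe koszul_ones[OF r'] scale_scale[symmetric] scale_sign scale_msign psg_shift[OF r]
        by simp
    qed
    also have "\<dots> = usum (\<lambda>A B. if length A = m then sg (q * a) (br (g (x # A)) (h B)) else 0) xs"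
      by (rule sum_block_shuffles) (rule n)
    finally show ?thesis
      unfolding P .
  qed
  have "brace scale (ident brc) ?gs ?zs = (\<Sum>ms\<in>?M. \<Sum>r\<in>?P ms. ?V ms r)"
    by (simp only: brace_def)
  also have "\<dots> = (\<Sum>ms\<in>(\<lambda>m. [Suc m, ?n - m]) ` {..<?n}. \<Sum>r\<in>?P ms. ?V ms r)"
    by (rule sum.mono_neutral_right[OF fin]) (use zero in auto)
  also have "\<dots> = (\<Sum>m<?n. usum (\<lambda>A B. if length A = m then sg (q * a) (br (g (x # A)) (h B)) else 0) xs)"
    by (rule sum.reindex_cong[OF _ refl]) (use main in \<open>auto simp: inj_on_def\<close>)
  also have "\<dots> = usum (\<lambda>A B. sg (q * a) (br (g (x # A)) (h B))) xs"
    unfolding usum_sum[symmetric]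
  proof (rule usum_cong)
    fix A B :: "'g list" assume "length A + length B = ?n"
    then show "(\<Sum>m<?n. if length A = m then sg (q * a) (br (g (x # A)) (h B)) else 0)
        = sg (q * a) (br (g (x # A)) (h B))"
      using h(2) biadd_zero[OF biadd_br] by (cases B) simp_all
  qed
  also have "\<dots> = sg (q * a) ((contr x g \<sqinter> h) xs)"
    by (simp add: usum_sg wedge_def contr_apply)
  finally show "brace scale (ident brc) ?gs (map (Pair 1) ws)
      = (case ws of [] \<Rightarrow> 0 | x # xs \<Rightarrow> sg (q * a) ((contr x g \<sqinter> h) xs))"
    by (simp add: ws)
qed

end

section \<open>The operations involving the Lie bracket\<close>

lemma permutes_one: "{p. p permutes {..<Suc 0}} = {id}"
  by (simp add: lessThan_Suc)

lemma block_shuffles_1_1: "block_shuffles [1, 1] = {id, rot 1}"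
proof -
  have "shift id = id"
    by (auto simp: fun_eq_iff shift_def split: nat.splits)
  then show ?thesis
    using block_shuffles_Suc_Suc[of 0 0] by (simp add: block_shuffles_0 insert_commute)
qed

lemma permutes_two: "{p. p permutes {..<2}} = {id, rot 1}"
proof -
  have "{p. p permutes {..<2}} = block_shuffles [1, 1]"
    by (auto simp: block_shuffles_two strict_mono_on_def numeral_2_eq_2)
  then show ?thesis
    by (simp only: block_shuffles_1_1)
qed

lemma id_neq_rot: "id \<noteq> rot (Suc m)"
proof
  assume "id = rot (Suc m)"
  then have "id 0 = rot (Suc m) 0"
    by (rule fun_cong)
  then show False
    by (simp add: rot_def)
qed

lemma koszul_inversions:
  "koszul p ds = (\<Prod>(i, j)\<in>inversions (length ds) p. msign (ds ! p i * ds ! p j))"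
  by (simp add: koszul_def inversions_def)

lemma chi_id: "chi id ds = 1"
proof -
  have "inversions n id = {}" for n
    by (auto simp: inversions_def)
  then show ?thesis
    unfolding chi_def koszul_inversions by (simp only: prod.empty sign_id of_int_1 mult_1)
qed

lemma inversions_rot: "inversions (Suc m) (rot m) = (\<lambda>i. (i, m)) ` {..<m}"
  by (auto simp: inversions_def rot_def split: if_splits)

lemma sign_rot: "sign (rot m) = (- 1) ^ m"
  unfolding sign_eq_inversions[OF rot_permutes[OF lessI]] inversions_rot
  by (simp add: card_image inj_on_def)

lemma chi_rot_1: "chi (rot 1) [p, q] = - msign (p * q)"
  unfolding chi_def koszul_inversions sign_rot
  using inversions_rot[of 1] by (simp add: rot_def lessThan_Suc mult.commute numeral_2_eq_2)

lemma permute_list_rot_1: "permute_list (rot 1) [x, y] = [y, x]"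
  using permute_list_rot[of 1 "[y]" x] by simp

lemma fun_scale_apply [simp]: "fun_scale s c f x = s c (f x)"
  by (simp add: fun_scale_def)

context lie_alg
begin

definition ident_list :: "(int \<times> ((int \<times> 'g) list \<Rightarrow> 'g)) list \<Rightarrow> bool" where
  "ident_list gs \<longleftrightarrow> (\<forall>z\<in>set gs. \<exists>b g. cochain b g \<and> snd z = ident g)"

lemma ident_list_simps [simp]: "ident_list []" "ident_list (z # gs) \<longleftrightarrow> (\<exists>b g. cochain b g \<and> snd z = ident g) \<and> ident_list gs"
  by (simp_all add: ident_list_def)

lemma brace_zero: "brace scale 0 gs = 0"
  by (simp add: brace_def fun_eq_iff)

lemma brace_ident_zero: "cochain b g \<Longrightarrow> brace scale (ident g) [(q, 0)] = 0"
  using brace_one[of b g "1 - q" 0 q]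
  by (simp add: ident_zero ins_zero_left supported_def)

lemma nested_zero:
  assumes "ident_list gs" "gs \<noteq> []"
  shows "nested scale p 0 gs = 0"
proof -
  obtain b g where "cochain b g" "snd (hd gs) = ident g"
    using assms by (cases gs) auto
  then show ?thesis
    by (simp add: nested_def brace_zero brace_ident_zero)
qed

lemma ident_list_permute: "p permutes {..<length gs} \<Longrightarrow> ident_list gs \<Longrightarrow> ident_list (permute_list p gs)"
  by (simp add: ident_list_def)

lemma permute_list_eq_Nil: "permute_list p xs = [] \<longleftrightarrow> xs = []"
  by (metis length_0_conv length_permute_list)

lemma op_top_zero: "ident_list gs \<Longrightarrow> gs \<noteq> [] \<Longrightarrow> op_top scale p 0 gs xs = 0"
  unfolding op_top_def
  by (rule sum.neutral) (simp add: nested_zero ident_list_permute permute_list_eq_Nil brace_zero Let_def)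

lemma op_lam_zero: "ident_list gs \<Longrightarrow> gs \<noteq> [] \<Longrightarrow> op_lam scale lam n p 0 gs xs = 0"
  unfolding op_lam_def
  by (rule sum.neutral) (simp add: nested_zero ident_list_permute permute_list_eq_Nil Let_def)

section \<open>Selection of the formula for the mixed operations by arity\<close>

lemma arity_part_zero: "arity_part n 0 = 0"
  by (simp add: arity_part_def fun_eq_iff)

lemma op_mixed_zero: "ident_list gs \<Longrightarrow> gs \<noteq> [] \<Longrightarrow> op_mixed scale lam p 0 gs xs = 0"
  by (simp add: op_mixed_def arity_part_zero op_top_zero op_lam_zero)

lemma arity_part_ident:
  fixes f :: "'g list \<Rightarrow> 'g"
  assumes "supported a f"
  shows "arity_part n (ident f) = (if int n = a then ident f else 0)"
proof
  fix zs :: "(int \<times> 'g) list"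
  have "ident f zs = 0" if "int (length zs) \<noteq> a"
    using supportedD[OF assms, of "map snd zs"] that by (auto simp: ident_def)
  then show "arity_part n (ident f) zs = (if int n = a then ident f else 0) zs"
    by (auto simp: arity_part_def)
qed

text \<open>With more operators than slots of \<open>f\<close>, neither (II)(i) nor (II)(ii)
  applies.\<close>

lemma op_mixed_large:
  assumes "supported a f" "ident_list gs" "gs \<noteq> []" "a < int (length gs)"
  shows "op_mixed scale lam p (ident f) gs xs = 0"
  unfolding op_mixed_def using assms(4)
  by (simp add: arity_part_ident[OF assms(1)] op_top_zero[OF assms(2,3)] op_lam_zero[OF assms(2,3)])

lemma op_mixed_top:
  assumes "supported (int n) f" "ident_list gs" "gs \<noteq> []" "n = length gs"
  shows "op_mixed scale lam p (ident f) gs xs = op_top scale p (ident f) gs xs"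
  unfolding op_mixed_def using assms(4)
  by (simp add: arity_part_ident[OF assms(1)] op_lam_zero[OF assms(2,3)])

lemma op_mixed_lam:
  assumes "supported (int n) f" "ident_list gs" "gs \<noteq> []" "length gs < n"
  shows "op_mixed scale lam p (ident f) gs xs
    = (if n \<le> length xs then op_lam scale lam n p (ident f) gs xs else 0)"
proof -
  have "(\<Sum>k = length gs + 1..length xs. op_lam scale lam k p (arity_part k (ident f)) gs xs)
      = (\<Sum>k = length gs + 1..length xs. if k = n then op_lam scale lam n p (ident f) gs xs else 0)"
    by (rule sum.cong) (auto simp: arity_part_ident[OF assms(1)] op_lam_zero[OF assms(2,3)])
  then show ?thesis
    unfolding op_mixed_def using assms(4)
    by (simp add: arity_part_ident[OF assms(1)] op_top_zero[OF assms(2,3)])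
qed

text \<open>One operator against a binary map: (II)(ii) with \<open>n = 2\<close> and
  \<open>m = 1\<close>, which leaves the factor \<open>lam\<close> and the brace of \<open>g\<close>
  with \<open>brc\<close>.\<close>

lemma op_mixed_brc_one:
  assumes g: "cochain (- p) g" "g [] = 0"
  shows "op_mixed scale lam (- 1) (ident brc) [(p, ident g)]
    = ident (sg (p + 1) (fun_scale scale lam (ins brc g)))"
proof
  fix xs :: "(int \<times> 'g) list"
  have ident_list: "ident_list [(p, ident g)]"
    using g by auto
  have s: "supported (int 2) brc"
    using cochain_supported[OF cochain_brc] by simp
  have n: "nested scale (- 1) (ident brc) [(p, ident g)] = ident (ins brc g)"
    using brace_one[OF g(1) cochain_supported[OF cochain_brc], of "- 1"]
    by (simp add: nested_def susp_list_def brace_Nil[OF cochain_brc] degs_def)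
  have l: "op_lam scale lam 2 (- 1) (ident brc) [(p, ident g)] xs
      = ident (sg (p + 1) (fun_scale scale lam (ins brc g))) xs"
    unfolding op_lam_def
    by (simp add: permutes_one partial_degs_def chi_id chi_id[unfolded id_def] n[simplified] ident_sg ident_fun_scale Let_def
        scale_msign sg_scale mult.commute[of _ lam] scale_scale[symmetric] del: scale_scale)
      (simp add: sg_def)
  \<comment> \<open>\<open>op_mixed\<close> cuts off the arities above \<open>length xs\<close>; on
    lists shorter than 2 the value is zero as well.\<close>
  have "ident (ins brc g) xs = 0" if "length xs < 2"
  proof (rule ccontr)
    assume "ident (ins brc g) xs \<noteq> 0"
    then have nz: "ins brc g (map snd xs) \<noteq> 0" "xs \<noteq> []"
      by (auto simp: ident_def split: if_splits)
    moreover have "length xs = 1"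
      using that nz by (cases xs) auto
    then obtain x where "map snd xs = [x]"
      by (auto simp: length_Suc_conv)
    moreover have "ins brc g [x] = 0"
      by (simp add: ins_def cochain_Cons[OF g(1)])
    ultimately show False
      by simp
  qed
  then show "op_mixed scale lam (- 1) (ident brc) [(p, ident g)] xs
      = ident (sg (p + 1) (fun_scale scale lam (ins brc g))) xs"
    unfolding op_mixed_lam[OF s ident_list, simplified] l
    by (auto simp: ident_sg ident_fun_scale)
qed

text \<open>Two operators against a binary map: (II)(i). The braces of \<open>brc\<close> for the
  two permutations are the two halves of \<open>g \<sqinter> h\<close>, and the nested braces are
  the two action terms of \<open>lbr\<close>.\<close>

lemma op_mixed_brc_two:
  assumes g: "cochain (- p) g" "g [] = 0" and h: "cochain (- q) h" "h [] = 0"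
  shows "op_mixed scale lam (- 1) (ident brc) [(p, ident g), (q, ident h)]
    = ident (sg (p * q) (lbr (- p) (- q) g h))"
proof
  fix xs :: "(int \<times> 'g) list"
  have ident_list: "ident_list [(p, ident g), (q, ident h)]"
    using g h by auto
  have s: "supported (int 2) brc"
    using cochain_supported[OF cochain_brc] by simp
  define hw where "hw g h ws = (case ws of [] \<Rightarrow> 0 | x # xs \<Rightarrow> (contr x g \<sqinter> h) xs)"
    for g h :: "'g list \<Rightarrow> 'g" and ws
  have b: "brace scale (ident brc) [(p + 1, ident g), (q + 1, ident h)]
      = ident (sg ((q + 1) * (- p)) (hw g h))"
    if "cochain (- p) g" "g [] = 0" "cochain (- q) h" "h [] = 0" for p q g h
  proof -
    have "(\<lambda>ws. case ws of [] \<Rightarrow> 0 | x # xs \<Rightarrow> sg ((q + 1) * (- p)) ((contr x g \<sqinter> h) xs))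
        = sg ((q + 1) * (- p)) (hw g h)"
      by (auto simp: fun_eq_iff hw_def split: list.splits)
    then show ?thesis
      using brace_two[OF cochain_supported[OF that(1)] that(2) _ cochain_supported[OF that(3)] that(4),
          of "p + 1" "q + 1"] by (simp del: sg_apply)
  qed
  have n: "nested scale (- 1) (ident brc) [(p, ident g), (q, ident h)] = ident (ins (h \<sqinter> idc) g)"
    if "cochain (- p) g" "cochain (- q) h" "h [] = 0" for p q g h
  proof -
    have "brace scale (ident brc) [(q + 1, ident h)] = ident (h \<sqinter> idc)"
      using brace_one[OF cochain_brc cochain_supported[OF that(2)] that(3), of "q + 1"]
      by (simp add: ins_brc[OF that(2)])
    moreover have "brace scale (ident g) [(q, ident (h \<sqinter> idc))] = ident (ins (h \<sqinter> idc) g)"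
      by (rule brace_one[OF that(1) cochain_supported[OF cochain_wed_idc[OF that(2)]]])
        (simp_all add: that biadd_zero[OF biadd_br])
    ultimately show ?thesis
      by (simp add: nested_def susp_list_def degs_def)
  qed
  \<comment> \<open>The summands of the identity and of the transposition. For the transposition,
    \<open>chi\<close> contributes \<open>p * q + 1\<close> and the partial degrees contribute
    \<open>q\<close>.\<close>
  let ?A = "sg p (sg ((q + 1) * (- p)) (hw g h) + (- sg (p + 1) (ins (h \<sqinter> idc) g)))"
  let ?B = "sg (p * q + q + 1) (sg ((p + 1) * (- q)) (hw h g) + (- sg (q + 1) (ins (g \<sqinter> idc) h)))"
  have T: "op_top scale (- 1) (ident brc) [(p, ident g), (q, ident h)] xs
      = ident ?A xs + ident ?B xs"
  proof -
    let ?t = "\<lambda>r. let gs' = permute_list r [(p, ident g), (q, ident h)] in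
        scale (chi r (map fst [(p, ident g), (q, ident h)])
            * msign (int (length [(p, ident g), (q, ident h)]) * (- 1) + partial_degs gs'))
          (brace scale (ident brc) (susp_list gs') xs
           - scale (msign ((fst (hd gs') + 1) * (- 1))) (nested scale (- 1) (ident brc) gs' xs))"
    have "op_top scale (- 1) (ident brc) [(p, ident g), (q, ident h)] xs = ?t id + ?t (rot 1)"
      unfolding op_top_def using permutes_two id_neq_rot[of 0] by (simp add: numeral_2_eq_2)
    also have "?t id = ident ?A xs"
      unfolding permute_list_id Let_def
      by (simp add: chi_id chi_id[unfolded id_def] partial_degs_def degs_def susp_list_def b[OF g h] n[OF g(1) h]
          scale_msign ident_def) (simp add: sg_def)
    also have "?t (rot 1) = ident ?B xs"
      unfolding permute_list_rot_1 Let_def list.map fst_conv chi_rot_1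
      by (simp add: partial_degs_def degs_def susp_list_def b[OF h g] n[OF h(1) g]
          scale_msign scale_scale[symmetric] scale_minus_left ident_def
          del: scale_scale) (simp add: sg_def)
    finally show ?thesis .
  qed
  have E: "ident (?A + ?B) = ident (sg (p * q) (lbr (- p) (- q) g h))"
  proof (rule ident_eqI)
    fix ws :: "'g list" assume "ws \<noteq> []"
    then obtain x xs where ws: "ws = x # xs"
      by (cases ws) auto
    \<comment> \<open>The first argument goes to \<open>g\<close> or to \<open>h\<close>; in the
      second case skew symmetry moves \<open>h\<close> to the front.\<close>
    have e: "(g \<sqinter> h) ws = hw g h ws + sg (p + p * q + p + 1) (hw h g ws)"
    proof -
      have "g \<sqinter> contr x h = - sg ((- p) * (- q - 1)) (contr x h \<sqinter> g)"
        by (rule wed_skew[OF g(1) cochain_contr[OF h(1)]])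
      then show ?thesis
        by (cases "even p"; cases "even q") (simp_all add: ws wed_Cons[OF g(1)] hw_def sg_def)
    qed
    show "ident (?A + ?B) (map (Pair 1) ws) = sg (p * q) (lbr (- p) (- q) g h) ws"
      unfolding ident_ones using \<open>ws \<noteq> []\<close> e
      by (cases "even p"; cases "even q") (simp_all add: lbr_def deriv_def sg_def)
  qed (simp_all add: ident_not_ones)
  have "op_mixed scale lam (- 1) (ident brc) [(p, ident g), (q, ident h)] xs
      = op_top scale (- 1) (ident brc) [(p, ident g), (q, ident h)] xs"
    by (rule op_mixed_top[OF s ident_list]) simp_all
  then show "op_mixed scale lam (- 1) (ident brc) [(p, ident g), (q, ident h)] xs
      = ident (sg (p * q) (lbr (- p) (- q) g h)) xs"
    unfolding T E[symmetric] ident_add plus_fun_apply .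
qed

lemma op_mixed_brc_many:
  "ident_list gs \<Longrightarrow> 3 \<le> length gs \<Longrightarrow> op_mixed scale lam p (ident brc) gs = 0"
  using op_mixed_large[OF cochain_supported[OF cochain_brc], of gs]
  by (cases gs) (auto simp: fun_eq_iff)

end

section \<open>The differentials of the cochain complexes\<close>

lemma drop_nth_simps [simp]:
  "drop_nth 0 (x # xs) = xs" "drop_nth (Suc i) (x # xs) = x # drop_nth i xs"
  by (simp_all add: drop_nth_def)

lemma sum_sg: "(\<Sum>x\<in>A. sg e (F x)) = sg e (\<Sum>x\<in>A. F x)"
  by (simp add: sg_def sum_negf)

lemma sg_Suc: "sg (int (Suc i)) v = - sg (int i) v"
  by (simp add: sg_def)

text \<open>Picking the entry at position \<open>i\<close> is a splitting with a singleton left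
  block, and moving it to the front passes \<open>i\<close> entries.\<close>

lemma sum_drop_nth:
  "(\<Sum>i<length ws. sg (int i) (G (ws ! i) (drop_nth i ws)))
    = usum (\<lambda>A B. if length A = 1 then G (hd A) B else 0) ws"
proof (induction ws arbitrary: G)
  case (Cons x ws)
  have "(\<Sum>i<length (x # ws). sg (int i) (G ((x # ws) ! i) (drop_nth i (x # ws))))
      = G x ws + (\<Sum>i<length ws. - sg (int i) (G (ws ! i) (x # drop_nth i ws)))"
    unfolding length_Cons sum.lessThan_Suc_shift sg_Suc by simp
  also have "(\<Sum>i<length ws. - sg (int i) (G (ws ! i) (x # drop_nth i ws)))
      = - usum (\<lambda>A B. if length A = 1 then G (hd A) (x # B) else 0) ws"
    using Cons.IH[of "\<lambda>u B. G u (x # B)"] by (simp add: sum_negf)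
  also have "G x ws = usum (\<lambda>A B. if length (x # A) = 1 then G (hd (x # A)) B else 0) ws"
    using usum_left_0[of "\<lambda>A B. G x B" ws] by (simp cong: if_cong)
  also have "- usum (\<lambda>A B. if length A = 1 then G (hd A) (x # B) else 0) ws
      = usum (\<lambda>A B. sg (int (length A)) (if length A = 1 then G (hd A) (x # B) else 0)) ws"
    unfolding usum_uminus[symmetric] by (rule usum_cong) (simp add: sg_def)
  finally show ?case
    by simp
qed simp

text \<open>Moving the entries at \<open>i < j\<close> to the front passes \<open>i\<close> and
  \<open>j - 1\<close> entries, one fewer than \<open>i + j\<close> in all, whence the minus
  sign.\<close>

lemma sum_drop_nth_two:
  "(\<Sum>j<length ws. \<Sum>i<j. sg (int (i + j)) (G (ws ! i) (ws ! j) (drop_nth i (drop_nth j ws))))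
    = - usum (\<lambda>A B. if length A = 2 then G (A ! 0) (A ! 1) B else 0) ws"
proof (induction ws arbitrary: G)
  case (Cons x ws)
  let ?t = "\<lambda>i j. sg (int (i + j)) (G ((x # ws) ! i) ((x # ws) ! j) (drop_nth i (drop_nth j (x # ws))))"
  have "(\<Sum>j<length (x # ws). \<Sum>i<j. ?t i j) = (\<Sum>j<length ws. ?t 0 (Suc j) + (\<Sum>i<j. ?t (Suc i) (Suc j)))"
    unfolding length_Cons by (simp only: sum.lessThan_Suc_shift lessThan_0 sum.empty add_0_left)
  also have "\<dots> = - (\<Sum>j<length ws. sg (int j) (G x (ws ! j) (drop_nth j ws)))
      + (\<Sum>j<length ws. \<Sum>i<j. sg (int (i + j)) (G (ws ! i) (ws ! j) (x # drop_nth i (drop_nth j ws))))"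
    unfolding sum.distrib sum_negf[symmetric]
    by (intro arg_cong2[where f = "(+)"] sum.cong refl) (simp_all add: sg_def)
  also have "(\<Sum>j<length ws. sg (int j) (G x (ws ! j) (drop_nth j ws)))
      = usum (\<lambda>A B. if length A = 1 then G x (hd A) B else 0) ws"
    by (rule sum_drop_nth)
  also have "\<dots> = usum (\<lambda>A B. if length (x # A) = 2 then G ((x # A) ! 0) ((x # A) ! 1) B else 0) ws"
    by (rule usum_cong) (auto simp: length_Suc_conv)
  also have "(\<Sum>j<length ws. \<Sum>i<j. sg (int (i + j)) (G (ws ! i) (ws ! j) (x # drop_nth i (drop_nth j ws))))
      = - usum (\<lambda>A B. if length A = 2 then G (A ! 0) (A ! 1) (x # B) else 0) ws"
    by (rule Cons.IH)
  also have "usum (\<lambda>A B. if length A = 2 then G (A ! 0) (A ! 1) (x # B) else 0) ws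
      = usum (\<lambda>A B. sg (int (length A)) (if length A = 2 then G (A ! 0) (A ! 1) (x # B) else 0)) ws"
    by (rule usum_cong) (simp add: sg_def)
  finally show ?case
    by simp
qed simp

section \<open>Repeated arguments and subsets of given cardinality\<close>

lemma permute_list_replicate:
  assumes "p permutes {..<n}"
  shows "permute_list p (replicate n y) = replicate n y"
proof (rule nth_equalityI)
  fix i assume "i < length (permute_list p (replicate n y))"
  then show "permute_list p (replicate n y) ! i = replicate n y ! i"
    using permutes_in_image[OF assms, of i] by (simp add: permute_list_nth assms)
qed simp

lemma degs_replicate: "degs (replicate n (d, y)) = int n * d"
  by (induction n) (simp_all add: degs_def algebra_simps)

text \<open>This triangular number cancels, modulo 2, the exponent \<open>i * (i - 1) div 2\<close>
  in the twisting series.\<close>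

lemma partial_degs_replicate: "partial_degs (replicate i (- 1, y)) = - int (i * (i - 1) div 2)"
proof -
  have "partial_degs (replicate i (- 1, y)) = (\<Sum>k = 1..i - 1. - int k)"
    unfolding partial_degs_def by (rule sum.cong) (auto simp: degs_replicate min_def)
  also have "\<dots> = - int (\<Sum>k = 1..i - 1. k)"
    by (simp add: sum_negf)
  also have "(\<Sum>k = 1..i - 1. k) = i * (i - 1) div 2"
    using gauss_sum_from_Suc_0[of "i - 1", where 'a = nat] by (cases i) (simp_all add: mult.commute)
  finally show ?thesis .
qed

definition subsets_of_card :: "nat \<Rightarrow> nat \<Rightarrow> nat set set" where
  "subsets_of_card n i = {I. I \<subseteq> {..<n} \<and> card I = i}"

lemma finite_subsets_of_card [simp]: "finite (subsets_of_card n i)"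
  by (simp add: subsets_of_card_def)

lemma subsets_of_card_0: "subsets_of_card n 0 = {{}}"
  by (auto simp: subsets_of_card_def finite_subset[OF _ finite_lessThan])

lemma subsets_of_card_Suc_Suc:
  "subsets_of_card (Suc n) (Suc i)
    = (\<lambda>J. insert 0 (Suc ` J)) ` subsets_of_card n i \<union> image Suc ` subsets_of_card n (Suc i)"
proof (intro equalityI subsetI)
  fix I assume "I \<in> subsets_of_card (Suc n) (Suc i)"
  then have I: "I \<subseteq> {..<Suc n}" "card I = Suc i" "finite I"
    by (auto simp: subsets_of_card_def intro: finite_subset)
  define J where "J = {j. Suc j \<in> I}"
  have J: "J \<subseteq> {..<n}" "Suc ` J = I - {0}"
    using I(1) by (auto simp: J_def image_iff) (metis not0_implies_Suc)
  have c: "card J = card (I - {0})"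
    unfolding J(2)[symmetric] by (simp add: card_image)
  show "I \<in> (\<lambda>J. insert 0 (Suc ` J)) ` subsets_of_card n i \<union> image Suc ` subsets_of_card n (Suc i)"
  proof (cases "0 \<in> I")
    case True
    then have "J \<in> subsets_of_card n i" "I = insert 0 (Suc ` J)"
      using I J c by (auto simp: subsets_of_card_def)
    then show ?thesis
      by blast
  next
    case False
    then have "J \<in> subsets_of_card n (Suc i)" "I = Suc ` J"
      using I J c by (auto simp: subsets_of_card_def)
    then show ?thesis
      by blast
  qed
next
  fix I assume "I \<in> (\<lambda>J. insert 0 (Suc ` J)) ` subsets_of_card n i \<union> image Suc ` subsets_of_card n (Suc i)"
  then show "I \<in> subsets_of_card (Suc n) (Suc i)"
    by (auto simp: subsets_of_card_def card_image card_insert_if dest: finite_subset[OF _ finite_lessThan])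
qed

context lie_alg
begin

lemma sum_const_scale: "finite A \<Longrightarrow> (\<Sum>x\<in>A. v) = scale (of_nat (card A)) v"
  by (induction A rule: finite_induct) (simp_all add: scale_left_distrib)

definition lin :: "('g \<Rightarrow> 'g) \<Rightarrow> bool" where
  "lin T \<longleftrightarrow> Vector_Spaces.linear scale scale T"

lemma lin_simps:
  assumes "lin T"
  shows "T (x + y) = T x + T y" "T (scale c x) = scale c (T x)" "T 0 = 0" "T (- x) = - T x"
    "T (x - y) = T x - T y"
proof -
  have a: "T (x + y) = T x + T y" and s: "T (scale c x) = scale c (T x)" for x y c
    using assms by (auto simp: lin_def linear_scale_iff)
  show "T (x + y) = T x + T y" "T (scale c x) = scale c (T x)"
    by (fact a s)+
  show z: "T 0 = 0"
    using s[of 0 0] by simp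
  have m: "T (- x) = - T x" for x
    using a[of x "- x"] z by (simp add: eq_neg_iff_add_eq_0 add.commute)
  show "T (- x) = - T x"
    by (fact m)
  show "T (x - y) = T x - T y"
    using a[of x "- y"] m[of y] by simp
qed

lemma lin_sum: "lin T \<Longrightarrow> T (\<Sum>x\<in>A. h x) = (\<Sum>x\<in>A. T (h x))"
  by (induction A rule: infinite_finite_induct) (simp_all add: lin_simps)

definition opc :: "('g \<Rightarrow> 'g) \<Rightarrow> 'g list \<Rightarrow> 'g" where
  "opc T ws = T (idc ws)"

lemma cochain_comp_lin:
  assumes T: "lin T" and f: "cochain a f"
  shows "cochain a (\<lambda>ws. T (f ws))"
proof (rule cochainI)
  show "supported a (\<lambda>ws. T (f ws))"
    using cochain_supported[OF f] lin_simps(3)[OF T] unfolding supported_def by metis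
qed (simp_all add: cochain_add[OF f] cochain_scale[OF f] cochain_alt[OF f] lin_simps[OF T])

lemma cochain_opc: "lin T \<Longrightarrow> cochain 1 (opc T)"
  unfolding opc_def[abs_def] by (rule cochain_comp_lin[OF _ cochain_idc])

lemma opc_simps: "lin T \<Longrightarrow> opc T [] = 0" "opc T [x] = T x" "lin T \<Longrightarrow> opc T (x # y # ws) = 0"
  by (simp_all add: opc_def lin_simps)

lemma tilde_operator_opc: "lin T \<Longrightarrow> tilde_operator T = ident (opc T)"
  using tilde_operator_ident[of T] by (simp add: lin_simps opc_def[abs_def])

lemma ins_opc:
  assumes "lin T"
  shows "ins H (opc T) = (\<lambda>ws. T (H ws))"
proof
  fix ws
  have "(\<lambda>A B. opc T (H A # B)) = (\<lambda>A B. if B = [] then T (H A) else 0)"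
    using lin_simps(3)[OF assms] by (auto simp: opc_def idc_Cons fun_eq_iff)
  then show "ins H (opc T) ws = T (H ws)"
    by (simp add: ins_def usum_all_left)
qed

lemma opc_wed: "lin T \<Longrightarrow> (opc T \<sqinter> f) ws = usum (\<lambda>A B. if length A = 1 then br (T (hd A)) (f B) else 0) ws"
  unfolding wedge_def
  by (rule usum_cong)
    (auto simp: opc_def idc_def lin_simps biadd_zero[OF biadd_br] length_Suc_conv split: list.splits)

lemma idc_wed: "(idc \<sqinter> f) ws = usum (\<lambda>A B. if length A = 1 then br (hd A) (f B) else 0) ws"
  unfolding wedge_def
  by (rule usum_cong)
    (auto simp: idc_def biadd_zero[OF biadd_br] length_Suc_conv split: list.splits)

lemma usum_lin: "lin T \<Longrightarrow> usum (\<lambda>A B. T (F A B)) ws = T (usum F ws)"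
  by (rule usum_hom) (simp_all add: lin_simps)

text \<open>With positions counted from 0, both sums carry the sign \<open>- sg (int n)\<close>
  relative to \<open>sum_drop_nth\<close> and \<open>sum_drop_nth_two\<close>. The latter has a
  minus sign of its own, so the action and bracket terms end up with opposite signs.\<close>

lemma ce_diff_eq:
  assumes "cochain (int n) f" "length ws = n + 1" "supported 2 b2" "\<And>x y. b2 [x, y] = b x y"
  shows "ce_diff scale b act n f ws
    = - sg (int n) (usum (\<lambda>A B. if length A = 1 then act (hd A) (f B) else 0) ws)
      + sg (int n) (ins b2 f ws)"
proof -
  have pow: "scale ((- 1) ^ m) v = sg (int m) v" for m v
    by (simp add: sg_def uminus_power_if)
  have "(\<Sum>i<n + 1. scale ((- 1) ^ (n + Suc i)) (act (ws ! i) (f (drop_nth i ws))))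
      = - sg (int n) (\<Sum>i<length ws. sg (int i) (act (ws ! i) (f (drop_nth i ws))))"
  proof -
    have "sg (int (n + Suc i)) v = - sg (int n) (sg (int i) v)" for i and v :: 'g
      by (simp add: sg_def)
    then show ?thesis
      by (simp only: pow assms(2) sum_negf sum_sg)
  qed
  moreover have "(\<Sum>j<n + 1. \<Sum>i<j. scale ((- 1) ^ (Suc i + Suc j + n + 1))
        (f (b (ws ! i) (ws ! j) # drop_nth i (drop_nth j ws))))
      = - sg (int n) (\<Sum>j<length ws. \<Sum>i<j. sg (int (i + j)) (f (b (ws ! i) (ws ! j) # drop_nth i (drop_nth j ws))))"
  proof -
    have "sg (int (Suc i + Suc j + n + 1)) v = - sg (int n) (sg (int (i + j)) v)" for i j and v :: 'g
      by (simp add: sg_def)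
    then show ?thesis
      by (simp only: pow assms(2) sum_negf sum_sg)
  qed
  moreover have "usum (\<lambda>A B. if length A = 2 then f (b (A ! 0) (A ! 1) # B) else 0) ws = ins b2 f ws"
    unfolding ins_def
  proof (rule usum_cong)
    fix A B :: "'g list"
    show "(if length A = 2 then f (b (A ! 0) (A ! 1) # B) else 0) = f (b2 A # B)"
    proof (cases "length A = 2")
      case True
      then obtain x y where "A = [x, y]"
        by (auto simp: length_Suc_conv numeral_2_eq_2)
      then show ?thesis
        by (simp add: assms(4))
    next
      case False
      then have "b2 A = 0"
        using supportedD[OF assms(3), of A] by fastforce
      then show ?thesis
        using False cochain_Cons[OF assms(1)] by simp
    qed
  qed
  ultimately show ?thesis
    using assms(2) sum_drop_nth[of "\<lambda>u B. act u (f B)" ws]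
      sum_drop_nth_two[of "\<lambda>u v B. f (b u v # B)" ws]
    by (simp add: ce_diff_def sg_minus)
qed

lemma lie_diff_eq:
  assumes f: "cochain (int n) f"
  shows "lie_diff scale br n f = sg (int n) (ins brc f) + (- sg (int n) (idc \<sqinter> f))"
proof
  fix ws
  show "lie_diff scale br n f ws = (sg (int n) (ins brc f) + (- sg (int n) (idc \<sqinter> f))) ws"
  proof (cases "length ws = n + 1")
    case True
    show ?thesis
      unfolding lie_diff_def
      by (subst ce_diff_eq[OF f True cochain_supported[OF cochain_brc]]) (simp_all add: idc_wed)
  next
    case False
    then have "ins brc f ws = 0" "(idc \<sqinter> f) ws = 0"
      using supportedD[OF cochain_supported[OF cochain_ins_brc[OF f]], of ws]
        supportedD[OF cochain_supported[OF cochain_wed[OF cochain_idc f]], of ws] by fastforce+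
    then show ?thesis
      using False by (simp add: lie_diff_def ce_diff_def)
  qed
qed

text \<open>As a 2-cochain the new bracket is \<open>lam\<close> times \<open>brc\<close> plus
  \<open>opc T \<sqinter> idc\<close>; inserting the second summand is, up to sign, the action of
  \<open>opc T\<close> on \<open>f\<close>. The two parts of the new module structure give
  \<open>opc T \<sqinter> f\<close> and, up to sign, the action of \<open>f\<close> on
  \<open>opc T\<close>. These are the three terms of \<open>lbr\<close>.\<close>

lemma rblo_diff_eq:
  assumes T: "lin T" and f: "cochain (int n) f"
  shows "rblo_diff scale lam br T n f
    = sg (int n) (fun_scale scale lam (ins brc f) + (- lbr 1 (int n) (opc T) f))"
proof
  fix ws
  let ?b = "\<lambda>x y. br x (T y) + br (T x) y + scale lam (br x y)"
  let ?b2 = "fun_scale scale lam brc + (opc T \<sqinter> idc)"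
  note o = cochain_opc[OF T]
  have b2: "cochain 2 ?b2"
    by (intro cochain_plus cochain_fun_scale cochain_brc) (use cochain_wed_idc[OF o] in simp)
  have b2_eq: "?b2 [x, y] = ?b x y" for x y
    using br_skew[of "T y" x] by (simp add: wedge_def opc_simps(1,3)[OF T] opc_simps(2) lin_simps[OF T] biadd_zero[OF biadd_br])
      (simp add: sg_def)
  show "rblo_diff scale lam br T n f ws
    = (sg (int n) (fun_scale scale lam (ins brc f) + (- lbr 1 (int n) (opc T) f))) ws"
  proof (cases "length ws = n + 1")
    case True
    have "usum (\<lambda>A B. if length A = 1 then br (T (hd A)) (f B) - T (br (hd A) (f B)) else 0) ws
        = usum (\<lambda>A B. (if length A = 1 then br (T (hd A)) (f B) else 0)
            + - T (if length A = 1 then br (hd A) (f B) else 0)) ws"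
      by (rule usum_cong) (simp add: lin_simps[OF T])
    also have "\<dots> = (opc T \<sqinter> f) ws + - T ((idc \<sqinter> f) ws)"
      unfolding usum_add usum_uminus usum_lin[OF T] opc_wed[OF T] idc_wed ..
    finally have 1: "rblo_diff scale lam br T n f ws
        = - sg (int n) ((opc T \<sqinter> f) ws + - T ((idc \<sqinter> f) ws)) + sg (int n) (ins ?b2 f ws)"
      unfolding rblo_diff_def
      by (subst ce_diff_eq[OF f True cochain_supported[OF b2] b2_eq]) simp
    have "f \<sqinter> idc = - sg (int n * 1) (idc \<sqinter> f)"
      by (rule wed_skew[OF f cochain_idc])
    then have 2: "ins (f \<sqinter> idc) (opc T) ws = - sg (int n) (T ((idc \<sqinter> f) ws))"
      by (simp add: ins_opc[OF T] lin_simps[OF T] sg_def)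
    show ?thesis
      unfolding 1
      by (cases "even n") (simp_all add: lbr_def 2 deriv_def ins_add_left[OF f] ins_scale_left[OF f]
          sg_def algebra_simps)
  next
    case False
    have "lbr 1 (int n) (opc T) f ws = 0"
      using supportedD[OF cochain_supported[OF cochain_lbr[OF o f]], of ws] False by fastforce
    moreover have "ins brc f ws = 0"
      using supportedD[OF cochain_supported[OF cochain_ins_brc[OF f]], of ws] False by fastforce
    ultimately show ?thesis
      using False by (simp add: rblo_diff_def ce_diff_def)
  qed
qed

section \<open>Applying \<open>T\<close> in some of the arguments\<close>

lemma cochain_move:
  assumes "cochain a f"
  shows "f (us @ x # ws) = sg (int (length us)) (f (x # us @ ws))"
  using assms
proof (induction us arbitrary: f a)
  case (Cons u us)
  have "f (u # us @ x # ws) = sg (int (length us)) (f (u # x # us @ ws))"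
    using Cons.IH[OF cochain_contr[OF Cons.prems], of u] by (simp add: contr_apply)
  also have "f (u # x # us @ ws) = - f (x # u # us @ ws)"
    using cochain_swap[OF Cons.prems, of "[]" u x "us @ ws"] by simp
  finally show ?case
    by (simp add: sg_def)
qed simp

lemma opsub_0: "opsub 0 T f = f"
  unfolding opsub_def fun_eq_iff using usum_left_0[of "\<lambda>A B. f (map T A @ B)"] by simp

lemma opsub_Suc_Nil [simp]: "opsub (Suc i) T f [] = 0"
  by (simp add: opsub_def)

text \<open>No sign appears: the sign of the shuffle that moves \<open>x\<close> past the left block
  is undone by moving \<open>x\<close> back to the front inside \<open>f\<close>.\<close>

lemma opsub_Cons:
  assumes "cochain a f"
  shows "opsub (Suc i) T f (x # ws) = opsub i T (contr (T x) f) ws + opsub (Suc i) T (contr x f) ws"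
proof -
  have "usum (\<lambda>A B. sg (int (length A)) (if length A = Suc i then f (map T A @ x # B) else 0)) ws
      = usum (\<lambda>A B. if length A = Suc i then f (x # map T A @ B) else 0) ws"
    by (rule usum_cong) (simp add: cochain_move[OF assms, of "map T _"] sg_sg, simp add: sg_def)
  then show ?thesis
    by (simp add: opsub_def contr_apply cong: if_cong)
qed

lemma opsub_add: "opsub i T (f + g) = opsub i T f + opsub i T g"
proof
  fix ws
  show "opsub i T (f + g) ws = (opsub i T f + opsub i T g) ws"
    unfolding opsub_def plus_fun_apply usum_add[symmetric] by (rule usum_cong) simp
qed

lemma opsub_scale: "opsub i T (fun_scale scale c f) = fun_scale scale c (opsub i T f)"
proof
  fix ws
  show "opsub i T (fun_scale scale c f) ws = (fun_scale scale c (opsub i T f)) ws"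
    unfolding opsub_def fun_scale_apply usum_scale[symmetric] by (rule usum_cong) simp
qed

lemma opsub_zero: "opsub i T 0 = 0"
proof
  fix ws
  have "opsub i T 0 ws = usum (\<lambda>A B. 0) ws"
    unfolding opsub_def by (rule usum_cong) simp
  then show "opsub i T 0 ws = 0 ws"
    by simp
qed

lemma supported_opsub:
  assumes "supported a f"
  shows "supported a (opsub i T f)"
proof -
  have "opsub i T f ws = usum (\<lambda>A B. 0) ws" if "int (length ws) \<noteq> a" for ws
    unfolding opsub_def
  proof (rule usum_cong)
    fix A B :: "'g list" assume "length A + length B = length ws"
    then show "(if length A = i then f (map T A @ B) else 0) = 0"
      using supportedD[OF assms, of "map T A @ B"] that by (metis length_append length_map)
  qed
  then show ?thesis
    by (auto simp: supported_def)
qed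

lemma cochain_opsub:
  assumes T: "lin T" and "cochain a f"
  shows "cochain a (opsub i T f)"
proof (rule cochainI)
  show "supported a (opsub i T f)"
    by (rule supported_opsub[OF cochain_supported[OF assms(2)]])
  show "opsub i T f (us @ (x + y) # ws) = opsub i T f (us @ x # ws) + opsub i T f (us @ y # ws)" for us x y ws
    using assms(2)
  proof (induction us arbitrary: f a i)
    case Nil
    then show ?case
      by (cases i) (simp_all add: opsub_0 cochain_Cons opsub_Cons[OF Nil] lin_simps[OF T]
          contr_cochain_add[OF Nil] opsub_add)
  next
    case (Cons u us)
    show ?case
      using Cons.IH[OF cochain_contr[OF Cons.prems]] cochain_add[OF Cons.prems, of "u # us"]
      by (cases i) (simp_all add: opsub_0 opsub_Cons[OF Cons.prems])
  qed
  show "opsub i T f (us @ scale c x # ws) = scale c (opsub i T f (us @ x # ws))" for us c x ws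
    using assms(2)
  proof (induction us arbitrary: f a i)
    case Nil
    then show ?case
      by (cases i) (simp_all add: opsub_0 cochain_Cons opsub_Cons[OF Nil] lin_simps[OF T]
          contr_cochain_scale[OF Nil] opsub_scale scale_right_distrib)
  next
    case (Cons u us)
    show ?case
      using Cons.IH[OF cochain_contr[OF Cons.prems]] cochain_scale[OF Cons.prems, of "u # us"]
      by (cases i) (simp_all add: opsub_0 opsub_Cons[OF Cons.prems] scale_right_distrib)
  qed
  show "opsub i T f (us @ x # x # ws) = 0" for us x ws
    using assms(2)
  proof (induction us arbitrary: f a i)
    case Nil
    \<comment> \<open>With two equal arguments \<open>x\<close>, the terms with \<open>T\<close> on
      exactly one of them cancel by this anticommutation; the others contain a double
      contraction.\<close>
    have sw: "contr x (contr (T x) f) = - contr (T x) (contr x f)"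
      using cochain_swap[OF Nil, of "[]" "T x" x] by (simp add: fun_eq_iff contr_apply)
    have um: "opsub i T (- h) = - opsub i T h" for i h
      using opsub_scale[of i T "- 1" h] by (simp add: fun_scale_def fun_eq_iff fun_Compl_def)
    show ?case
    proof (cases i)
      case 0
      then show ?thesis
        using cochain_Cons[OF Nil] by (simp add: opsub_0)
    next
      case (Suc j)
      show ?thesis
        using cochain_swap[OF Nil, of "[]" "T x" x ws]
        unfolding Suc append_Nil opsub_Cons[OF Nil] opsub_Cons[OF cochain_contr[OF Nil]]
        by (cases j) (simp_all add: opsub_0 opsub_Cons[OF cochain_contr[OF Nil]] contr_twice[OF Nil]
            sw um opsub_zero contr_apply)
    qed
  next
    case (Cons u us)
    show ?case
      using Cons.IH[OF cochain_contr[OF Cons.prems]] cochain_alt[OF Cons.prems, of "u # us"]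
      by (cases i) (simp_all add: opsub_0 opsub_Cons[OF Cons.prems])
  qed
qed

text \<open>All entries stay in place, so the recursion \<open>opsub_Cons\<close> is the unsigned
  one, which splits the subsets by whether they contain 0.\<close>

lemma opsub_eq_sum:
  assumes "cochain a f"
  shows "opsub i T f ws = (\<Sum>I\<in>subsets_of_card (length ws) i.
    f (map (\<lambda>j. if j \<in> I then T (ws ! j) else ws ! j) [0..<length ws]))"
  using assms
proof (induction ws arbitrary: f a i)
  case Nil
  have "subsets_of_card 0 (Suc i) = {}" for i
    by (auto simp: subsets_of_card_def)
  then show ?case
    by (cases i) (simp_all add: opsub_0 subsets_of_card_0)
next
  case (Cons x ws)
  let ?n = "length ws"
  let ?m = "\<lambda>I. map (\<lambda>j. if j \<in> I then T ((x # ws) ! j) else (x # ws) ! j) [0..<length (x # ws)]"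
  show ?case
  proof (cases i)
    case 0
    have "map (\<lambda>j. (x # ws) ! j) [0..<length (x # ws)] = x # ws"
      by (rule map_nth)
    then show ?thesis
      unfolding 0 subsets_of_card_0 opsub_0 by simp
  next
    case (Suc k)
    have m: "?m I = (if 0 \<in> I then T x else x) # map (\<lambda>j. if Suc j \<in> I then T (ws ! j) else ws ! j) [0..<?n]" for I
      by (simp add: upt_conv_Cons map_Suc_upt[symmetric] comp_def del: upt_Suc map_Suc_upt)
    have disj: "(\<lambda>J. insert 0 (Suc ` J)) ` subsets_of_card ?n k \<inter> image Suc ` subsets_of_card ?n (Suc k) = {}"
      by auto
    have inj: "inj_on (\<lambda>J. insert 0 (Suc ` J)) X" "inj_on (image Suc) X" for X
    proof -
      have "J = J'" if "insert 0 (Suc ` J) = insert 0 (Suc ` J')" for J J'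
      proof -
        have "Suc ` J = Suc ` J'"
          using that by (metis Diff_insert_absorb Zero_not_Suc imageE)
        then show ?thesis
          by (simp add: inj_image_eq_iff)
      qed
      then show "inj_on (\<lambda>J. insert 0 (Suc ` J)) X"
        by (intro inj_onI)
      show "inj_on (image Suc) X"
        by (intro inj_onI) (simp add: inj_image_eq_iff)
    qed
    have "(\<Sum>I\<in>subsets_of_card (Suc ?n) (Suc k). f (?m I))
        = (\<Sum>J\<in>subsets_of_card ?n k. f (?m (insert 0 (Suc ` J))))
          + (\<Sum>J\<in>subsets_of_card ?n (Suc k). f (?m (Suc ` J)))"
      unfolding subsets_of_card_Suc_Suc
      by (subst sum.union_disjoint[OF _ _ disj])
        (simp_all only: finite_subsets_of_card finite_imageI sum.reindex_cong[OF inj(1) refl refl]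
          sum.reindex_cong[OF inj(2) refl refl])
    also have "\<dots> = opsub k T (contr (T x) f) ws + opsub (Suc k) T (contr x f) ws"
      unfolding m Cons.IH[OF cochain_contr[OF Cons.prems]] contr_apply by (simp add: image_iff)
    finally show ?thesis
      unfolding Suc opsub_Cons[OF Cons.prems] by simp
  qed
qed

lemma opsub_full: "length ws = n \<Longrightarrow> opsub n T f ws = f (map T ws)"
  using usum_right_0[of ws "\<lambda>A B. f (map T A @ B)"] by (simp add: opsub_def)

text \<open>The sum over proper subsets is grouped by cardinality, on which alone the power of
  \<open>lam\<close> depends.\<close>

lemma rb_Phi_eq:
  assumes T: "lin T" and f: "cochain (int n) f" and n: "n > 0"
  shows "rb_Phi scale lam T n f
    = (\<lambda>ws. opsub n T f ws - (\<Sum>i<n. scale (lam ^ (n - i - 1)) (T (opsub i T f ws))))"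
proof
  fix ws
  show "rb_Phi scale lam T n f ws
    = opsub n T f ws - (\<Sum>i<n. scale (lam ^ (n - i - 1)) (T (opsub i T f ws)))"
  proof (cases "length ws = n")
    case True
    let ?m = "\<lambda>I. map (\<lambda>i. if i \<in> I then T (ws ! i) else ws ! i) [0..<n]"
    have S: "{I \<in> {I. I \<subset> {..<n}}. card I = i} = subsets_of_card n i" if "i < n" for i
      using that by (auto simp: subsets_of_card_def)
    have fin: "finite {I. I \<subset> {..<n}}"
      by (rule finite_subset[of _ "Pow {..<n}"]) auto
    have "(\<Sum>I | I \<subset> {..<n}. scale (lam ^ (n - card I - 1)) (T (f (?m I))))
        = (\<Sum>i<n. \<Sum>I\<in>{I \<in> {I. I \<subset> {..<n}}. card I = i}. scale (lam ^ (n - card I - 1)) (T (f (?m I))))"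
      by (rule sum.group[symmetric, OF fin finite_lessThan])
        (use psubset_card_mono[OF finite_lessThan[of n]] in auto)
    also have "\<dots> = (\<Sum>i<n. scale (lam ^ (n - i - 1)) (T (opsub i T f ws)))"
    proof (rule sum.cong[OF refl])
      fix i assume "i \<in> {..<n}"
      then have i: "i < n"
        by simp
      have "(\<Sum>I\<in>subsets_of_card n i. scale (lam ^ (n - card I - 1)) (T (f (?m I))))
          = (\<Sum>I\<in>subsets_of_card n i. scale (lam ^ (n - i - 1)) (T (f (?m I))))"
        by (rule sum.cong) (simp_all add: subsets_of_card_def)
      then show "(\<Sum>I\<in>{I \<in> {I. I \<subset> {..<n}}. card I = i}. scale (lam ^ (n - card I - 1)) (T (f (?m I))))
          = scale (lam ^ (n - i - 1)) (T (opsub i T f ws))"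
        unfolding S[OF i] opsub_eq_sum[OF f] True by (simp add: lin_sum[OF T] scale_sum_right)
    qed
    finally show ?thesis
      using n True opsub_full[OF True, of T f] by (simp add: rb_Phi_def)
  next
    case False
    then have "opsub i T f ws = 0" for i
      using supportedD[OF supported_opsub[OF cochain_supported[OF f]], of i T ws] by fastforce
    then show ?thesis
      using False by (simp add: rb_Phi_def lin_simps[OF T])
  qed
qed

text \<open>One copy of \<open>T\<close> is applied outermost and the other \<open>i\<close> are
  inserted into \<open>f\<close>. Hence \<open>Suc i\<close> copies produce the summands of \<Phi>
  with \<open>card I = i\<close>.\<close>

lemma nested_operators:
  assumes T: "lin T" and f: "cochain a f" "f [] = 0" "p + a = 1"
  shows "nested scale p (ident f) (replicate (Suc i) (- 1, tilde_operator T))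
    = ident (\<lambda>ws. T (opsub i T f ws))"
proof -
  have s: "susp_list (replicate i (- 1, tilde_operator T)) = replicate i (0, tilde_operator T)"
    by (simp add: susp_list_def)
  have n: "opsub i T f [] = 0"
    using f(2) by (cases i) (simp_all add: opsub_0)
  have "nested scale p (ident f) (replicate (Suc i) (- 1, tilde_operator T))
      = brace scale (ident (opc T)) [(p, ident (opsub i T f))]"
    unfolding nested_def replicate_Suc list.sel s brace_operator[where T = T, OF f(1) lin_simps(3)[OF T]]
    by (simp add: degs_replicate tilde_operator_opc[OF T])
  then show ?thesis
    using brace_one[OF cochain_opc[OF T] supported_opsub[OF cochain_supported[OF f(1)]] n f(3)]
    by (simp add: ins_opc[OF T])
qed

lemma ident_list_operators: "lin T \<Longrightarrow> ident_list (replicate i (d, tilde_operator T))"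
  using cochain_opc tilde_operator_opc by (auto simp: ident_list_def)

text \<open>
  The contribution of \<open>i\<close> copies of \<open>T\<close> to the twisted differential of \<open>f\<close>; the subtracted terms are those of
  \<open>\<Phi>\<close> indexed by subsets of cardinality \<open>i - 1\<close>.
\<close>

definition phi_part :: "'k \<Rightarrow> ('g \<Rightarrow> 'g) \<Rightarrow> nat \<Rightarrow> ('g list \<Rightarrow> 'g) \<Rightarrow> nat \<Rightarrow> 'g list \<Rightarrow> 'g" where
  "phi_part lam T n f i ws =
    (if i = n then opsub n T f ws - T (opsub (n - 1) T f ws)
     else if i < n then - scale (lam ^ (n - i)) (T (opsub (i - 1) T f ws)) else 0)"

text \<open>Subsets of cardinality \<open>i - 1\<close> belong to the part with index
  \<open>i\<close>, where the exponent of \<open>lam\<close> is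
  \<open>n - (i - 1) - 1 = n - i\<close>. The last part also contains the term with \<open>T\<close>
  in every argument.\<close>

lemma rb_Phi_parts:
  assumes T: "lin T" and f: "cochain (int n) f" and n: "n > 0"
  shows "rb_Phi scale lam T n f = (\<lambda>ws. \<Sum>i = 1..n. phi_part lam T n f i ws)"
proof
  fix ws
  obtain m where m: "n = Suc m"
    using n by (cases n) auto
  have "(\<Sum>i = 1..n. phi_part lam T n f i ws) = (\<Sum>i<Suc m. phi_part lam T n f (Suc i) ws)"
    unfolding m by (rule sum.reindex_bij_witness[of _ Suc "\<lambda>i. i - 1"]) auto
  also have "\<dots> = (\<Sum>i<m. - scale (lam ^ (m - i)) (T (opsub i T f ws)))
      + (opsub n T f ws - T (opsub m T f ws))"
    unfolding sum.lessThan_Suc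
    by (intro arg_cong2[where f = "(+)"] sum.cong refl) (simp_all add: phi_part_def m)
  finally show "rb_Phi scale lam T n f ws = (\<Sum>i = 1..n. phi_part lam T n f i ws)"
    unfolding rb_Phi_eq[OF assms] unfolding m by (simp add: sum_negf)
qed

text \<open>The \<open>i!\<close> permutations contribute equally by \<open>chi_odd\<close> and
  cancel the factorial. The factor \<open>sg (int i * int n)\<close> is the sign for moving
  \<open>f\<close> in front of the \<open>i\<close> copies of \<open>T\<close>; the sign attached to
  the nested brace is trivial, since the suspended operator has degree 0.\<close>

lemma op_mixed_operators:
  assumes T: "lin T" and f: "cochain (int n) f" and n: "n > 0" and i: "i > 0"
  shows "scale ((- 1) ^ (i + i * (i - 1) div 2) / fact i) (sg (int i * int n)
      (op_mixed scale lam (1 - int n) (ident f) (replicate i (- 1, tilde_operator T)) xs))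
    = ident (phi_part lam T n f i) xs"
proof -
  let ?gs = "replicate i (- 1 :: int, tilde_operator T)"
  let ?p = "1 - int n"
  have f0: "f [] = 0"
    using supportedD[OF cochain_supported[OF f], of "[]"] n by fastforce
  have ident_list: "ident_list ?gs" "?gs \<noteq> []"
    using ident_list_operators[OF T] i by auto
  have perm: "permute_list r ?gs = ?gs" "chi r (map fst ?gs) = (1 :: 'k)" if "r permutes {..<length ?gs}" for r
    using that by (auto intro: permute_list_replicate chi_odd)
  have card: "card {r. r permutes {..<length ?gs}} = fact i"
    using card_permutations[of "{..<i}" i] by simp
  have nest: "nested scale ?p (ident f) ?gs = ident (\<lambda>ws. T (opsub (i - 1) T f ws))"
    using nested_operators[OF T f f0, of ?p "i - 1"] i by simp
  have hd: "fst (hd ?gs) = - 1"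
    using i by (cases i) auto
  have br: "brace scale (ident f) (susp_list ?gs) = ident (opsub i T f)"
    using brace_operator[where T = T, OF f lin_simps(3)[OF T], of i] by (simp add: susp_list_def)
  have fact: "scale (e / fact i) (sg s (scale (of_nat (fact i)) v)) = scale e (sg s v)" for e s v
    by (simp add: sg_scale)
  have pow: "scale ((- 1) ^ m) v = sg (int m) v" for m v
    by (simp add: sg_def uminus_power_if)
  consider "n < i" | "n = i" | "i < n"
    by linarith
  then show ?thesis
  proof cases
    case 1
    then have "phi_part lam T n f i = (\<lambda>ws. 0)"
      by (auto simp: phi_part_def)
    then show ?thesis
      using 1 op_mixed_large[OF cochain_supported[OF f] ident_list] by (simp add: ident_def)
  next
    case 2
    let ?v = "ident (opsub n T f) xs - ident (\<lambda>ws. T (opsub (n - 1) T f ws)) xs"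
    have "op_mixed scale lam ?p (ident f) ?gs xs = op_top scale ?p (ident f) ?gs xs"
      by (rule op_mixed_top[OF cochain_supported[OF f] ident_list]) (simp add: 2)
    also have "\<dots> = (\<Sum>r | r permutes {..<length ?gs}.
        sg (int n * ?p + - int (n * (n - 1) div 2)) ?v)"
      unfolding op_top_def Let_def
    proof (rule sum.cong[OF refl])
      fix r assume "r \<in> {r. r permutes {..<length ?gs}}"
      then have r: "r permutes {..<length ?gs}"
        by simp
      show "scale (chi r (map fst ?gs) * msign (int (length ?gs) * ?p + partial_degs (permute_list r ?gs)))
          (brace scale (ident f) (susp_list (permute_list r ?gs)) xs
            - scale (msign ((fst (hd (permute_list r ?gs)) + 1) * ?p)) (nested scale ?p (ident f) (permute_list r ?gs) xs))
        = sg (int n * ?p + - int (n * (n - 1) div 2)) ?v"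
        unfolding perm[OF r] nest hd br partial_degs_replicate by (simp add: scale_msign 2)
    qed
    also have "\<dots> = scale (of_nat (fact i)) (sg (int n * ?p + - int (n * (n - 1) div 2)) ?v)"
      by (subst sum_const_scale) (simp_all add: finite_permutations card[simplified])
    finally have "scale ((- 1) ^ (i + i * (i - 1) div 2) / fact i) (sg (int i * int n)
        (op_mixed scale lam ?p (ident f) ?gs xs))
      = sg (int (n + n * (n - 1) div 2) + (int n * int n + (int n * ?p + - int (n * (n - 1) div 2)))) ?v"
      by (simp only: fact pow sg_sg 2)
    \<comment> \<open>The exponents add up to \<open>2 * n\<close>: the triangular numbers cancel,
      and \<open>n * n + n * (1 - n) = n\<close>.\<close>
    also have "\<dots> = ?v"
      by (simp add: sg_def)
    also have "\<dots> = ident (phi_part lam T n f i) xs"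
      by (simp add: ident_def phi_part_def 2)
    finally show ?thesis .
  next
    case 3
    let ?v = "scale (lam ^ (n - i)) (ident (\<lambda>ws. T (opsub (i - 1) T f ws)) xs)"
    have op: "op_lam scale lam n ?p (ident f) ?gs xs
        = scale (of_nat (fact i)) (sg (1 + int i * ?p + - int (i * (i - 1) div 2)) ?v)"
    proof -
      have "op_lam scale lam n ?p (ident f) ?gs xs
        = (\<Sum>r | r permutes {..<length ?gs}. sg (1 + int i * ?p + - int (i * (i - 1) div 2)) ?v)"
        unfolding op_lam_def Let_def
      proof (rule sum.cong[OF refl])
        fix r assume "r \<in> {r. r permutes {..<length ?gs}}"
        then have r: "r permutes {..<length ?gs}"
          by simp
        show "scale (chi r (map fst ?gs) * msign (1 + int (length ?gs) * ?p + partial_degs (permute_list r ?gs)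
              + ?p * (fst (hd (permute_list r ?gs)) + 1)) * lam ^ (n - length ?gs))
            (nested scale ?p (ident f) (permute_list r ?gs) xs)
          = sg (1 + int i * ?p + - int (i * (i - 1) div 2)) ?v"
          unfolding perm[OF r] nest hd partial_degs_replicate
          by (simp add: scale_msign scale_scale[symmetric] del: scale_scale)
      qed
      also have "\<dots> = scale (of_nat (fact i)) (sg (1 + int i * ?p + - int (i * (i - 1) div 2)) ?v)"
        by (subst sum_const_scale) (simp_all add: finite_permutations card[simplified])
      finally show ?thesis .
    qed
    \<comment> \<open>On lists shorter than \<open>n\<close>, which \<open>op_mixed\<close> cuts
      off, the uncut value is zero too.\<close>
    have short: "?v = 0" if "\<not> n \<le> length xs"
    proof -
      have "opsub (i - 1) T f (map snd xs) = 0"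
        using supportedD[OF supported_opsub[OF cochain_supported[OF f]], of "i - 1" T "map snd xs"] that
        by fastforce
      then have "ident (\<lambda>ws. T (opsub (i - 1) T f ws)) xs = 0"
        by (simp add: ident_def lin_simps(3)[OF T])
      then show ?thesis
        by simp
    qed
    have "op_mixed scale lam ?p (ident f) ?gs xs = op_lam scale lam n ?p (ident f) ?gs xs"
    proof (cases "n \<le> length xs")
      case False
      then have "op_lam scale lam n ?p (ident f) ?gs xs = 0"
        unfolding op short[OF False] by simp
      then show ?thesis
        using op_mixed_lam[OF cochain_supported[OF f] ident_list, of lam ?p xs] 3 by simp
    next
      case True
      then show ?thesis
        using op_mixed_lam[OF cochain_supported[OF f] ident_list, of lam ?p xs] 3 by simp
    qed
    then have "scale ((- 1) ^ (i + i * (i - 1) div 2) / fact i) (sg (int i * int n)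
        (op_mixed scale lam ?p (ident f) ?gs xs))
      = sg (int (i + i * (i - 1) div 2) + (int i * int n + (1 + int i * ?p + - int (i * (i - 1) div 2)))) ?v"
      by (simp only: op fact pow sg_sg)
    \<comment> \<open>The exponents add up to \<open>2 * i + 1\<close>.\<close>
    also have "\<dots> = - ?v"
      by (simp add: sg_def algebra_simps)
    also have "\<dots> = ident (phi_part lam T n f i) xs"
      using 3 by (simp add: ident_def phi_part_def)
    finally show ?thesis .
  qed
qed

end

section \<open>The dg Lie algebra\<close>

lemma Sum_any_two:
  fixes u v :: "'v::comm_monoid_add"
  assumes "\<And>n. F n = (if n = a then u else if n = b then v else 0)" "a \<noteq> b"
  shows "Sum_any F = u + v" "finite {n. F n \<noteq> 0}"
proof -
  have s: "{n. F n \<noteq> 0} \<subseteq> {a, b}"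
    using assms(1) by auto
  show "finite {n. F n \<noteq> 0}"
    by (rule finite_subset[OF s]) simp
  show "Sum_any F = u + v"
    using Sum_any.expand_superset[OF _ s] assms(2) by (simp add: assms(1))
qed

lemma homs_Cons: "homs V (z # zs) \<longleftrightarrow> snd z \<in> V (fst z) \<and> homs V zs"
  by (auto simp: homs_def)

lemma homs_Nil [simp]: "homs V []"
  by (simp add: homs_def)

lemma tilde_operator_0: "tilde_operator (\<lambda>_. 0) = 0"
  by (auto simp: fun_eq_iff tilde_operator_def split: list.splits)

lemma drop_nth_replicate: "k < n \<Longrightarrow> drop_nth k (replicate n z) = replicate (n - 1) z"
  by (simp add: drop_nth_def replicate_add[symmetric] min_def)

lemma drop_nth_append: "k < length xs \<Longrightarrow> drop_nth k (xs @ ys) = drop_nth k xs @ ys"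
  by (simp add: drop_nth_def)

context lie_alg
begin

lemma cochain_diff: "cochain a f \<Longrightarrow> cochain a g \<Longrightarrow> cochain a (f - g)"
  using cochain_plus[OF _ cochain_uminus, of a f g] by simp

lemma cochain_sum: "(\<And>i. i \<in> I \<Longrightarrow> cochain a (F i)) \<Longrightarrow> cochain a (\<Sum>i\<in>I. F i)"
  by (induction I rule: infinite_finite_induct) (simp_all add: cochain_zero_fun cochain_plus)

lemma rblo_elem: "G \<in> rblo_space scale deg0 p \<longleftrightarrow> (\<exists>g. cochain (- p) g \<and> g [] = 0 \<and> G = ident g)"
  unfolding rblo_space_def using ident_in_sym_hom sym_homE by metis

text \<open>In degree \<open>p\<close> the Lie component has arity \<open>1 - p\<close>, because its
  values are suspended, and the operator component has arity \<open>- p\<close>.\<close>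

lemma rbl_elem: "z \<in> rbl_space scale deg0 p \<longleftrightarrow>
    (\<exists>f g. cochain (1 - p) f \<and> f [] = 0 \<and> cochain (- p) g \<and> g [] = 0 \<and> z = (ident f, ident g))"
proof -
  have "F \<in> sym_hom scale (susp deg0) (susp deg0) p \<longleftrightarrow> (\<exists>f. cochain (1 - p) f \<and> f [] = 0 \<and> F = ident f)" for F
    using rblo_elem[of F "p - 1"] by (simp add: rblo_space_def sym_hom_susp)
  then show ?thesis
    unfolding rbl_space_def mem_Times_iff rblo_elem by (cases z) auto
qed

lemma ident_list_rblo: "homs (rblo_space scale deg0) zs \<Longrightarrow> ident_list zs"
  by (fastforce simp: homs_def ident_list_def rblo_elem)

lemma ident_inj: "ident f = ident g \<Longrightarrow> f [] = g [] \<Longrightarrow> f = (g :: 'g list \<Rightarrow> 'g)"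
proof
  fix ws assume e: "ident f = ident g" "f [] = g []"
  have "ident f (map (Pair 1) ws) = ident g (map (Pair 1) ws)"
    using e(1) by simp
  then show "f ws = g ws"
    unfolding ident_ones using e(2) by (cases "ws = []") simp_all
qed

lemma lbr_add:
  assumes "cochain a K" "cochain a K'" "cochain b L" "cochain b L'"
  shows "lbr a b (K + K') L = lbr a b K L + lbr a b K' L"
    "lbr a b K (L + L') = lbr a b K L + lbr a b K L'"
  by (simp_all add: lbr_def wed_add deriv_right deriv_left[OF assms(1)] deriv_left[OF assms(3)]
      sg_plus)

lemma deriv_scale:
  assumes "cochain b f"
  shows "deriv (fun_scale scale c K) f = fun_scale scale c (deriv K f)"
    "deriv K (fun_scale scale c f) = fun_scale scale c (deriv K f)"
  by (simp_all add: deriv_def wed_scale ins_scale_left[OF assms] ins_scale_right)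
    (simp_all add: fun_eq_iff)

lemma lbr_scale:
  assumes "cochain a K" "cochain b L"
  shows "lbr a b (fun_scale scale c K) L = fun_scale scale c (lbr a b K L)"
    "lbr a b K (fun_scale scale c L) = fun_scale scale c (lbr a b K L)"
  by (simp_all add: lbr_def wed_scale deriv_scale[OF assms(1)] deriv_scale[OF assms(2)] fun_eq_iff
      sg_scale scale_right_distrib scale_right_diff_distrib)

lemma lbr_Nil: "K [] = 0 \<Longrightarrow> L [] = 0 \<Longrightarrow> cochain a K \<Longrightarrow> cochain b L \<Longrightarrow> lbr a b K L [] = 0"
  by (simp add: lbr_def deriv_def biadd_zero[OF biadd_br] cochain_Cons)

lemma ins_brc_Nil: "cochain a f \<Longrightarrow> ins brc f [] = 0"
  by (simp add: cochain_Cons)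

text \<open>Each summand takes the Lie component of one argument, and only the first argument has a
  nonzero one.\<close>

lemma rbl_op_head:
  assumes "ident_list zs" "zs \<noteq> []"
  shows "snd (rbl_op scale lam ((- 1, (ident brc, 0)) # map rblo_incl zs))
    = op_mixed scale lam (- 1) (ident brc) zs"
proof
  fix xs
  let ?zs = "(- 1, (ident brc, 0)) # map rblo_incl zs"
  have d: "map (\<lambda>(q, z). (q, snd z)) (map rblo_incl l) = l" for l :: "(int \<times> ((int \<times> 'g) list \<Rightarrow> 'g)) list"
    by (induction l) (auto simp: rblo_incl_def)
  have z: "op_mixed scale lam p 0 (map (\<lambda>(q, z). (q, snd z)) (drop_nth (Suc k) ?zs)) xs = 0" for k p
  proof (rule op_mixed_zero)
    have "drop_nth k (map rblo_incl zs) = map rblo_incl (drop_nth k zs)"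
      by (simp add: drop_nth_def take_map drop_map)
    moreover have "ident_list (drop_nth k zs)"
      using assms(1) by (auto simp: ident_list_def drop_nth_def dest: in_set_takeD in_set_dropD)
    moreover have "\<exists>b g. cochain b g \<and> (0 :: (int \<times> 'g) list \<Rightarrow> 'g) = ident g"
      using cochain_zero_fun ident_zero by metis
    ultimately show "ident_list (map (\<lambda>(q, z). (q, snd z)) (drop_nth (Suc k) ?zs))"
      by (simp add: d del: map_map)
  qed simp
  let ?t = "\<lambda>k. scale (msign (fst (?zs ! k) * degs (take k ?zs) + int k))
        (op_mixed scale lam (fst (?zs ! k)) (fst (snd (?zs ! k)))
          (map (\<lambda>(q, z). (q, snd z)) (drop_nth k ?zs)) xs)"
  have "snd (rbl_op scale lam ?zs) xs = (\<Sum>k<Suc (length zs). ?t k)"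
    using assms(2) by (cases zs) (simp_all add: rbl_op_def)
  also have "\<dots> = ?t 0 + (\<Sum>k<length zs. ?t (Suc k))"
    by (rule sum.lessThan_Suc_shift)
  also have "?t 0 = op_mixed scale lam (- 1) (ident brc) zs xs"
    by (simp add: d degs_def msign_def del: map_map)
  also have "(\<Sum>k<length zs. ?t (Suc k)) = 0"
  proof (rule sum.neutral, rule ballI)
    fix k assume "k \<in> {..<length zs}"
    then have "fst (snd (?zs ! Suc k)) = 0"
      by (simp add: rblo_incl_def)
    then show "?t (Suc k) = 0"
      by (simp only: z scale_zero_right)
  qed
  finally show "snd (rbl_op scale lam ?zs) xs = op_mixed scale lam (- 1) (ident brc) zs xs"
    by (simp only: add_0_right)
qed

lemma rblo_op_eq:
  assumes "ident_list zs" "zs \<noteq> []"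
  shows "rblo_op scale lam br zs = (if length zs = 1 then - op_mixed scale lam (- 1) (ident brc) zs
    else if length zs = 2 then op_mixed scale lam (- 1) (ident brc) zs else 0)"
  unfolding rblo_op_def tilde_bracket_ident rbl_op_head[OF assms] Let_def ..

lemma rblo_op_one:
  assumes "cochain (- p) g" "g [] = 0"
  shows "rblo_op scale lam br [(p, ident g)] = ident (sg p (fun_scale scale lam (ins brc g)))"
proof -
  have "ident_list [(p, ident g)]"
    using assms by auto
  then have "rblo_op scale lam br [(p, ident g)] = - op_mixed scale lam (- 1) (ident brc) [(p, ident g)]"
    by (subst rblo_op_eq) simp_all
  then have "rblo_op scale lam br [(p, ident g)] = - ident (sg (p + 1) (fun_scale scale lam (ins brc g)))"
    unfolding op_mixed_brc_one[OF assms] .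
  then show ?thesis
    by (simp only: ident_uminus[symmetric]) (simp add: sg_def)
qed

lemma rblo_op_two:
  assumes "cochain (- p) g" "g [] = 0" "cochain (- q) h" "h [] = 0"
  shows "rblo_op scale lam br [(p, ident g), (q, ident h)] = ident (sg (p * q) (lbr (- p) (- q) g h))"
proof -
  have "ident_list [(p, ident g), (q, ident h)]"
    using assms by auto
  then have "rblo_op scale lam br [(p, ident g), (q, ident h)]
      = op_mixed scale lam (- 1) (ident brc) [(p, ident g), (q, ident h)]"
    by (subst rblo_op_eq) simp_all
  then show ?thesis
    unfolding op_mixed_brc_two[OF assms] .
qed

lemma rblo_op_many: "3 \<le> length zs \<Longrightarrow> rblo_op scale lam br zs = 0"
  by (simp add: rblo_op_def Let_def)

section \<open>Graded space and multilinearity\<close>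

lemma vector_space_fun_scale: "vector_space (fun_scale scale)"
  by unfold_locales (simp_all add: fun_eq_iff scale_right_distrib scale_left_distrib)

lemma graded_rblo: "graded_space (fun_scale scale) (rblo_space scale deg0)"
  unfolding graded_space_def
proof (intro conjI allI vector_space_fun_scale)
  fix p
  have m: "module (fun_scale scale)"
    using vector_space_fun_scale by (simp add: module_iff_vector_space)
  show "module.subspace (fun_scale scale) (rblo_space scale deg0 p)"
    unfolding module.subspace_def[OF m]
  proof (intro conjI ballI allI)
    have "cochain (- p) 0 \<and> (0 :: 'g list \<Rightarrow> 'g) [] = 0 \<and> 0 = ident (0 :: 'g list \<Rightarrow> 'g)"
      by (simp add: cochain_zero_fun ident_zero)
    then show "0 \<in> rblo_space scale deg0 p"
      unfolding rblo_elem by blast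
  next
    fix F G assume "F \<in> rblo_space scale deg0 p" "G \<in> rblo_space scale deg0 p"
    then obtain f g where "cochain (- p) f" "f [] = 0" "F = ident f" "cochain (- p) g" "g [] = 0" "G = ident g"
      unfolding rblo_elem by blast
    then have "cochain (- p) (f + g) \<and> (f + g) [] = 0 \<and> F + G = ident (f + g)"
      by (simp add: cochain_plus ident_add)
    then show "F + G \<in> rblo_space scale deg0 p"
      unfolding rblo_elem by blast
  next
    fix c F assume "F \<in> rblo_space scale deg0 p"
    then obtain f where "cochain (- p) f" "f [] = 0" "F = ident f"
      unfolding rblo_elem by blast
    then have "cochain (- p) (fun_scale scale c f) \<and> fun_scale scale c f [] = 0
        \<and> fun_scale scale c F = ident (fun_scale scale c f)"
      by (simp add: cochain_fun_scale ident_fun_scale)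
    then show "fun_scale scale c F \<in> rblo_space scale deg0 p"
      unfolding rblo_elem by blast
  qed
qed

lemma rblo_elemE:
  assumes "G \<in> rblo_space scale deg0 p"
  obtains g where "cochain (- p) g" "g [] = 0" "G = ident g"
  using assms unfolding rblo_elem by blast

lemma multilinear_rblo:
  "multilinear_on (fun_scale scale) (fun_scale scale) (rblo_space scale deg0) (rblo_op scale lam br)"
  unfolding multilinear_on_def
proof (intro allI impI, elim conjE)
  fix us ws :: "(int \<times> ((int \<times> 'g) list \<Rightarrow> 'g)) list" and p F G c
  assume h: "homs (rblo_space scale deg0) us" "homs (rblo_space scale deg0) ws"
    and F: "F \<in> rblo_space scale deg0 p" and G: "G \<in> rblo_space scale deg0 p"
  let ?l = "rblo_op scale lam br"
  obtain f where f: "cochain (- p) f" "f [] = 0" "F = ident f"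
    using F by (rule rblo_elemE)
  obtain g where g: "cochain (- p) g" "g [] = 0" "G = ident g"
    using G by (rule rblo_elemE)
  have fg: "cochain (- p) (f + g)" "(f + g) [] = 0" "F + G = ident (f + g)"
    using f g by (simp_all add: cochain_plus ident_add)
  have cf: "cochain (- p) (fun_scale scale c f)" "fun_scale scale c f [] = 0"
    "fun_scale scale c F = ident (fun_scale scale c f)"
    using f by (simp_all add: cochain_fun_scale ident_fun_scale)
  have lin1: "sg e (fun_scale scale l (a + b)) = sg e (fun_scale scale l a) + sg e (fun_scale scale l b)"
    "sg e (fun_scale scale l (fun_scale scale d a)) = fun_scale scale d (sg e (fun_scale scale l a))"
    "sg e (fun_scale scale d a) = fun_scale scale d (sg e a)"
    for e l d and a b :: "'g list \<Rightarrow> 'g"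
    by (simp_all add: fun_eq_iff sg_plus scale_right_distrib sg_scale mult.commute)
  consider "us = []" "ws = []" | u where "us = [u]" "ws = []" | w where "us = []" "ws = [w]"
    | "length us + length ws \<ge> 2"
    by (cases us; cases ws; cases "tl us"; cases "tl ws") auto
  then show "?l (us @ (p, F + G) # ws) = ?l (us @ (p, F) # ws) + ?l (us @ (p, G) # ws) \<and>
      ?l (us @ (p, fun_scale scale c F) # ws) = fun_scale scale c (?l (us @ (p, F) # ws))"
  proof cases
    case 1
    show ?thesis
      unfolding 1 append_Nil fg(3) cf(3) unfolding f(3) g(3) rblo_op_one[OF fg(1,2)]
        rblo_op_one[OF cf(1,2)] rblo_op_one[OF f(1,2)] rblo_op_one[OF g(1,2)]
      unfolding ins_add_right ins_scale_right unfolding lin1(1,2) unfolding ident_add ident_fun_scale by simp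
  next
    case 2
    obtain q U where "u = (q, U)"
      by (cases u)
    then obtain v where v: "cochain (- q) v" "v [] = 0" "u = (q, ident v)"
      using h(1) unfolding 2 homs_Cons by (auto elim: rblo_elemE)
    show ?thesis
      unfolding 2 append_Nil append_Cons fg(3) cf(3) unfolding f(3) g(3) v(3)
        rblo_op_two[OF v(1,2) fg(1,2)] rblo_op_two[OF v(1,2) cf(1,2)] rblo_op_two[OF v(1,2) f(1,2)]
        rblo_op_two[OF v(1,2) g(1,2)] lbr_add(2)[OF v(1) v(1) f(1) g(1)] lbr_scale(2)[OF v(1) f(1)]
      unfolding sg_plus lin1(3) ident_add ident_fun_scale by simp
  next
    case 3
    obtain q U where "w = (q, U)"
      by (cases w)
    then obtain v where v: "cochain (- q) v" "v [] = 0" "w = (q, ident v)"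
      using h(2) unfolding 3 homs_Cons by (auto elim: rblo_elemE)
    show ?thesis
      unfolding 3 append_Nil append_Cons fg(3) cf(3) unfolding f(3) g(3) v(3)
        rblo_op_two[OF fg(1,2) v(1,2)] rblo_op_two[OF cf(1,2) v(1,2)] rblo_op_two[OF f(1,2) v(1,2)]
        rblo_op_two[OF g(1,2) v(1,2)] lbr_add(1)[OF f(1) g(1) v(1) v(1)] lbr_scale(1)[OF f(1) v(1)]
      unfolding sg_plus lin1(3) ident_add ident_fun_scale by simp
  next
    case 4
    then have "3 \<le> length (us @ (p, H) # ws)" for H :: "(int \<times> 'g) list \<Rightarrow> 'g"
      by simp
    then show ?thesis
      by (simp add: rblo_op_many fun_eq_iff)
  qed
qed

lemma ident_mem_rblo: "cochain (- p) f \<Longrightarrow> f [] = 0 \<Longrightarrow> ident f \<in> rblo_space scale deg0 p"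
  unfolding rblo_elem by blast

lemma zero_mem_rblo: "0 \<in> rblo_space scale deg0 p"
  using ident_mem_rblo[OF cochain_zero_fun] by (simp add: ident_zero)

lemma rblo_op_zero_head:
  assumes "homs (rblo_space scale deg0) zs"
  shows "rblo_op scale lam br ((d, 0) # zs) = 0"
  using multilinear_rblo[of lam, unfolded multilinear_on_def, rule_format, of "[]" zs 0 d 0] assms
    zero_mem_rblo[of d] by simp

lemma rblo_op_one_mem:
  assumes g: "cochain (- p) g" "g [] = 0"
  shows "cochain (- (p - 1)) (sg p (fun_scale scale lam (ins brc g)))"
    "sg p (fun_scale scale lam (ins brc g)) [] = 0"
  using cochain_sg[OF cochain_fun_scale[OF cochain_ins_brc[OF g(1)]]] ins_brc_Nil[OF g(1)]
  by (simp_all add: add.commute)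

lemma rblo_op_two_mem:
  assumes "cochain (- p) g" "g [] = 0" "cochain (- q) h" "h [] = 0"
  shows "cochain (- (p + q)) (sg (p * q) (lbr (- p) (- q) g h))" "sg (p * q) (lbr (- p) (- q) g h) [] = 0"
  using cochain_sg[OF cochain_lbr[OF assms(1,3)]] lbr_Nil[OF assms(2,4,1,3)] by simp_all

end

section \<open>The (2,1)-shuffles of three elements\<close>

lemma inversions_shift_rot_1: "inversions 3 (shift (rot 1)) = {(1, 2)}"
proof -
  have "shift (rot 1) 0 = 0" "shift (rot 1) 1 = 2" "shift (rot 1) 2 = 1"
    by (simp_all add: shift_def rot_def numeral_2_eq_2)
  moreover have "inversions 3 p = {(i, j) \<in> {(0, 1), (0, 2), (1, 2)}. p j < p i}" for p :: "nat \<Rightarrow> nat"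
    by (auto simp: inversions_def numeral_3_eq_3 numeral_2_eq_2 less_Suc_eq)
  ultimately show ?thesis
    by auto
qed

lemma chi_shift_rot_1: "chi (shift (rot 1)) [p, q, r] = - msign (q * r)"
proof -
  have "sign (shift (rot 1)) = - 1"
    using sign_eq_inversions[OF shift_permutes[OF rot_permutes[of 1 2]]] inversions_shift_rot_1
    by (simp add: numeral_3_eq_3 numeral_2_eq_2)
  moreover have "koszul (shift (rot 1)) [p, q, r] = msign (q * r)"
    unfolding koszul_inversions using inversions_shift_rot_1
    by (simp add: rot_def numeral_3_eq_3 numeral_2_eq_2 mult.commute)
  ultimately show ?thesis
    by (simp add: chi_def)
qed

lemma chi_rot_2: "chi (rot 2) [p, q, r] = msign (p * q) * msign (p * r)"
proof -
  have "inversions 3 (rot 2) = {(0, 2), (1, 2)}"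
    using inversions_rot[of 2] by (auto simp: numeral_3_eq_3 numeral_2_eq_2 lessThan_Suc)
  then have "koszul (rot 2) [p, q, r] = msign (p * q) * msign (p * r)"
    unfolding koszul_inversions by (simp add: rot_def numeral_3_eq_3 numeral_2_eq_2 mult.commute)
  then show ?thesis
    by (simp add: chi_def sign_rot)
qed

lemma block_shuffles_2_1: "block_shuffles [2, 1] = {id, shift (rot 1), rot 2}"
proof -
  have s: "shift id = id"
    by (auto simp: fun_eq_iff shift_def split: nat.splits)
  have a: "block_shuffles [1, Suc 0] = {id, rot 1}"
    using block_shuffles_1_1 by simp
  have "block_shuffles [Suc 1, Suc 0] = shift ` {id, rot 1} \<union> (\<lambda>q. shift q \<circ> rot (Suc 1)) ` {id}"
    by (simp only: block_shuffles_Suc_Suc[of 1 0] a block_shuffles_0)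
  then show ?thesis
    by (simp add: s insert_commute numeral_2_eq_2)
qed

lemma block_shuffles_2_1_distinct: "id \<noteq> shift (rot 1)" "id \<noteq> rot 2" "shift (rot 1) \<noteq> rot 2"
proof -
  have "id (1::nat) \<noteq> shift (rot 1) 1" "id (0::nat) \<noteq> rot 2 0" "shift (rot 1) 0 \<noteq> rot 2 0"
    by (simp_all add: shift_def rot_def)
  then show "id \<noteq> shift (rot 1)" "id \<noteq> rot 2" "shift (rot 1) \<noteq> rot 2"
    by metis+
qed

lemma permute_list_three:
  "permute_list (shift (rot 1)) [x, y, z] = [x, z, y]" "permute_list (rot 2) [x, y, z] = [y, z, x]"
  using permute_list_rot[of 2 "[y, z]" x] by (simp_all only: permute_list_shift permute_list_rot_1) simp

context lie_alg
begin

lemma rblo_op_nested: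
  assumes "cochain (- p) f" "f [] = 0" "cochain (- q) g" "g [] = 0" "cochain (- r) h" "h [] = 0"
  shows "rblo_op scale lam br [(p + q, rblo_op scale lam br [(p, ident f), (q, ident g)]), (r, ident h)]
    = ident (sg ((p + q) * r + p * q) (lbr (- p + - q) (- r) (lbr (- p) (- q) f g) h))"
proof -
  have "sg ((p + q) * r) (lbr (- (p + q)) (- r) (sg (p * q) (lbr (- p) (- q) f g)) h)
      = sg ((p + q) * r + p * q) (lbr (- p + - q) (- r) (lbr (- p) (- q) f g) h)"
  proof -
    have "lbr a b (- K) L = - lbr a b K L" if "cochain a K" "cochain b L" for a b K L
      by (simp add: lbr_def wed_uminus deriv_right deriv_left[OF that(1)] deriv_left[OF that(2)] sg_minus)
    from this[OF cochain_lbr[OF assms(1,3)] assms(5)] show ?thesis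
      by (simp only: minus_add_distrib) (cases "even (p * q)"; simp add: sg_def)
  qed
  then show ?thesis
    unfolding rblo_op_two[OF assms(1-4)] rblo_op_two[OF rblo_op_two_mem[OF assms(1-4)] assms(5,6)]
    by (simp only:)
qed

text \<open>The summands are those of the three (2,1)-shuffles in the relation with three arguments.
  Skew symmetry brings the nested brackets into the shape of \<open>lbr_jacobi\<close>.\<close>

lemma rblo_jacobi:
  fixes lam :: 'k
  assumes f: "cochain (- p) f" "f [] = 0" and g: "cochain (- q) g" "g [] = 0"
    and h: "cochain (- r) h" "h [] = 0"
  defines "l \<equiv> rblo_op scale lam br"
  shows "l [(p + q, l [(p, ident f), (q, ident g)]), (r, ident h)]
    + (- sg (q * r) (l [(p + r, l [(p, ident f), (r, ident h)]), (q, ident g)]))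
    + sg (p * q + p * r) (l [(q + r, l [(q, ident g), (r, ident h)]), (p, ident f)]) = 0"
proof -
  let ?fg = "lbr (- p) (- q) f g" and ?fh = "lbr (- p) (- r) f h" and ?gh = "lbr (- q) (- r) g h"
  have 1: "lbr (- p + - r) (- q) ?fh g = - sg ((- p + - r) * (- q)) (lbr (- q) (- p + - r) g ?fh)"
    by (rule lbr_skew[OF cochain_lbr[OF f(1) h(1)] g(1)])
  have 2: "lbr (- q + - r) (- p) ?gh f = - sg ((- q + - r) * (- p)) (lbr (- p) (- q + - r) f ?gh)"
    by (rule lbr_skew[OF cochain_lbr[OF g(1) h(1)] f(1)])
  have "sg ((p + q) * r + p * q) (lbr (- p + - q) (- r) ?fg h)
      + (- sg (q * r) (sg ((p + r) * q + p * r) (lbr (- p + - r) (- q) ?fh g)))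
      + sg (p * q + p * r) (sg ((q + r) * p + q * r) (lbr (- q + - r) (- p) ?gh f)) = 0"
    unfolding 1 2 lbr_jacobi[OF f(1) g(1) h(1)]
    by (cases "even p"; cases "even q"; cases "even r") (simp_all add: sg_def)
  then have "ident (sg ((p + q) * r + p * q) (lbr (- p + - q) (- r) ?fg h)
      + (- sg (q * r) (sg ((p + r) * q + p * r) (lbr (- p + - r) (- q) ?fh g)))
      + sg (p * q + p * r) (sg ((q + r) * p + q * r) (lbr (- q + - r) (- p) ?gh f))) = 0"
    by (simp only: ident_zero)
  then show ?thesis
    unfolding l_def rblo_op_nested[OF f g h] rblo_op_nested[OF f h g] rblo_op_nested[OF g h f]
      ident_add ident_uminus ident_sg .
qed

text \<open>The relation with two arguments, a consequence of \<open>ins_brc_lbr\<close>.\<close>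

lemma rblo_leibniz:
  fixes lam :: 'k
  assumes f: "cochain (- p) f" "f [] = 0" and g: "cochain (- q) g" "g [] = 0"
  defines "l \<equiv> rblo_op scale lam br"
  shows "- l [(p - 1, l [(p, ident f)]), (q, ident g)]
    + sg (p * q) (l [(q - 1, l [(q, ident g)]), (p, ident f)])
    + l [(p + q, l [(p, ident f), (q, ident g)])] = 0"
proof -
  let ?F = "fun_scale scale lam (ins brc f)" and ?G = "fun_scale scale lam (ins brc g)"
  have m: "lbr a b (sg e K) L = sg e (lbr a b K L)" if "cochain a K" "cochain b L" for a b e K L
    by (simp add: lbr_def wed_sg deriv_right deriv_left[OF that(1)] deriv_left[OF that(2)] sg_sg sg_minus
        sg_plus sg_def wed_uminus)
  have c: "cochain (- p + 1) (ins brc f)" "cochain (- q + 1) (ins brc g)"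
    by (rule cochain_ins_brc[OF f(1)] cochain_ins_brc[OF g(1)])+
  have e: "- (p - 1) = - p + 1" "- (q - 1) = - q + 1"
    by simp_all
  have 1: "lbr (- q + 1) (- p) (ins brc g) f = - sg ((- q + 1) * (- p)) (lbr (- p) (- q + 1) f (ins brc g))"
    by (rule lbr_skew[OF c(2) f(1)])
  have s: "ins brc (sg n K) = sg n (ins brc K)" for n K
    by (simp add: ins_sg_right)
  \<comment> \<open>The identity without the common factor \<open>lam\<close>; it is a pure
    cancellation of signs.\<close>
  have z: "- sg ((p - 1) * q) (sg p (lbr (- p + 1) (- q) (ins brc f) g))
      + sg (p * q) (sg ((q - 1) * p) (sg q (- sg ((- q + 1) * (- p)) (lbr (- p) (- q + 1) f (ins brc g)))))
      + sg (p + q) (sg (p * q) (lbr (- p + 1) (- q) (ins brc f) g + sg (- p) (lbr (- p) (- q + 1) f (ins brc g)))) = 0"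
    by (cases "even p"; cases "even q") (simp_all add: sg_def)
  have "- sg ((p - 1) * q) (lbr (- (p - 1)) (- q) (sg p ?F) g)
      + sg (p * q) (sg ((q - 1) * p) (lbr (- (q - 1)) (- p) (sg q ?G) f))
      + sg (p + q) (fun_scale scale lam (ins brc (sg (p * q) (lbr (- p) (- q) f g))))
      = fun_scale scale lam (- sg ((p - 1) * q) (sg p (lbr (- p + 1) (- q) (ins brc f) g))
      + sg (p * q) (sg ((q - 1) * p) (sg q (- sg ((- q + 1) * (- p)) (lbr (- p) (- q + 1) f (ins brc g)))))
      + sg (p + q) (sg (p * q) (lbr (- p + 1) (- q) (ins brc f) g + sg (- p) (lbr (- p) (- q + 1) f (ins brc g)))))"
    unfolding e m[OF cochain_fun_scale[OF c(1)] g(1)] m[OF cochain_fun_scale[OF c(2)] f(1)]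
      lbr_scale(1)[OF c(1) g(1)] lbr_scale(1)[OF c(2) f(1)] 1 s ins_brc_lbr[OF f(1) g(1)]
    by (simp add: fun_eq_iff scale_right_distrib scale_right_diff_distrib sg_scale sg_plus sg_minus)
  also have "\<dots> = 0"
    unfolding z by (simp add: fun_eq_iff)
  finally have "ident (- sg ((p - 1) * q) (lbr (- (p - 1)) (- q) (sg p ?F) g)
      + sg (p * q) (sg ((q - 1) * p) (lbr (- (q - 1)) (- p) (sg q ?G) f))
      + sg (p + q) (fun_scale scale lam (ins brc (sg (p * q) (lbr (- p) (- q) f g))))) = 0"
    by (simp only: ident_zero)
  then show ?thesis
    unfolding l_def rblo_op_one[OF f] rblo_op_one[OF g] rblo_op_two[OF f g]
      rblo_op_two[OF rblo_op_one_mem[OF f] g] rblo_op_two[OF rblo_op_one_mem[OF g] f]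
      rblo_op_one[OF rblo_op_two_mem[OF f g]] ident_add ident_uminus ident_sg[of "p * q" "sg ((q - 1) * p) _"] .
qed

lemma rblo_square_zero:
  assumes f: "cochain (- p) f" "f [] = 0"
  shows "rblo_op scale lam br [(p - 1, rblo_op scale lam br [(p, ident f)])] = 0"
  unfolding rblo_op_one[OF f] rblo_op_one[OF rblo_op_one_mem[OF f]] ins_sg_right ins_scale_right
    ins_brc_twice[OF f(1)]
  by (simp add: fun_eq_iff ident_def)

lemma rblo_swap:
  assumes f: "cochain (- p) f" "f [] = 0" and g: "cochain (- q) g" "g [] = 0"
  shows "rblo_op scale lam br [(q, ident g), (p, ident f)]
    = - sg (p * q) (rblo_op scale lam br [(p, ident f), (q, ident g)])"
  unfolding rblo_op_two[OF f g] rblo_op_two[OF g f] lbr_skew[OF g(1) f(1)]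
    ident_sg[symmetric] ident_uminus[symmetric]
  by (rule arg_cong[where f = ident]) (cases "even p"; cases "even q"; simp add: sg_def)

text \<open>Only the relations with at most three arguments have content. With four or more, either
  the inner operation has at least three arguments, or the outer one has.\<close>

lemma linf_rblo: "linf_algebra (fun_scale scale) (rblo_space scale deg0) (rblo_op scale lam br)"
  unfolding linf_algebra_def
proof (intro conjI graded_rblo multilinear_rblo allI impI)
  fix xs :: "(int \<times> ((int \<times> 'g) list \<Rightarrow> 'g)) list"
  assume "xs \<noteq> [] \<and> homs (rblo_space scale deg0) xs"
  then have xs: "xs \<noteq> []" "homs (rblo_space scale deg0) xs"
    by auto
  let ?l = "rblo_op scale lam br"
  let ?t = "\<lambda>i p. let ys = permute_list p xs; as = take i ys; bs = drop i ys in
    fun_scale scale (chi p (map fst xs) * (- 1) ^ (i * (length xs - i))) (?l ((degs as + int i - 2, ?l as) # bs))"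
  let ?ident_list = "?l xs \<in> rblo_space scale deg0 (degs xs + int (length xs) - 2) \<and>
    (\<forall>p. p permutes {..<length xs} \<longrightarrow> ?l (permute_list p xs) = fun_scale scale (chi p (map fst xs)) (?l xs)) \<and>
    (\<Sum>i = 1..length xs. \<Sum>p\<in>block_shuffles [i, length xs - i]. ?t i p) = 0"
  have fs: "fun_scale scale 1 F = F" "fun_scale scale (- 1) F = - F"
    "fun_scale scale (msign e) F = sg e F" "fun_scale scale (- msign e) F = - sg e F" "fun_scale scale c 0 = 0"
    for F :: "(int \<times> 'g) list \<Rightarrow> 'g" and e c
    by (simp_all add: fun_eq_iff scale_msign)
  consider p F where "xs = [(p, F)]" | p F q G where "xs = [(p, F), (q, G)]"
    | p F q G r H where "xs = [(p, F), (q, G), (r, H)]" | "length xs \<ge> 4"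
  proof (cases xs)
    case (Cons z1 l1)
    then show ?thesis
    proof (cases l1)
      case Nil
      then show ?thesis
        using Cons that(1) by (cases z1) auto
    next
      case Cons2: (Cons z2 l2)
      then show ?thesis
      proof (cases l2)
        case Nil
        then show ?thesis
          using Cons Cons2 that(2) by (cases z1; cases z2) auto
      next
        case Cons3: (Cons z3 l3)
        then show ?thesis
          using Cons Cons2 that(3,4) by (cases l3; cases z1; cases z2; cases z3) auto
      qed
    qed
  qed (use xs in auto)
  then have ?ident_list
  proof cases
    case 1
    then obtain f where f: "cochain (- p) f" "f [] = 0" "F = ident f"
      using xs by (auto simp: homs_Cons elim: rblo_elemE)
    have "(\<Sum>i = 1..length xs. \<Sum>r\<in>block_shuffles [i, length xs - i]. ?t i r) = ?t 1 id"
      by (simp add: 1 block_shuffles_0 id_def)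
    also have "\<dots> = ?l [(p - 1, ?l [(p, F)])]"
      unfolding permute_list_id Let_def chi_id by (simp add: 1 degs_def fs)
    also have "\<dots> = 0"
      using rblo_square_zero[OF f(1,2)] f(3) by simp
    finally have R: "(\<Sum>i = 1..length xs. \<Sum>r\<in>block_shuffles [i, length xs - i]. ?t i r) = 0" .
    have D: "?l xs \<in> rblo_space scale deg0 (degs xs + int (length xs) - 2)"
      unfolding 1 f(3) rblo_op_one[OF f(1,2)] using ident_mem_rblo[OF rblo_op_one_mem[OF f(1,2)]]
      by (simp add: degs_def del: sg_apply fun_scale_apply)
    have P: "?l (permute_list r xs) = fun_scale scale (chi r (map fst xs)) (?l xs)"
      if "r permutes {..<length xs}" for r
    proof -
      have "r = id"
        using that permutes_one by (auto simp: 1)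
      then show ?thesis
        by (simp only: permute_list_id chi_id fs)
    qed
    show ?thesis
      using R D P by blast
  next
    case 2
    then obtain f g where f: "cochain (- p) f" "f [] = 0" "F = ident f"
      and g: "cochain (- q) g" "g [] = 0" "G = ident g"
      using xs by (auto simp: homs_Cons elim!: rblo_elemE)
    have d: "id \<noteq> rot 1"
      using id_neq_rot[of 0] by simp
    have "(\<Sum>i = 1..length xs. \<Sum>r\<in>block_shuffles [i, length xs - i]. ?t i r)
        = (\<Sum>r\<in>block_shuffles [1, 1]. ?t 1 r) + (\<Sum>r\<in>block_shuffles [2, 0]. ?t 2 r)"
      by (simp add: 2 numeral_2_eq_2 atLeastAtMostSuc_conv)
    also have "\<dots> = (?t 1 id + ?t 1 (rot 1)) + ?t 2 id"
      unfolding block_shuffles_1_1 block_shuffles_0 using d by simp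
    also have "?t 1 id = - ?l [(p - 1, ?l [(p, F)]), (q, G)]"
      unfolding permute_list_id Let_def chi_id by (simp add: 2 degs_def fs)
    also have "?t 1 (rot 1) = sg (p * q) (?l [(q - 1, ?l [(q, G)]), (p, F)])"
      unfolding 2 permute_list_rot_1 Let_def list.map fst_conv chi_rot_1 by (simp add: degs_def fs)
    also have "?t 2 id = ?l [(p + q, ?l [(p, F), (q, G)])]"
      unfolding permute_list_id Let_def chi_id by (simp add: 2 degs_def fs)
    finally have R: "(\<Sum>i = 1..length xs. \<Sum>r\<in>block_shuffles [i, length xs - i]. ?t i r) = 0"
      unfolding f(3) g(3) using rblo_leibniz[OF f(1,2) g(1,2), of lam] by (simp only:)
    have D: "?l xs \<in> rblo_space scale deg0 (degs xs + int (length xs) - 2)"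
      unfolding 2 f(3) g(3) rblo_op_two[OF f(1,2) g(1,2)]
      using ident_mem_rblo[OF rblo_op_two_mem[OF f(1,2) g(1,2)]] by (simp add: degs_def del: sg_apply)
    have P: "?l (permute_list r xs) = fun_scale scale (chi r (map fst xs)) (?l xs)"
      if "r permutes {..<length xs}" for r
    proof -
      have "r permutes {..<2}"
        using that by (simp add: 2 numeral_2_eq_2)
      then have "r = id \<or> r = rot 1"
        using permutes_two by auto
      then show ?thesis
      proof
        assume r: "r = rot 1"
        show ?thesis
          unfolding r 2 permute_list_rot_1 list.map fst_conv chi_rot_1 fs f(3) g(3)
          by (rule rblo_swap[OF f(1,2) g(1,2)])
      qed (simp only: permute_list_id chi_id fs)
    qed
    show ?thesis
      using R D P by blast
  next
    case 3
    then obtain f g h where f: "cochain (- p) f" "f [] = 0" "F = ident f"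
      and g: "cochain (- q) g" "g [] = 0" "G = ident g" and h: "cochain (- r) h" "h [] = 0" "H = ident h"
      using xs by (auto simp: homs_Cons elim!: rblo_elemE)
    have many: "?l l = 0" if "3 \<le> length l" for l
      using that by (rule rblo_op_many)
    have "(\<Sum>i = 1..length xs. \<Sum>r\<in>block_shuffles [i, length xs - i]. ?t i r)
        = (\<Sum>r\<in>block_shuffles [1, 2]. ?t 1 r) + (\<Sum>r\<in>block_shuffles [2, 1]. ?t 2 r)
          + (\<Sum>r\<in>block_shuffles [3, 0]. ?t 3 r)"
      by (simp add: 3 numeral_2_eq_2 numeral_3_eq_3 atLeastAtMostSuc_conv)
    \<comment> \<open>With an inner \<open>l_1\<close> the outer operation has three arguments; with
      an inner \<open>l_3\<close> the inner one does.\<close>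
    also have "(\<Sum>r\<in>block_shuffles [1, 2]. ?t 1 r) = 0"
      by (rule sum.neutral) (simp add: Let_def 3 many fs)
    also have "(\<Sum>r\<in>block_shuffles [3, 0]. ?t 3 r) = 0"
      by (rule sum.neutral) (simp add: Let_def 3 many fs rblo_op_zero_head)
    also have "(\<Sum>r\<in>block_shuffles [2, 1]. ?t 2 r) = ?t 2 id + (?t 2 (shift (rot 1)) + ?t 2 (rot 2))"
      unfolding block_shuffles_2_1 using block_shuffles_2_1_distinct by simp
    also have "?t 2 id = ?l [(p + q, ?l [(p, F), (q, G)]), (r, H)]"
      unfolding permute_list_id Let_def chi_id by (simp add: 3 degs_def fs)
    also have "?t 2 (shift (rot 1)) = - sg (q * r) (?l [(p + r, ?l [(p, F), (r, H)]), (q, G)])"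
      unfolding 3 permute_list_three Let_def list.map fst_conv chi_shift_rot_1 by (simp add: degs_def fs)
    also have "?t 2 (rot 2) = sg (p * q + p * r) (?l [(q + r, ?l [(q, G), (r, H)]), (p, F)])"
      unfolding 3 permute_list_three Let_def list.map fst_conv chi_rot_2
      by (cases "even (p * q)"; cases "even (p * r)") (simp_all add: degs_def msign_def fs sg_def)
    finally have R: "(\<Sum>i = 1..length xs. \<Sum>r\<in>block_shuffles [i, length xs - i]. ?t i r) = 0"
      unfolding f(3) g(3) h(3) using rblo_jacobi[OF f(1,2) g(1,2) h(1,2), of lam]
      by (simp only: add_0_left add_0_right add.assoc)
    show ?thesis
      using R by (simp add: 3 many fs zero_mem_rblo)
  next
    case 4
    have t: "?t i r = 0" if "r \<in> block_shuffles [i, length xs - i]" "i \<in> {1..length xs}" for i r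
    proof -
      have "r permutes {..<length xs}"
        using block_shuffles_permutes[OF that(1)] that(2) by simp
      then have "homs (rblo_space scale deg0) (permute_list r xs)"
        using xs(2) by (simp add: homs_def)
      then have h: "homs (rblo_space scale deg0) (drop i (permute_list r xs))"
        by (auto simp: homs_def dest: in_set_dropD)
      show ?thesis
      proof (cases "3 \<le> i")
        case True
        then have "?l (take i (permute_list r xs)) = 0"
          using 4 by (intro rblo_op_many) simp
        then show ?thesis
          unfolding Let_def using rblo_op_zero_head[OF h] by (simp only: fs)
      next
        case False
        then have "3 \<le> length ((degs (take i (permute_list r xs)) + int i - 2, ?l (take i (permute_list r xs)))
            # drop i (permute_list r xs))"
          using 4 by simp
        from rblo_op_many[OF this] show ?thesis
          unfolding Let_def by (simp only: fs)
      qed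
    qed
    have "(\<Sum>i = 1..length xs. \<Sum>r\<in>block_shuffles [i, length xs - i]. ?t i r) = 0"
      by (intro sum.neutral ballI t)
    moreover have "?l xs = 0" "?l (permute_list r xs) = 0" for r
      using 4 by (simp_all add: rblo_op_many)
    ultimately show ?thesis
      by (simp add: fs zero_mem_rblo)
  qed
  then show "?l xs \<in> rblo_space scale deg0 (degs xs + int (length xs) - 2)"
    "\<And>p. p permutes {..<length xs} \<Longrightarrow> ?l (permute_list p xs) = fun_scale scale (chi p (map fst xs)) (?l xs)"
    "(\<Sum>i = 1..length xs. \<Sum>p\<in>block_shuffles [i, length xs - i]. ?t i p) = 0"
    by blast+
qed

lemma dg_lie_rblo: "dg_lie_algebra (fun_scale scale) (rblo_space scale deg0) (rblo_op scale lam br)"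
  unfolding dg_lie_algebra_def using linf_rblo rblo_op_many by blast

end

section \<open>Maurer-Cartan elements and twisting\<close>

lemma pair_scale_zero_fst:
  assumes "vector_space s"
  shows "pair_scale s c (0, G) = (0, fun_scale s c G)" "pair_scale s c 0 = 0"
proof -
  interpret vector_space s
    by (rule assms)
  show "pair_scale s c (0, G) = (0, fun_scale s c G)" "pair_scale s c 0 = 0"
    by (simp_all add: pair_scale_def fun_eq_iff zero_prod_def)
qed

lemma degs_take_replicate: "k \<le> i \<Longrightarrow> degs (take k (replicate i (d, y) @ zs)) = int k * d"
  by (simp add: degs_replicate min_def)

lemma maurer_cartan_cong:
  assumes "\<And>n. mc_term s l \<alpha> n = (if n = a then u else if n = b then v else 0)" "a \<noteq> b"
  shows "maurer_cartan s L l \<alpha> \<longleftrightarrow> \<alpha> \<in> L (- 1) \<and> u + v = 0"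
  unfolding maurer_cartan_def using Sum_any_two[OF assms] by simp

context lie_alg
begin

text \<open>The Maurer-Cartan expression of \<open>T\<close> as a 2-cochain: the terms with
  \<open>n = 2\<close> and \<open>n = 1\<close> of the series.\<close>

definition mc_fun :: "'k \<Rightarrow> ('g \<Rightarrow> 'g) \<Rightarrow> 'g list \<Rightarrow> 'g" where
  "mc_fun lam T = fun_scale scale (1 / 2) (lbr 1 1 (opc T) (opc T)) + (- fun_scale scale lam (ins brc (opc T)))"

lemma half_double: "scale (1 / 2) (v + v) = v"
proof -
  have "scale (1 / 2) (v + v) = scale (1 / 2 + 1 / 2) v"
    by (simp only: scale_right_distrib scale_left_distrib)
  then show ?thesis
    by simp
qed

text \<open>The bracket of \<open>opc T\<close> with itself takes each term twice, which the
  coefficient 1/2 of the series compensates. The result is the defect of the Rota-Baxter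
  identity.\<close>

lemma mc_fun_apply:
  assumes T: "lin T"
  shows "mc_fun lam T [x, y] = br (T x) (T y) - T (br x (T y) + br (T x) y + scale lam (br x y))"
proof -
  have w: "(opc T \<sqinter> opc T) [x, y] = br (T x) (T y) + br (T x) (T y)"
    using br_skew[of "T y" "T x"] by (simp add: wedge_def opc_def lin_simps[OF T] biadd_zero[OF biadd_br] sg_def)
  have w': "(opc T \<sqinter> idc) [x, y] = br (T x) y + br x (T y)"
    using br_skew[of "T y" x] by (simp add: wedge_def opc_def lin_simps[OF T] biadd_zero[OF biadd_br] sg_def)
  have "lbr 1 1 (opc T) (opc T) [x, y] = (br (T x) (T y) - T (br x (T y) + br (T x) y))
      + (br (T x) (T y) - T (br x (T y) + br (T x) y))"
    by (simp add: lbr_def deriv_def ins_opc[OF T] w w' lin_simps[OF T] sg_def)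
  then have "scale (1 / 2) (lbr 1 1 (opc T) (opc T) [x, y]) = br (T x) (T y) - T (br x (T y) + br (T x) y)"
    by (simp only: half_double)
  then show ?thesis
    by (simp add: mc_fun_def ins_opc[OF T] lin_simps[OF T])
qed

lemma cochain_mc_fun: "lin T \<Longrightarrow> cochain 2 (mc_fun lam T)"
  unfolding mc_fun_def
  using cochain_lbr[OF cochain_opc cochain_opc, of T T] cochain_ins_brc[OF cochain_opc, of T]
  by (intro cochain_plus cochain_uminus cochain_fun_scale) simp_all

lemma mc_fun_eq_0_iff:
  assumes T: "lin T"
  shows "ident (mc_fun lam T) = 0 \<longleftrightarrow> rota_baxter_operator scale lam br T"
proof
  assume z: "ident (mc_fun lam T) = 0"
  have "mc_fun lam T [x, y] = 0" for x y
    using ident_ones[of "mc_fun lam T" "[x, y]"] unfolding z by simp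
  then show "rota_baxter_operator scale lam br T"
    using T unfolding mc_fun_apply[OF T] by (simp add: rota_baxter_operator_def lin_def)
next
  assume "rota_baxter_operator scale lam br T"
  then have xy: "mc_fun lam T [x, y] = 0" for x y
    unfolding mc_fun_apply[OF T] by (simp add: rota_baxter_operator_def)
  have "mc_fun lam T ws = 0" for ws
  proof (rule ccontr)
    assume nz: "mc_fun lam T ws \<noteq> 0"
    then have "length ws = 2"
      using supportedD[OF cochain_supported[OF cochain_mc_fun[OF T]]] by fastforce
    then show False
      using xy nz by (auto simp: length_Suc_conv numeral_2_eq_2)
  qed
  then show "ident (mc_fun lam T) = 0"
    by (simp add: ident_def fun_eq_iff)
qed

lemma rota_baxter_lin: "rota_baxter_operator scale lam br T \<Longrightarrow> lin T"
  by (simp add: rota_baxter_operator_def lin_def)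

lemma opc_Nil: "lin T \<Longrightarrow> opc T [] = 0"
  by (rule opc_simps)

lemma op_mixed_brc_operator:
  assumes T: "lin T"
  shows "op_mixed scale lam (- 1) (ident brc) [(- 1, ident (opc T))]
      = ident (fun_scale scale lam (ins brc (opc T)))"
    "op_mixed scale lam (- 1) (ident brc) [(- 1, ident (opc T)), (- 1, ident (opc T))]
      = - ident (lbr 1 1 (opc T) (opc T))"
proof -
  have c: "cochain (- (- 1)) (opc T)"
    using cochain_opc[OF T] by simp
  show "op_mixed scale lam (- 1) (ident brc) [(- 1, ident (opc T))]
      = ident (fun_scale scale lam (ins brc (opc T)))"
    unfolding op_mixed_brc_one[OF c opc_Nil[OF T]] by (simp del: sg_apply)
  show "op_mixed scale lam (- 1) (ident brc) [(- 1, ident (opc T)), (- 1, ident (opc T))]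
      = - ident (lbr 1 1 (opc T) (opc T))"
    unfolding op_mixed_brc_two[OF c opc_Nil[OF T] c opc_Nil[OF T]] ident_sg by (simp add: sg_def)
qed

lemma mc_term_rblo:
  assumes T: "lin T"
  shows "mc_term (fun_scale scale) (rblo_op scale lam br) (tilde_operator T) n
    = (if n = 1 then - ident (fun_scale scale lam (ins brc (opc T)))
       else if n = 2 then ident (fun_scale scale (1 / 2) (lbr 1 1 (opc T) (opc T))) else 0)"
proof -
  have g: "ident_list [(- 1, ident (opc T))]" "ident_list [(- 1, ident (opc T)), (- 1, ident (opc T))]"
    using cochain_opc[OF T] by auto
  have fs: "fun_scale scale 1 F = F" "fun_scale scale c 0 = 0" for F :: "(int \<times> 'g) list \<Rightarrow> 'g" and c
    by (simp_all add: fun_eq_iff)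
  consider "n = 0" | "n = 1" | "n = 2" | "3 \<le> n"
    by linarith
  then show ?thesis
  proof cases
    case 2
    have "rblo_op scale lam br [(- 1, ident (opc T))] = - ident (fun_scale scale lam (ins brc (opc T)))"
      unfolding rblo_op_eq[OF g(1) list.simps(3)] op_mixed_brc_operator[OF T] by simp
    then show ?thesis
      by (simp add: 2 mc_term_def tilde_operator_opc[OF T] fs)
  next
    case 3
    have "rblo_op scale lam br [(- 1, ident (opc T)), (- 1, ident (opc T))] = - ident (lbr 1 1 (opc T) (opc T))"
      unfolding rblo_op_eq[OF g(2) list.simps(3)] op_mixed_brc_operator[OF T] by simp
    then have "mc_term (fun_scale scale) (rblo_op scale lam br) (tilde_operator T) 2
        = fun_scale scale (- 1 / 2) (- ident (lbr 1 1 (opc T) (opc T)))"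
      by (simp add: mc_term_def tilde_operator_opc[OF T] numeral_2_eq_2)
    also have "\<dots> = ident (fun_scale scale (1 / 2) (lbr 1 1 (opc T) (opc T)))"
      unfolding ident_fun_scale by (simp add: fun_eq_iff)
    finally show ?thesis
      by (simp add: 3)
  next
    case 4
    then have "rblo_op scale lam br (replicate n (- 1, tilde_operator T)) = 0"
      by (simp add: rblo_op_many)
    then show ?thesis
      using 4 by (simp add: mc_term_def fs)
  qed (simp add: mc_term_def)
qed

lemma tilde_operator_mem: "lin T \<Longrightarrow> tilde_operator T \<in> rblo_space scale deg0 (- 1)"
  unfolding rblo_elem using cochain_opc opc_Nil tilde_operator_opc by fastforce

lemma maurer_cartan_rblo_iff:
  assumes T: "lin T"
  shows "maurer_cartan (fun_scale scale) (rblo_space scale deg0) (rblo_op scale lam br) (tilde_operator T)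
    \<longleftrightarrow> rota_baxter_operator scale lam br T"
proof -
  have ne: "(1::nat) \<noteq> 2"
    by simp
  have e: "- ident (fun_scale scale lam (ins brc (opc T)))
      + ident (fun_scale scale (1 / 2) (lbr 1 1 (opc T) (opc T))) = ident (mc_fun lam T)"
    unfolding mc_fun_def ident_add ident_uminus by simp
  show ?thesis
    unfolding maurer_cartan_cong[OF mc_term_rblo[OF T] ne] e
    using mc_fun_eq_0_iff[OF T] tilde_operator_mem[OF T] by simp
qed

lemma bij_betw_rbo_mc:
  "bij_betw tilde_operator {T. rota_baxter_operator scale lam br T}
    {\<tau>. maurer_cartan (fun_scale scale) (rblo_space scale deg0) (rblo_op scale lam br) \<tau>}"
proof (rule bij_betw_imageI)
  show "inj_on tilde_operator {T. rota_baxter_operator scale lam br T}"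
  proof (rule inj_onI, rule ext)
    fix T T' :: "'g \<Rightarrow> 'g" and x assume "tilde_operator T = tilde_operator T'"
    then have "tilde_operator T [(1, x)] = tilde_operator T' [(1, x)]"
      by simp
    then show "T x = T' x"
      by (simp add: tilde_operator_def)
  qed
  show "tilde_operator ` {T. rota_baxter_operator scale lam br T}
      = {\<tau>. maurer_cartan (fun_scale scale) (rblo_space scale deg0) (rblo_op scale lam br) \<tau>}"
  proof (intro equalityI subsetI)
    fix \<tau> assume "\<tau> \<in> tilde_operator ` {T. rota_baxter_operator scale lam br T}"
    then show "\<tau> \<in> {\<tau>. maurer_cartan (fun_scale scale) (rblo_space scale deg0) (rblo_op scale lam br) \<tau>}"
      using maurer_cartan_rblo_iff rota_baxter_lin by auto
  next
    fix \<tau> assume "\<tau> \<in> {\<tau>. maurer_cartan (fun_scale scale) (rblo_space scale deg0) (rblo_op scale lam br) \<tau>}"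
    then have mc: "maurer_cartan (fun_scale scale) (rblo_space scale deg0) (rblo_op scale lam br) \<tau>"
      by simp
    then have "\<tau> \<in> rblo_space scale deg0 (- 1)"
      by (simp add: maurer_cartan_def)
    then obtain t where t: "cochain 1 t" "t [] = 0" "\<tau> = ident t"
      by (auto elim: rblo_elemE)
    \<comment> \<open>An element of degree -1 has arity 1, so it is determined by its values on
      single vectors.\<close>
    define T where "T x = t [x]" for x
    have T: "lin T"
      unfolding lin_def linear_scale_iff T_def by (simp add: cochain_Cons[OF t(1)])
    have "t ws = opc T ws" for ws
    proof (cases "length ws = 1")
      case True
      then show ?thesis
        by (auto simp: length_Suc_conv opc_def T_def)
    next
      case False
      then have "t ws = 0" "opc T ws = 0"
        using supportedD[OF cochain_supported[OF t(1)], of ws]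
          supportedD[OF cochain_supported[OF cochain_opc[OF T]], of ws] by fastforce+
      then show ?thesis
        by simp
    qed
    then have "\<tau> = tilde_operator T"
      unfolding t(3) tilde_operator_opc[OF T] by (metis ext)
    then show "\<tau> \<in> tilde_operator ` {T. rota_baxter_operator scale lam br T}"
      using mc maurer_cartan_rblo_iff[OF T] by blast
  qed
qed

section \<open>Twisting the dg Lie algebra by an operator\<close>

lemma twist_converges_rblo:
  "twist_converges (fun_scale scale) L (rblo_op scale lam br) \<tau>"
  unfolding twist_converges_def
proof (intro allI impI)
  fix xs :: "(int \<times> ((int \<times> 'g) list \<Rightarrow> 'g)) list" assume "xs \<noteq> [] \<and> homs L xs"
  then have "length xs \<ge> 1"
    by (cases xs) auto
  have "twist_term (fun_scale scale) (rblo_op scale lam br) \<tau> xs i = 0" if "i \<ge> 2" for i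
  proof -
    have "rblo_op scale lam br (replicate i (- 1, \<tau>) @ xs) = 0"
      using that \<open>length xs \<ge> 1\<close> by (intro rblo_op_many) simp
    then show ?thesis
      by (simp add: twist_term_def fun_eq_iff)
  qed
  then have "{i. twist_term (fun_scale scale) (rblo_op scale lam br) \<tau> xs i \<noteq> 0} \<subseteq> {..<2}"
    by (auto simp: not_le[symmetric])
  then show "finite {i. twist_term (fun_scale scale) (rblo_op scale lam br) \<tau> xs i \<noteq> 0}"
    by (rule finite_subset) simp
qed

text \<open>The twisted differential in every integer degree \<open>p\<close>. For
  \<open>p \<le> 0\<close> it is \<open>rblo_diff\<close> on cochains of arity \<open>- p\<close>;
  for \<open>p > 0\<close> the cochains vanish.\<close>

definition tw_diff :: "'k \<Rightarrow> ('g \<Rightarrow> 'g) \<Rightarrow> int \<Rightarrow> ('g list \<Rightarrow> 'g) \<Rightarrow> 'g list \<Rightarrow> 'g" where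
  "tw_diff lam T p g = sg p (fun_scale scale lam (ins brc g)) + (- sg p (lbr 1 (- p) (opc T) g))"

lemma lbr_zero:
  assumes "cochain a K"
  shows "lbr c d 0 K = 0" "lbr c d K 0 = 0"
  using ins_zero_left[OF assms] by (simp_all add: lbr_def deriv_def wed_zero ins_zero_right)

lemma tw_diff_zero: "lin T \<Longrightarrow> tw_diff lam T p 0 = 0"
  unfolding tw_diff_def ins_zero_right lbr_zero(2)[OF cochain_opc] by (simp add: fun_eq_iff)

lemma tw_diff_eq:
  assumes "lin T" "cochain (- p) g" "p \<le> 0"
  shows "tw_diff lam T p g = rblo_diff scale lam br T (nat (- p)) g"
proof -
  have "int (nat (- p)) = - p"
    using assms(3) by simp
  then show ?thesis
    using rblo_diff_eq[OF assms(1), of "nat (- p)" g lam] assms(2)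
    by (simp add: tw_diff_def fun_eq_iff sg_def)
qed

lemma cochain_tw_diff:
  assumes T: "lin T" and g: "cochain (- p) g" "g [] = 0"
  shows "cochain (1 - p) (tw_diff lam T p g)" "tw_diff lam T p g [] = 0"
proof -
  have "cochain (1 - p) (ins brc g)" "cochain (1 - p) (lbr 1 (- p) (opc T) g)"
    using cochain_ins_brc[OF g(1)] cochain_lbr[OF cochain_opc[OF T] g(1)] by simp_all
  then show "cochain (1 - p) (tw_diff lam T p g)"
    unfolding tw_diff_def by (intro cochain_plus cochain_uminus cochain_sg cochain_fun_scale)
  show "tw_diff lam T p g [] = 0"
    using ins_brc_Nil[OF g(1)] lbr_Nil[OF opc_Nil[OF T] g(2) cochain_opc[OF T] g(1)]
    by (simp add: tw_diff_def)
qed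

text \<open>The two surviving terms of the twisting series: \<open>i = 0\<close> and
  \<open>i = 1\<close> in the dg Lie algebra, \<open>i = 1\<close> and \<open>i = 2\<close> in the
  full algebra, where one more copy of the Maurer-Cartan element supplies the bracket.\<close>

lemma op_mixed_tw_diff:
  assumes T: "lin T" and g: "cochain (- p) g" "g [] = 0"
  shows "- op_mixed scale lam (- 1) (ident brc) [(p, ident g)]
      + (- op_mixed scale lam (- 1) (ident brc) [(- 1, ident (opc T)), (p, ident g)])
    = ident (tw_diff lam T p g)"
proof -
  have c: "cochain (- (- 1)) (opc T)"
    using cochain_opc[OF T] by simp
  show ?thesis
    unfolding op_mixed_brc_one[OF g] op_mixed_brc_two[OF c opc_Nil[OF T] g] tw_diff_def
      ident_add ident_uminus ident_sg
    by (simp add: sg_def)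
qed

lemma twisted_diff_rblo:
  assumes T: "lin T" and g: "cochain (- p) g" "g [] = 0"
  shows "twisted_diff (fun_scale scale) (rblo_op scale lam br) (tilde_operator T) p (ident g)
    = ident (tw_diff lam T p g)"
proof -
  let ?l = "rblo_op scale lam br"
  have ident_list: "ident_list [(p, ident g)]" "ident_list [(- 1, ident (opc T)), (p, ident g)]"
    using cochain_opc[OF T] g by auto
  have fs: "fun_scale scale 1 F = F" "fun_scale scale (- 1) F = - F" "fun_scale scale c 0 = 0"
    for F :: "(int \<times> 'g) list \<Rightarrow> 'g" and c
    by (simp_all add: fun_eq_iff)
  have "twist_term (fun_scale scale) ?l (tilde_operator T) [(p, ident g)] i
    = (if i = 0 then - op_mixed scale lam (- 1) (ident brc) [(p, ident g)]
       else if i = 1 then - op_mixed scale lam (- 1) (ident brc) [(- 1, ident (opc T)), (p, ident g)] else 0)" for i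
  proof -
    consider "i = 0" | "i = 1" | "2 \<le> i"
      by linarith
    then show ?thesis
    proof cases
      case 1
      have "?l [(p, ident g)] = - op_mixed scale lam (- 1) (ident brc) [(p, ident g)]"
        unfolding rblo_op_eq[OF ident_list(1) list.simps(3)] by simp
      then show ?thesis
        by (simp add: 1 twist_term_def fs)
    next
      case 2
      have "?l [(- 1, ident (opc T)), (p, ident g)]
          = op_mixed scale lam (- 1) (ident brc) [(- 1, ident (opc T)), (p, ident g)]"
        unfolding rblo_op_eq[OF ident_list(2) list.simps(3)] by simp
      then show ?thesis
        by (simp add: 2 twist_term_def fs tilde_operator_opc[OF T])
    next
      case 3
      then have "?l (replicate i (- 1, tilde_operator T) @ [(p, ident g)]) = 0"
        by (intro rblo_op_many) simp
      then show ?thesis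
        using 3 by (simp add: twist_term_def fs)
    qed
  qed
  from Sum_any_two(1)[OF this] show ?thesis
    unfolding twisted_diff_def twist_def by (simp add: op_mixed_tw_diff[OF T g, symmetric])
qed

lemma rblo_positive_iff:
  "g \<in> homological (rblo_positive scale) p \<longleftrightarrow> cochain (- p) g \<and> g [] = 0"
proof (cases "p \<le> 0")
  case True
  then show ?thesis
    by (auto simp: homological_def rblo_positive_def alt_cochains_iff)
next
  case False
  then show ?thesis
    using cochain_negative[of "- p" g] by (auto simp: homological_def cochain_zero_fun)
qed

text \<open>In degree 1 the convention that the operator part is zero agrees with its arity -1;
  above degree 1 both arities are negative.\<close>

lemma rbl_positive_iff:
  "z \<in> susp (homological (rbl_positive scale)) p \<longleftrightarrow>
    cochain (1 - p) (fst z) \<and> fst z [] = 0 \<and> cochain (- p) (snd z) \<and> snd z [] = 0"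
proof -
  obtain f g where z: "z = (f, g)"
    by (cases z)
  consider "p \<le> 0" | "p = 1" | "p > 1"
    by linarith
  then show ?thesis
  proof cases
    case 1
    then have "nat (- (p - 1)) \<noteq> 0" "nat (- (p - 1)) - 1 = nat (- p)"
      by auto
    then show ?thesis
      using 1 by (auto simp: z susp_def homological_def rbl_positive_def rbl_cochains_def alt_cochains_iff)
  next
    case 2
    then show ?thesis
      using cochain_negative[of "- 1" g] cochain_zero_fun
      by (auto simp: z susp_def homological_def rbl_positive_def rbl_cochains_def alt_cochains_iff)
  next
    case 3
    then show ?thesis
      using cochain_negative[of "- p" g] cochain_negative[of "1 - p" f] cochain_zero_fun
      by (auto simp: z susp_def homological_def zero_prod_def)
  qed
qed

lemma complex_iso_rblo:
  assumes T: "lin T"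
  shows "complex_iso (fun_scale scale) (fun_scale scale) ident
    (homological (rblo_positive scale)) (homological_diff (rblo_diff scale lam br T))
    (rblo_space scale deg0)
    (twisted_diff (fun_scale scale) (rblo_op scale lam br) (tilde_operator T))"
  unfolding complex_iso_def
proof (intro allI conjI ballI)
  fix p
  show "bij_betw ident (homological (rblo_positive scale) p) (rblo_space scale deg0 p)"
  proof (rule bij_betw_imageI)
    show "inj_on ident (homological (rblo_positive scale) p)"
      by (rule inj_onI) (simp add: rblo_positive_iff ident_inj)
    show "ident ` homological (rblo_positive scale) p = rblo_space scale deg0 p"
      unfolding set_eq_iff image_iff Bex_def rblo_positive_iff rblo_elem by blast
  qed
  fix g assume "g \<in> homological (rblo_positive scale) p"
  then have g: "cochain (- p) g" "g [] = 0"
    by (simp_all add: rblo_positive_iff)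
  have d: "homological_diff (rblo_diff scale lam br T) p g = tw_diff lam T p g"
  proof (cases "p \<le> 0")
    case False
    then have "g = 0"
      using cochain_negative[OF g(1)] by simp
    then have "tw_diff lam T p g = 0"
      using tw_diff_zero[OF T] by (simp only:)
    then show ?thesis
      using False by (simp add: homological_diff_def)
  qed (simp add: homological_diff_def tw_diff_eq[OF T g(1)])
  show "homological_diff (rblo_diff scale lam br T) p g \<in> homological (rblo_positive scale) (p - 1)"
    unfolding d rblo_positive_iff using cochain_tw_diff[OF T g] by simp
  show "ident (homological_diff (rblo_diff scale lam br T) p g)
      = twisted_diff (fun_scale scale) (rblo_op scale lam br) (tilde_operator T) p (ident g)"
    unfolding d twisted_diff_rblo[OF T g] ..
qed (simp_all add: ident_add ident_fun_scale)

text \<open>Every summand of the second component feeds \<open>length zs - 1\<close> operators to a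
  Lie component of smaller arity; the first component lives on two arguments only.\<close>

lemma rbl_op_large:
  assumes "3 \<le> length zs" "\<And>z. z \<in> set zs \<Longrightarrow> \<exists>b f c g. cochain b f \<and> b < int (length zs) - 1
    \<and> cochain c g \<and> snd z = (ident f, ident g)"
  shows "rbl_op scale lam zs = 0"
proof -
  have "op_mixed scale lam (fst (zs ! k)) (fst (snd (zs ! k)))
      (map (\<lambda>(q, z). (q, snd z)) (drop_nth k zs)) xs = 0" if k: "k < length zs" for k xs
  proof -
    obtain b f c g where z: "cochain b f" "b < int (length zs) - 1" "snd (zs ! k) = (ident f, ident g)"
      using assms(2)[OF nth_mem[OF k]] by blast
    have l: "length (drop_nth k zs) = length zs - 1"
      using k by (simp add: drop_nth_def)
    have "ident_list (map (\<lambda>(q, z). (q, snd z)) (drop_nth k zs))"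
      unfolding ident_list_def
    proof
      fix y assume "y \<in> set (map (\<lambda>(q, z). (q, snd z)) (drop_nth k zs))"
      then obtain x where "x \<in> set (drop_nth k zs)" "snd y = snd (snd x)"
        by auto
      moreover from this have "x \<in> set zs"
        by (auto simp: drop_nth_def dest: in_set_takeD in_set_dropD)
      ultimately show "\<exists>b g. cochain b g \<and> snd y = ident g"
        using assms(2)[of x] by fastforce
    qed
    then show ?thesis
      unfolding z(3) fst_conv
      by (rule op_mixed_large[OF cochain_supported[OF z(1)]]) (use l z(2) assms(1) in auto)
  qed
  then show ?thesis
    using assms(1) by (auto simp: rbl_op_def zero_prod_def fun_eq_iff intro!: sum.neutral)
qed

lemma twist_converges_rbl:
  assumes T: "lin T"
  shows "twist_converges (pair_scale scale) (rbl_space scale deg0) (rbl_op scale lam)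
    (ident brc, ident (opc T))"
  unfolding twist_converges_def
proof (intro allI impI)
  fix xs :: "(int \<times> ((int \<times> 'g) list \<Rightarrow> 'g) \<times> ((int \<times> 'g) list \<Rightarrow> 'g)) list"
  assume xs: "xs \<noteq> [] \<and> homs (rbl_space scale deg0) xs"
  let ?\<alpha> = "(ident brc, ident (opc T))"
  \<comment> \<open>A bound for the arities of all Lie components involved: 2 for
    \<open>brc\<close>, and \<open>1 - p\<close> for an argument of degree \<open>p\<close>.\<close>
  define B where "B = Max (insert 2 ((\<lambda>z. 1 - fst z) ` set xs))"
  have B: "2 \<le> B" "\<And>z. z \<in> set xs \<Longrightarrow> 1 - fst z \<le> B"
    unfolding B_def by (auto intro: Max_ge)
  have "twist_term (pair_scale scale) (rbl_op scale lam) ?\<alpha> xs i = 0" if i: "nat B + 2 \<le> i" for i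
  proof -
    let ?zs = "replicate i (- 1, ?\<alpha>) @ xs"
    have l: "3 \<le> length ?zs" "B < int (length ?zs) - 1"
      using i B(1) xs by (cases xs; simp)+
    have "rbl_op scale lam ?zs = 0"
    proof (rule rbl_op_large[OF l(1)])
      fix z assume "z \<in> set ?zs"
      then consider "z = (- 1, ?\<alpha>)" | "z \<in> set xs"
        by auto
      then show "\<exists>b f c g. cochain b f \<and> b < int (length ?zs) - 1 \<and> cochain c g \<and> snd z = (ident f, ident g)"
      proof cases
        case 1
        then show ?thesis
          using cochain_brc cochain_opc[OF T] l(2) B(1) by (intro exI[of _ 2] exI[of _ brc] exI[of _ 1] exI[of _ "opc T"]) simp
      next
        case 2
        then have "snd z \<in> rbl_space scale deg0 (fst z)"
          using xs by (auto simp: homs_def)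
        then obtain f g where "cochain (1 - fst z) f" "cochain (- fst z) g" "snd z = (ident f, ident g)"
          unfolding rbl_elem by blast
        moreover have "1 - fst z < int (length ?zs) - 1"
          using B(2)[OF 2] l(2) by linarith
        ultimately show ?thesis
          by blast
      qed
    qed
    then show ?thesis
      unfolding twist_term_def by (simp only: pair_scale_zero_fst[OF vector_space])
  qed
  then have "{i. twist_term (pair_scale scale) (rbl_op scale lam) ?\<alpha> xs i \<noteq> 0} \<subseteq> {..<nat B + 2}"
    by (auto simp: not_le[symmetric])
  then show "finite {i. twist_term (pair_scale scale) (rbl_op scale lam) ?\<alpha> xs i \<noteq> 0}"
    by (rule finite_subset) simp
qed

section \<open>The Maurer-Cartan series in the full algebra\<close>

lemma fst_rbl_op_eq_0: "length zs \<noteq> 2 \<Longrightarrow> fst (rbl_op scale lam zs) = 0"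
  by (simp add: rbl_op_def)

lemma rbl_op_short: "length zs < 2 \<Longrightarrow> rbl_op scale lam zs = 0"
  by (simp add: rbl_op_def zero_prod_def)

lemma msign_even: "even e \<Longrightarrow> msign e = (1 :: 'k)"
  by (simp add: msign_def)

text \<open>Moving the Lie component past \<open>k\<close> elements of degree -1 has exponent
  \<open>k + k\<close>, so all \<open>n\<close> positions contribute equally. The factor
  \<open>n\<close> turns the coefficient \<open>1 / fact n\<close> into
  \<open>1 / fact (n - 1)\<close>.\<close>

lemma snd_rbl_op_replicate:
  assumes "2 \<le> n"
  shows "snd (rbl_op scale lam (replicate n (- 1, (F, G)))) xs
    = scale (of_nat n) (op_mixed scale lam (- 1) F (replicate (n - 1) (- 1, G)) xs)"
proof -
  have "snd (rbl_op scale lam (replicate n (- 1, (F, G)))) xs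
      = (\<Sum>k<n. op_mixed scale lam (- 1) F (replicate (n - 1) (- 1, G)) xs)"
    using assms
    by (auto simp: rbl_op_def drop_nth_replicate degs_replicate min_def msign_even intro!: sum.cong)
  then show ?thesis
    by (simp add: sum_const_scale)
qed

lemma rbl_mem_mc:
  assumes T: "lin T"
  shows "(ident brc, ident (opc T)) \<in> rbl_space scale deg0 (- 1)"
  unfolding rbl_elem using cochain_brc cochain_opc[OF T] opc_Nil[OF T] by fastforce

text \<open>The terms of \<open>mc_term_rblo\<close> with the index shifted by one, since one of the
  arguments supplies the bracket. The coefficient for \<open>n = 3\<close> is
  \<open>- 3 / 6\<close>, because three positions contribute.\<close>

lemma mc_term_rbl:
  assumes T: "lin T"
  shows "mc_term (pair_scale scale) (rbl_op scale lam) (ident brc, ident (opc T)) n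
    = (if n = 2 then (0, - ident (fun_scale scale lam (ins brc (opc T))))
       else if n = 3 then (0, ident (fun_scale scale (1 / 2) (lbr 1 1 (opc T) (opc T)))) else 0)"
proof -
  let ?\<alpha> = "(ident brc, ident (opc T))"
  let ?z = "\<lambda>n. replicate n (- 1 :: int, ?\<alpha>)"
  \<comment> \<open>The Lie component of the series is the Jacobi identity of the bracket.\<close>
  have "brace scale (ident brc) [(- 1, ident brc)] = ident (ins brc brc)"
    by (rule brace_one[OF cochain_brc cochain_supported[OF cochain_brc]]) simp_all
  then have "op_lie scale (- 1, ident brc) (- 1, ident brc) = 0"
    by (simp add: op_lie_def ins_brc_brc ident_zero fun_eq_iff)
  then have f: "fst (rbl_op scale lam (?z n)) = 0" for n
    by (simp add: rbl_op_def)
  have s: "snd (rbl_op scale lam (?z n)) = fun_scale scale (of_nat n)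
      (op_mixed scale lam (- 1) (ident brc) (replicate (n - 1) (- 1, ident (opc T))))" if "2 \<le> n" for n
    using snd_rbl_op_replicate[OF that] by (simp add: fun_eq_iff)
  have t: "mc_term (pair_scale scale) (rbl_op scale lam) ?\<alpha> n = (0, fun_scale scale ((- 1) ^ (n * (n - 1) div 2) / fact n * of_nat n)
      (op_mixed scale lam (- 1) (ident brc) (replicate (n - 1) (- 1, ident (opc T)))))" if n: "2 \<le> n" for n
  proof -
    have "rbl_op scale lam (?z n) = (0, fun_scale scale (of_nat n)
      (op_mixed scale lam (- 1) (ident brc) (replicate (n - 1) (- 1, ident (opc T)))))"
      using f[of n] s[OF n] by (metis prod.collapse)
    then show ?thesis
      using n by (simp add: mc_term_def pair_scale_zero_fst[OF vector_space] fun_scale_def)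
  qed
  consider "n < 2" | "n = 2" | "n = 3" | "4 \<le> n"
    by linarith
  then show ?thesis
  proof cases
    case 1
    then show ?thesis
      by (simp add: mc_term_def rbl_op_short pair_scale_zero_fst[OF vector_space])
  next
    case 2
    have "fun_scale scale (- 1) F = - F" for F :: "(int \<times> 'g) list \<Rightarrow> 'g"
      by (simp add: fun_eq_iff)
    then show ?thesis
      using t[of 2] op_mixed_brc_operator(1)[OF T, of lam] by (simp add: 2)
  next
    case 3
    have r: "replicate (3 - 1) (- 1 :: int, ident (opc T)) = [(- 1, ident (opc T)), (- 1, ident (opc T))]"
      by (simp add: numeral_2_eq_2)
    have c: "(- 1) ^ (3 * (3 - 1) div 2) / fact 3 * of_nat 3 = (- (1 / 2) :: 'k)"
      by (simp add: fact_numeral)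
    have "fun_scale scale (- c) (- F) = fun_scale scale c F" for c and F :: "(int \<times> 'g) list \<Rightarrow> 'g"
      by (simp add: fun_eq_iff)
    then show ?thesis
      using t[of 3] unfolding r c op_mixed_brc_operator(2)[OF T] by (simp add: 3 ident_fun_scale)
  next
    case 4
    have "ident_list (replicate (n - 1) (- 1, ident (opc T)))"
      using ident_list_operators[OF T] by (simp add: tilde_operator_opc[OF T])
    then have "op_mixed scale lam (- 1) (ident brc) (replicate (n - 1) (- 1, ident (opc T))) = 0"
      by (rule op_mixed_brc_many) (use 4 in simp)
    moreover have "fun_scale scale c 0 = (0 :: (int \<times> 'g) list \<Rightarrow> 'g)" for c
      by (simp add: fun_eq_iff)
    ultimately show ?thesis
      using t[of n] 4 by (simp add: zero_prod_def)
  qed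
qed

lemma maurer_cartan_rbl:
  assumes "rota_baxter_operator scale lam br T"
  shows "maurer_cartan (pair_scale scale) (rbl_space scale deg0) (rbl_op scale lam)
    (tilde_bracket br, tilde_operator T)"
proof -
  have T: "lin T"
    by (rule rota_baxter_lin[OF assms])
  have ne: "(2::nat) \<noteq> 3"
    by simp
  have "- ident (fun_scale scale lam (ins brc (opc T)))
      + ident (fun_scale scale (1 / 2) (lbr 1 1 (opc T) (opc T))) = ident (mc_fun lam T)"
    unfolding mc_fun_def ident_add ident_uminus by simp
  also have "\<dots> = 0"
    using mc_fun_eq_0_iff[OF T] assms by simp
  finally have z: "- ident (fun_scale scale lam (ins brc (opc T)))
      + ident (fun_scale scale (1 / 2) (lbr 1 1 (opc T) (opc T))) = 0" .
  show ?thesis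
    unfolding tilde_bracket_ident tilde_operator_opc[OF T] maurer_cartan_cong[OF mc_term_rbl[OF T] ne]
      add_Pair z
    using rbl_mem_mc[OF T] by (simp add: zero_prod_def)
qed

text \<open>The Lie component is taken either from one of the \<open>i\<close> equal arguments, each
  with a trivial sign, or from the last one, which moves past \<open>i\<close> elements of degree -1
  with exponent \<open>i * (1 - p)\<close>.\<close>

lemma snd_rbl_op_twist:
  assumes "1 \<le> i"
  shows "snd (rbl_op scale lam (replicate i (- 1, (F, G)) @ [(p, (F', G'))])) xs
    = scale (of_nat i) (op_mixed scale lam (- 1) F (replicate (i - 1) (- 1, G) @ [(p, G')]) xs)
      + sg (int i * (p + 1)) (op_mixed scale lam p F' (replicate i (- 1, G)) xs)"
proof -
  let ?zs = "replicate i (- 1, (F, G)) @ [(p, (F', G'))]"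
  let ?t = "\<lambda>k. scale (msign (fst (?zs ! k) * degs (take k ?zs) + int k))
        (op_mixed scale lam (fst (?zs ! k)) (fst (snd (?zs ! k)))
          (map (\<lambda>(q, z). (q, snd z)) (drop_nth k ?zs)) xs)"
  have "snd (rbl_op scale lam ?zs) xs = (\<Sum>k<Suc i. ?t k)"
    using assms by (simp add: rbl_op_def)
  also have "\<dots> = (\<Sum>k<i. ?t k) + ?t i"
    by simp
  also have "(\<Sum>k<i. ?t k)
      = (\<Sum>k<i. op_mixed scale lam (- 1) F (replicate (i - 1) (- 1, G) @ [(p, G')]) xs)"
  proof (rule sum.cong[OF refl])
    fix k assume "k \<in> {..<i}"
    then have k: "k < i"
      by simp
    have "?zs ! k = (- 1, (F, G))"
      using k by (simp add: nth_append)
    moreover have "drop_nth k ?zs = replicate (i - 1) (- 1, (F, G)) @ [(p, (F', G'))]"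
      using k by (simp add: drop_nth_append drop_nth_replicate)
    moreover have "degs (take k ?zs) = - int k"
      using degs_take_replicate[of k i "- 1" "(F, G)" "[(p, (F', G'))]"] k by simp
    ultimately show "?t k = op_mixed scale lam (- 1) F (replicate (i - 1) (- 1, G) @ [(p, G')]) xs"
      by (simp add: msign_even)
  qed
  also have "\<dots> = scale (of_nat i) (op_mixed scale lam (- 1) F (replicate (i - 1) (- 1, G) @ [(p, G')]) xs)"
    by (simp add: sum_const_scale)
  also have "?t i = sg (int i * (p + 1)) (op_mixed scale lam p F' (replicate i (- 1, G)) xs)"
  proof -
    have "degs (take i ?zs) = - int i"
      using degs_take_replicate[of i i "- 1" "(F, G)" "[(p, (F', G'))]"] by simp
    moreover have "drop_nth i ?zs = replicate i (- 1, (F, G))" "?zs ! i = (p, (F', G'))"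
      by (simp_all add: drop_nth_def nth_append)
    ultimately show ?thesis
      by (simp add: scale_msign) (simp add: sg_def)
  qed
  finally show ?thesis .
qed

text \<open>Minus the graded commutator of \<open>brc\<close> with \<open>f\<close>; the minus sign
  is the coefficient of the term \<open>i = 1\<close> in the twisting series.\<close>

definition lie_part :: "int \<Rightarrow> ('g list \<Rightarrow> 'g) \<Rightarrow> 'g list \<Rightarrow> 'g" where
  "lie_part p f = sg p (ins brc f) + (- (f \<sqinter> idc))"

definition phi_sum :: "'k \<Rightarrow> ('g \<Rightarrow> 'g) \<Rightarrow> nat \<Rightarrow> ('g list \<Rightarrow> 'g) \<Rightarrow> 'g list \<Rightarrow> 'g" where
  "phi_sum lam T n f = (\<Sum>i = 1..n. phi_part lam T n f i)"

lemma cochain_nonpos_arity: "cochain (1 - p) f \<Longrightarrow> f [] = 0 \<Longrightarrow> 0 < p \<Longrightarrow> f = 0"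
proof
  fix ws assume "cochain (1 - p) f" "f [] = 0" "0 < p"
  then show "f ws = 0 ws"
    using supportedD[OF cochain_supported, of "1 - p" f ws] by (cases ws) auto
qed

lemma twist_phi_part:
  assumes T: "lin T" and f: "cochain (1 - p) f" "f [] = 0" and i: "1 \<le> i"
  shows "scale ((- 1) ^ (i + i * (i - 1) div 2) / fact i)
      (sg (int i * (p + 1)) (op_mixed scale lam p (ident f) (replicate i (- 1, ident (opc T))) xs))
    = (if i \<le> nat (1 - p) then ident (phi_part lam T (nat (1 - p)) f i) xs else 0)"
proof (cases "0 < p")
  case True
  then have "f = 0"
    using cochain_nonpos_arity[OF f] by simp
  moreover have "ident_list (replicate i (- 1, ident (opc T)))" "replicate i (- 1, ident (opc T)) \<noteq> []"
    using ident_list_operators[OF T] i by (auto simp: tilde_operator_opc[OF T])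
  ultimately show ?thesis
    using True i op_mixed_zero by (simp add: ident_zero)
next
  case False
  define n where "n = nat (1 - p)"
  then have n: "int n = 1 - p" "p = 1 - int n" "0 < n"
    using False by auto
  have sg: "sg (int i * (p + 1)) v = sg (int i * int n) v" for v :: 'g
    unfolding n(2) by (simp add: sg_def)
  have f': "cochain (int n) f"
    using f(1) n(1) by simp
  have "0 < i"
    using i by simp
  note op_mixed_operators[OF T f' n(3) this, of lam xs, folded n(2) sg, unfolded tilde_operator_opc[OF T]]
  moreover have "ident (phi_part lam T n f i) xs = 0" if "\<not> i \<le> n"
    using that by (simp add: phi_part_def ident_def)
  ultimately show ?thesis
    unfolding n_def[symmetric] by (cases "i \<le> n") (simp_all only: if_True if_False simp_thms)
qed

text \<open>The bracket accepts at most two operators, so \<open>i\<close> is 1 or 2. In both cases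
  the factorial cancels against the factor \<open>i\<close>, and the coefficient is -1.\<close>

lemma twist_brc_part:
  assumes T: "lin T" and g: "cochain (- p) g" "g [] = 0" and i: "1 \<le> i"
  shows "fun_scale scale ((- 1) ^ (i + i * (i - 1) div 2) / fact i * of_nat i)
      (op_mixed scale lam (- 1) (ident brc) (replicate (i - 1) (- 1, ident (opc T)) @ [(p, ident g)]))
    = (if i = 1 then - op_mixed scale lam (- 1) (ident brc) [(p, ident g)]
       else if i = 2 then - op_mixed scale lam (- 1) (ident brc) [(- 1, ident (opc T)), (p, ident g)] else 0)"
proof -
  have m: "fun_scale scale (- 1) F = - F" "fun_scale scale c 0 = 0" for c and F :: "(int \<times> 'g) list \<Rightarrow> 'g"
    by (simp_all add: fun_eq_iff)
  consider "i = 1" | "i = 2" | "3 \<le> i"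
    using i by linarith
  then show ?thesis
  proof cases
    case 3
    have "ident_list (replicate (i - 1) (- 1, ident (opc T)) @ [(p, ident g)])"
      using ident_list_operators[OF T, of "i - 1" "- 1"] g by (auto simp: tilde_operator_opc[OF T] ident_list_def)
    then have "op_mixed scale lam (- 1) (ident brc) (replicate (i - 1) (- 1, ident (opc T)) @ [(p, ident g)]) = 0"
      by (rule op_mixed_brc_many) (use 3 in simp)
    then show ?thesis
      using 3 by (simp add: m)
  qed (simp_all add: m)
qed

text \<open>If the Maurer-Cartan element supplies the Lie component, the terms
  \<open>i = 1, 2\<close> form \<open>tw_diff\<close>. If the argument supplies it, the
  \<open>i\<close> copies of \<open>T\<close> give the part of \<Phi> with index \<open>i\<close>.
  The first component needs exactly two arguments, so \<open>i = 1\<close>.\<close>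

lemma twisted_diff_rbl:
  assumes T: "lin T" and f: "cochain (1 - p) f" "f [] = 0" and g: "cochain (- p) g" "g [] = 0"
  shows "twisted_diff (pair_scale scale) (rbl_op scale lam) (ident brc, ident (opc T)) p (ident f, ident g)
    = (ident (lie_part p f), ident (tw_diff lam T p g + phi_sum lam T (nat (1 - p)) f))"
proof -
  let ?\<alpha> = "(ident brc, ident (opc T))"
  let ?n = "nat (1 - p)"
  let ?l = "rbl_op scale lam"
  let ?M1 = "- op_mixed scale lam (- 1) (ident brc) [(p, ident g)]"
  let ?M2 = "- op_mixed scale lam (- 1) (ident brc) [(- 1, ident (opc T)), (p, ident g)]"
  let ?A = "\<lambda>i::nat. if i = 1 then ident (lie_part p f) else 0"
  let ?B = "\<lambda>i::nat. (if i = 1 then ?M1 else 0) + (if i = 2 then ?M2 else 0)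
      + (if i \<in> {1..?n} then ident (phi_part lam T ?n f i) else 0)"
  have tt: "twist_term (pair_scale scale) ?l ?\<alpha> [(p, (ident f, ident g))] i = (?A i, ?B i)" for i
  proof (cases "i = 0")
    case True
    then show ?thesis
      by (simp add: twist_term_def rbl_op_short pair_scale_zero_fst[OF vector_space])
        (simp add: zero_prod_def)
  next
    case False
    then have i: "1 \<le> i"
      by simp
    let ?zs = "replicate i (- 1, ?\<alpha>) @ [(p, (ident f, ident g))]"
    let ?c = "(- 1) ^ (i + i * (i - 1) div 2) / fact i :: 'k"
    have "fun_scale scale ?c (fst (?l ?zs)) = ?A i"
    proof (cases "i = 1")
      case True
      have "brace scale (ident brc) [(p, ident f)] = ident (f \<sqinter> idc)"
        using brace_one[OF cochain_brc cochain_supported[OF f(1)] f(2), of p] by (simp add: ins_brc[OF f(1)])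
      moreover have "brace scale (ident f) [(- 1, ident brc)] = ident (ins brc f)"
        by (rule brace_one[OF f(1) cochain_supported[OF cochain_brc]]) simp_all
      ultimately have "op_lie scale (- 1, ident brc) (p, ident f) = - ident (lie_part p f)"
        unfolding lie_part_def ident_add ident_uminus ident_sg
        by (simp add: op_lie_def fun_eq_iff scale_msign) (simp add: sg_def)
      then show ?thesis
        by (simp add: True rbl_op_def fun_eq_iff)
    next
      case False
      then have "fst (?l ?zs) = 0"
        using i by (intro fst_rbl_op_eq_0) simp
      then show ?thesis
        using False by (simp add: fun_eq_iff)
    qed
    moreover have "fun_scale scale ?c (snd (?l ?zs)) = ?B i"
    proof
      fix xs
      have "fun_scale scale ?c (snd (?l ?zs)) xs
        = fun_scale scale (?c * of_nat i) (op_mixed scale lam (- 1) (ident brc)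
            (replicate (i - 1) (- 1, ident (opc T)) @ [(p, ident g)])) xs
          + scale ?c (sg (int i * (p + 1)) (op_mixed scale lam p (ident f) (replicate i (- 1, ident (opc T))) xs))"
        by (simp only: fun_scale_apply snd_rbl_op_twist[OF i] scale_right_distrib scale_scale)
      then show "fun_scale scale ?c (snd (?l ?zs)) xs = ?B i xs"
        unfolding twist_brc_part[OF T g i] twist_phi_part[OF T f i] using i by auto
    qed
    ultimately show ?thesis
      unfolding twist_term_def pair_scale_def by simp
  qed
  have delta: "(\<Sum>i\<le>?n + 2. if i = k then v else 0) = v" if "k \<le> 2" for k and v :: "(int \<times> 'g) list \<Rightarrow> 'g"
    unfolding sum.delta[OF finite_atMost] using that by simp
  \<comment> \<open>The bound covers the parts of \<Phi>, up to \<open>?n\<close>, and the bracket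
    term with index 2, also when \<open>?n = 0\<close>.\<close>
  have sub: "{i. twist_term (pair_scale scale) ?l ?\<alpha> [(p, (ident f, ident g))] i \<noteq> 0} \<subseteq> {..?n + 2}"
    unfolding tt by (auto simp: zero_prod_def split: if_splits)
  have "twisted_diff (pair_scale scale) ?l ?\<alpha> p (ident f, ident g) = (\<Sum>i\<le>?n + 2. (?A i, ?B i))"
    unfolding twisted_diff_def twist_def Sum_any.expand_superset[OF finite_atMost sub]
    by (rule sum.cong[OF refl tt])
  also have "\<dots> = (\<Sum>i\<le>?n + 2. ?A i, \<Sum>i\<le>?n + 2. ?B i)"
    by (rule prod_eqI) (simp_all only: fst_sum snd_sum fst_conv snd_conv)
  also have "(\<Sum>i\<le>?n + 2. ?A i) = ident (lie_part p f)"
    by (rule delta) simp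
  also have "(\<Sum>i\<le>?n + 2. ?B i) = ?M1 + ?M2 + (\<Sum>i = 1..?n. ident (phi_part lam T ?n f i))"
  proof -
    have "(\<Sum>i\<le>?n + 2. if i \<in> {1..?n} then ident (phi_part lam T ?n f i) else 0)
        = (\<Sum>i\<in>{..?n + 2} \<inter> {1..?n}. ident (phi_part lam T ?n f i))"
      by (rule sum.inter_restrict[symmetric]) simp
    also have "{..?n + 2} \<inter> {1..?n} = {1..?n}"
      by auto
    finally show ?thesis
      unfolding sum.distrib by (simp only: delta one_le_numeral order_refl)
  qed
  also have "(\<Sum>i = 1..?n. ident (phi_part lam T ?n f i)) = ident (phi_sum lam T ?n f)"
  proof -
    have "(\<Sum>i\<in>I. ident (F i)) = ident (\<Sum>i\<in>I. F i)" for I :: "nat set" and F :: "nat \<Rightarrow> 'g list \<Rightarrow> 'g"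
      by (induction I rule: infinite_finite_induct)
        (simp_all add: ident_zero ident_add del: plus_fun_apply zero_fun_apply)
    then show ?thesis
      by (simp add: phi_sum_def)
  qed
  finally show ?thesis
    unfolding op_mixed_tw_diff[OF T g] ident_add .
qed

lemma cochain_lie_part:
  assumes "cochain (1 - p) f" "f [] = 0"
  shows "cochain (2 - p) (lie_part p f)" "lie_part p f [] = 0"
proof -
  have "cochain (2 - p) (ins brc f)" "cochain (2 - p) (f \<sqinter> idc)"
    using cochain_ins_brc[OF assms(1)] cochain_wed_idc[OF assms(1)] by simp_all
  then show "cochain (2 - p) (lie_part p f)"
    unfolding lie_part_def by (intro cochain_plus cochain_uminus cochain_sg)
  show "lie_part p f [] = 0"
    using ins_brc_Nil[OF assms(1)] by (simp add: lie_part_def biadd_zero[OF biadd_br])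
qed

lemma cochain_phi_sum:
  assumes T: "lin T" and f: "cochain a f" "f [] = 0"
  shows "cochain a (phi_sum lam T n f)" "phi_sum lam T n f [] = 0"
proof -
  have o: "cochain a (opsub i T f)" "cochain a (\<lambda>ws. T (opsub i T f ws))" for i
    by (intro cochain_opsub[OF T f(1)] cochain_comp_lin[OF T])+
  have "cochain a (phi_part lam T n f i)" for i
  proof -
    consider "i = n" | "i < n" | "n < i"
      by linarith
    then show ?thesis
    proof cases
      case 1
      then have "phi_part lam T n f i = opsub n T f - (\<lambda>ws. T (opsub (n - 1) T f ws))"
        by (simp add: fun_eq_iff phi_part_def)
      then show ?thesis
        using cochain_diff[OF o] by simp
    next
      case 2
      then have "phi_part lam T n f i = - fun_scale scale (lam ^ (n - i)) (\<lambda>ws. T (opsub (i - 1) T f ws))"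
        by (simp add: fun_eq_iff phi_part_def)
      then show ?thesis
        using cochain_uminus[OF cochain_fun_scale[OF o(2)]] by simp
    next
      case 3
      then have "phi_part lam T n f i = 0"
        by (simp add: fun_eq_iff phi_part_def)
      then show ?thesis
        by (simp add: cochain_zero_fun)
    qed
  qed
  then show "cochain a (phi_sum lam T n f)"
    unfolding phi_sum_def by (intro cochain_sum)
  have "opsub i T f [] = 0" for i
    using f(2) by (cases i) (simp_all add: opsub_0)
  then have "phi_part lam T n f i [] = 0" for i
    by (simp add: phi_part_def lin_simps[OF T])
  moreover have "(\<Sum>i\<in>I. F i) [] = (\<Sum>i\<in>I. F i [])" for I :: "nat set" and F :: "nat \<Rightarrow> 'g list \<Rightarrow> 'g"
    by (induction I rule: infinite_finite_induct) simp_all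
  ultimately show "phi_sum lam T n f [] = 0"
    by (simp add: phi_sum_def)
qed

text \<open>The sign of the suspension turns \<open>-\<partial> - \<Phi>\<close> into
  \<open>\<partial> + \<Phi>\<close>, and \<delta> into its negative, which is
  \<open>lie_part\<close> after exchanging the factors of \<open>f \<sqinter> idc\<close>.\<close>

lemma susp_rbl_diff_eq:
  assumes T: "lin T" and f: "cochain (1 - p) f" "f [] = 0" and g: "cochain (- p) g" "g [] = 0"
  shows "susp_diff (homological_diff (rbl_diff scale lam br T)) p (f, g)
    = (lie_part p f, tw_diff lam T p g + phi_sum lam T (nat (1 - p)) f)"
proof (cases "0 < p")
  \<comment> \<open>The arity \<open>1 - p\<close> is at most 0 and \<open>f [] = 0\<close>, so both
    cochains vanish. For \<open>p = 1\<close> the special value of \<Phi> in arity 0 is therefore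
    only taken at zero.\<close>
  case True
  then have "f = 0" "g = 0"
    using cochain_nonpos_arity[OF f] cochain_negative[OF g(1)] by simp_all
  moreover have "lie_diff scale br 0 0 = 0"
    using lie_diff_eq[OF cochain_zero_fun, of 0] unfolding ins_zero_right wed_zero by simp
  moreover have "rb_Phi scale lam T 0 0 = 0"
    by (simp add: rb_Phi_def fun_eq_iff)
  moreover have "lie_part p 0 = 0"
    unfolding lie_part_def ins_zero_right wed_zero by simp
  moreover have "phi_sum lam T (nat (1 - p)) 0 = 0"
    using True by (simp add: phi_sum_def)
  ultimately have "susp_diff (homological_diff (rbl_diff scale lam br T)) p (f, g) = 0"
    "lie_part p f = 0" "tw_diff lam T p g = 0" "phi_sum lam T (nat (1 - p)) f = 0"
    using True tw_diff_zero[OF T]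
    by (simp_all add: susp_diff_def homological_diff_def rbl_diff_def) (simp add: zero_prod_def)?
  then show ?thesis
    by (simp add: zero_prod_def)
next
  case False
  define n where "n = nat (1 - p)"
  then have n: "int n = 1 - p" "0 < n" "n - 1 = nat (- p)"
    using False by auto
  have f': "cochain (int n) f"
    using f(1) n by simp
  have "f \<sqinter> idc = - sg (int n * 1) (idc \<sqinter> f)"
    by (rule wed_skew[OF f' cochain_idc])
  then have l: "- lie_diff scale br n f = lie_part p f"
    unfolding lie_diff_eq[OF f'] lie_part_def n(1) by (auto simp: sg_def fun_eq_iff)
  have ph: "rb_Phi scale lam T n f = phi_sum lam T n f"
  proof -
    have "(\<Sum>i\<in>I. F i) ws = (\<Sum>i\<in>I. F i ws)" for I :: "nat set" and F :: "nat \<Rightarrow> 'g list \<Rightarrow> 'g" and ws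
      by (induction I rule: infinite_finite_induct) simp_all
    then show ?thesis
      unfolding rb_Phi_parts[OF T f' n(2)] phi_sum_def by (simp add: fun_eq_iff)
  qed
  have "nat (- (p - 1)) = n" "p - 1 \<le> 0"
    using False by (simp_all add: n_def)
  then have "susp_diff (homological_diff (rbl_diff scale lam br T)) p (f, g)
      = - rbl_diff scale lam br T n (f, g)"
    by (simp add: susp_diff_def homological_diff_def)
  also have "\<dots> = (- lie_diff scale br n f, rblo_diff scale lam br T (nat (- p)) g + rb_Phi scale lam T n f)"
    using n(2,3) by (simp add: rbl_diff_def)
  finally show ?thesis
    unfolding l ph n_def[symmetric] using tw_diff_eq[OF T g(1), of lam] False by simp
qed

lemma complex_iso_rbl:
  assumes T: "lin T"
  shows "complex_iso (pair_scale scale) (pair_scale scale) ident_pair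
    (susp (homological (rbl_positive scale)))
    (susp_diff (homological_diff (rbl_diff scale lam br T)))
    (rbl_space scale deg0)
    (twisted_diff (pair_scale scale) (rbl_op scale lam) (tilde_bracket br, tilde_operator T))"
  unfolding complex_iso_def
proof (intro allI conjI ballI)
  fix p
  show "bij_betw ident_pair (susp (homological (rbl_positive scale)) p) (rbl_space scale deg0 p)"
  proof (rule bij_betw_imageI)
    show "inj_on ident_pair (susp (homological (rbl_positive scale)) p)"
      by (rule inj_onI) (auto simp: rbl_positive_iff ident_pair_def intro!: prod_eqI ident_inj)
    show "ident_pair ` susp (homological (rbl_positive scale)) p = rbl_space scale deg0 p"
    proof (intro equalityI subsetI)
      fix w assume "w \<in> ident_pair ` susp (homological (rbl_positive scale)) p"
      then obtain z where "w = (ident (fst z), ident (snd z))" "cochain (1 - p) (fst z)" "fst z [] = 0"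
        "cochain (- p) (snd z)" "snd z [] = 0"
        by (auto simp: ident_pair_def rbl_positive_iff)
      then show "w \<in> rbl_space scale deg0 p"
        unfolding rbl_elem by blast
    next
      fix w assume "w \<in> rbl_space scale deg0 p"
      then obtain f g where "cochain (1 - p) f" "f [] = 0" "cochain (- p) g" "g [] = 0" "w = (ident f, ident g)"
        unfolding rbl_elem by blast
      then have "(f, g) \<in> susp (homological (rbl_positive scale)) p" "w = ident_pair (f, g)"
        by (simp_all add: rbl_positive_iff ident_pair_def)
      then show "w \<in> ident_pair ` susp (homological (rbl_positive scale)) p"
        by blast
    qed
  qed
  fix z assume "z \<in> susp (homological (rbl_positive scale)) p"
  then obtain f g where z: "z = (f, g)" and f: "cochain (1 - p) f" "f [] = 0"
    and g: "cochain (- p) g" "g [] = 0"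
    by (cases z) (simp add: rbl_positive_iff)
  note d = susp_rbl_diff_eq[OF T f g]
  have "cochain (1 - p) (tw_diff lam T p g + phi_sum lam T (nat (1 - p)) f)"
    by (intro cochain_plus cochain_tw_diff[OF T g] cochain_phi_sum[OF T f])
  then show "susp_diff (homological_diff (rbl_diff scale lam br T)) p z
      \<in> susp (homological (rbl_positive scale)) (p - 1)"
    unfolding z d rbl_positive_iff using cochain_lie_part[OF f] cochain_tw_diff(2)[OF T g]
      cochain_phi_sum(2)[OF T f] by simp
  show "ident_pair (susp_diff (homological_diff (rbl_diff scale lam br T)) p z)
      = twisted_diff (pair_scale scale) (rbl_op scale lam) (tilde_bracket br, tilde_operator T) p (ident_pair z)"
    unfolding z d by (simp only: ident_pair_def fst_conv snd_conv tilde_bracket_ident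
        tilde_operator_opc[OF T] twisted_diff_rbl[OF T f g])
qed (simp_all add: ident_pair_def pair_scale_def ident_add ident_fun_scale)

section \<open>Twisting by the bracket alone\<close>

lemma op_mixed_brc_zero_head:
  assumes "zs \<noteq> []" "homs (rblo_space scale deg0) zs"
  shows "op_mixed scale lam (- 1) (ident brc) ((- 1, 0) # zs) = 0"
proof -
  obtain q G l where zs: "zs = (q, G) # l"
    using assms(1) by (cases zs) auto
  obtain g where g: "cochain (- q) g" "g [] = 0" "G = ident g"
    using assms(2) unfolding zs homs_Cons by (auto elim: rblo_elemE)
  have c: "cochain (- (- 1)) 0"
    by (rule cochain_zero_fun)
  show ?thesis
  proof (cases l)
    case Nil
    show ?thesis
      unfolding zs Nil g(3)
      using op_mixed_brc_two[OF c _ g(1,2), of lam] lbr_zero(1)[OF g(1), of 1] by (simp add: ident_zero)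
  next
    case (Cons w l')
    have "\<exists>b g. cochain b g \<and> (0 :: (int \<times> 'g) list \<Rightarrow> 'g) = ident g"
      using cochain_zero_fun ident_zero by metis
    then have "ident_list ((- 1, 0) # zs)"
      using ident_list_rblo[OF assms(2)] by simp
    then show ?thesis
      by (rule op_mixed_brc_many) (simp add: zs Cons)
  qed
qed

text \<open>With no copy of the bracket there is no Lie component at all. With two or more, using
  one of them as Lie component leaves the zero operator component of another among the
  arguments.\<close>

lemma rbl_op_zero_parts:
  assumes "zs \<noteq> []" "homs (rblo_space scale deg0) zs" "i \<noteq> 1"
  shows "rbl_op scale lam (replicate i (- 1, (ident brc, 0)) @ map rblo_incl zs) = 0"
proof -
  let ?zs = "replicate i (- 1, (ident brc, 0)) @ map rblo_incl zs"
  have len: "length ?zs = i + length zs"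
    by simp
  have sub: "homs (rblo_space scale deg0) (drop_nth k zs)" for k
    using assms(2) by (auto simp: homs_def drop_nth_def dest: in_set_takeD in_set_dropD)
  have m: "map (\<lambda>(q, z). (q, snd z)) (map rblo_incl l) = l" for l :: "(int \<times> ((int \<times> 'g) list \<Rightarrow> 'g)) list"
    by (induction l) (auto simp: rblo_incl_def)
  have z: "\<exists>b g. cochain b g \<and> (0 :: (int \<times> 'g) list \<Rightarrow> 'g) = ident g"
    using cochain_zero_fun ident_zero by metis
  have t: "op_mixed scale lam (fst (?zs ! k)) (fst (snd (?zs ! k)))
      (map (\<lambda>(q, z). (q, snd z)) (drop_nth k ?zs)) xs = 0" if k: "k < length ?zs" "2 \<le> length ?zs" for k xs
  proof (cases "k < i")
    case True
    then obtain j where j: "i - 1 = Suc j"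
      using assms(3) by (cases "i - 1") auto
    have "map (\<lambda>(q, z). (q, snd z)) (drop_nth k ?zs) = replicate (i - 1) (- 1, 0) @ zs"
      using True by (simp add: drop_nth_append drop_nth_replicate m del: map_map)
    also have "\<dots> = (- 1, 0) # (replicate j (- 1, 0) @ zs)"
      by (simp only: j replicate_Suc append_Cons)
    finally have e: "map (\<lambda>(q, z). (q, snd z)) (drop_nth k ?zs) = (- 1, 0) # (replicate j (- 1, 0) @ zs)" .
    have "homs (rblo_space scale deg0) (replicate j (- 1, 0) @ zs)"
      using assms(2) zero_mem_rblo by (auto simp: homs_def)
    then have "op_mixed scale lam (- 1) (ident brc) ((- 1, 0) # (replicate j (- 1, 0) @ zs)) = 0"
      using assms(1) by (intro op_mixed_brc_zero_head) simp_all
    then show ?thesis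
      unfolding e using True by (simp add: nth_append)
  next
    case False
    then have "fst (snd (?zs ! k)) = 0"
      using k by (auto simp: nth_append rblo_incl_def)
    moreover have "drop_nth k ?zs = replicate i (- 1, (ident brc, 0)) @ map rblo_incl (drop_nth (k - i) zs)"
      using False by (simp add: drop_nth_def take_map drop_map Suc_diff_le)
    moreover have "ident_list (map (\<lambda>(q, z). (q, snd z)) (replicate i (- 1, (ident brc, 0)) @ map rblo_incl (drop_nth (k - i) zs)))"
      unfolding map_append m ident_list_def
    proof
      fix y assume "y \<in> set (map (\<lambda>(q, z). (q, snd z)) (replicate i (- 1, (ident brc, 0))) @ drop_nth (k - i) zs)"
      then consider "snd y = 0" | "y \<in> set (drop_nth (k - i) zs)"
        by (auto split: if_splits)
      then show "\<exists>b g. cochain b g \<and> snd y = ident g"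
        using z ident_list_rblo[OF sub[of "k - i"]] by cases (simp_all only: ident_list_def)
    qed
    moreover have "length (drop_nth k ?zs) \<noteq> 0"
      using k by (simp add: drop_nth_def)
    ultimately show ?thesis
      using op_mixed_zero[of "map (\<lambda>(q, z). (q, snd z)) (drop_nth k ?zs)" lam "fst (?zs ! k)" xs] by simp
  qed
  have "fst (rbl_op scale lam ?zs) = 0"
  proof (cases "length ?zs = 2 \<and> i = 0")
    case True
    then obtain u v where "zs = [u, v]"
      by (auto simp: length_Suc_conv numeral_2_eq_2)
    then show ?thesis
      using True by (simp add: rbl_op_def rblo_incl_def op_lie_def brace_zero fun_eq_iff)
  next
    case False
    have "length zs \<noteq> 0"
      using assms(1) by simp
    then have "length ?zs \<noteq> 2"
      using False assms(3) len by linarith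
    then show ?thesis
      by (rule fst_rbl_op_eq_0)
  qed
  moreover have "snd (rbl_op scale lam ?zs) = 0"
  proof (cases "2 \<le> length ?zs")
    case True
    then have "snd (rbl_op scale lam ?zs) = (\<lambda>xs. \<Sum>k<length ?zs. scale (msign (fst (?zs ! k) * degs (take k ?zs) + int k))
        (op_mixed scale lam (fst (?zs ! k)) (fst (snd (?zs ! k))) (map (\<lambda>(q, z). (q, snd z)) (drop_nth k ?zs)) xs))"
      unfolding rbl_op_def by (simp only: snd_conv if_True)
    also have "\<dots> = 0"
    proof
      fix xs
      have 0: "(0 :: (int \<times> 'g) list \<Rightarrow> 'g) xs = 0"
        by simp
      show "(\<Sum>k<length ?zs. scale (msign (fst (?zs ! k) * degs (take k ?zs) + int k))
          (op_mixed scale lam (fst (?zs ! k)) (fst (snd (?zs ! k))) (map (\<lambda>(q, z). (q, snd z)) (drop_nth k ?zs)) xs)) = 0 xs"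
        unfolding 0 by (intro sum.neutral ballI) (use t True in \<open>simp only: scale_zero_right lessThan_iff\<close>)
    qed
    finally show ?thesis .
  next
    case False
    then show ?thesis
      unfolding rbl_op_def by simp
  qed
  ultimately show ?thesis
    by (metis prod.collapse zero_prod_def)
qed

text \<open>Only the term \<open>i = 1\<close> survives. Its coefficient
  \<open>(- 1) ^ length zs\<close> is the sign with which \<open>rblo_op\<close> defines
  \<open>l_1\<close> and \<open>l_2\<close>.\<close>

lemma twist_rblo_incl:
  assumes "zs \<noteq> []" "homs (rblo_space scale deg0) zs"
  shows "twist (pair_scale scale) (rbl_op scale lam) (tilde_bracket br, 0) (map rblo_incl zs)
    = (0, rblo_op scale lam br zs)"
proof -
  let ?\<alpha> = "(ident brc, 0)"
  have ident_list: "ident_list zs"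
    by (rule ident_list_rblo[OF assms(2)])
  have "twist_term (pair_scale scale) (rbl_op scale lam) ?\<alpha> (map rblo_incl zs) i
      = (if i = 1 then (0, rblo_op scale lam br zs) else if i = 0 then 0 else 0)" for i
  proof (cases "i = 1")
    case True
    have f: "fst (rbl_op scale lam ((- 1, ?\<alpha>) # map rblo_incl zs)) = 0"
    proof (cases "length zs = 1")
      case True
      then obtain q G where zs: "zs = [(q, G)]"
        by (auto simp: length_Suc_conv)
      have "brace scale (ident brc) [(q, 0)] = 0"
        by (rule brace_ident_zero[OF cochain_brc])
      then show ?thesis
        by (simp add: zs rbl_op_def rblo_incl_def op_lie_def brace_zero fun_eq_iff)
    qed (use fst_rbl_op_eq_0 in simp)
    have m: "fun_scale scale (- 1) F = - F" "fun_scale scale 1 F = F" "fun_scale scale c 0 = 0"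
      for c and F :: "(int \<times> 'g) list \<Rightarrow> 'g"
      by (simp_all add: fun_eq_iff)
    have "rbl_op scale lam ((- 1, ?\<alpha>) # map rblo_incl zs) = (0, op_mixed scale lam (- 1) (ident brc) zs)"
      using f rbl_op_head[OF ident_list assms(1), of lam] by (metis prod.collapse)
    then have "twist_term (pair_scale scale) (rbl_op scale lam) ?\<alpha> (map rblo_incl zs) 1
        = (0, fun_scale scale ((- 1) ^ length zs) (op_mixed scale lam (- 1) (ident brc) zs))"
      unfolding twist_term_def by (simp add: pair_scale_zero_fst[OF vector_space])
    also have "fun_scale scale ((- 1) ^ length zs) (op_mixed scale lam (- 1) (ident brc) zs) = rblo_op scale lam br zs"
    proof -
      have "length zs \<noteq> 0"
        using assms(1) by simp
      then consider "length zs = 1" | "length zs = 2" | "3 \<le> length zs"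
        by linarith
      then show ?thesis
        by cases (simp_all only: rblo_op_eq[OF ident_list assms(1)] op_mixed_brc_many[OF ident_list],
            simp_all add: m)
    qed
    finally show ?thesis
      unfolding True by (simp only: if_True simp_thms)
  next
    case False
    then show ?thesis
      unfolding twist_term_def rbl_op_zero_parts[OF assms False] by (simp add: pair_scale_zero_fst[OF vector_space])
  qed
  from Sum_any_two(1)[OF this] show ?thesis
    unfolding twist_def tilde_bracket_ident by simp
qed

text \<open>With \<open>T = 0\<close>, the statements on the Maurer-Cartan element of a Rota-Baxter
  Lie algebra specialise to the element given by the bracket alone.\<close>

lemma zero_rota_baxter: "rota_baxter_operator scale lam br (\<lambda>_. 0)"
  by (simp add: rota_baxter_operator_def linear_scale_iff biadd_zero[OF biadd_br])

end

theorem theorem2: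
  fixes scale :: "'k::field_char_0 \<Rightarrow> 'g::ab_group_add \<Rightarrow> 'g"
    and lam :: 'k
    and br :: "'g \<Rightarrow> 'g \<Rightarrow> 'g"
  assumes "lie_algebra scale br"
  shows
    "(\<forall>T. rota_baxter_operator scale lam br T \<longrightarrow>
        maurer_cartan (pair_scale scale) (rbl_space scale deg0) (rbl_op scale lam)
          (tilde_bracket br, tilde_operator T) \<and>
        twist_converges (pair_scale scale) (rbl_space scale deg0) (rbl_op scale lam)
          (tilde_bracket br, tilde_operator T) \<and>
        complex_iso (pair_scale scale) (pair_scale scale) ident_pair
          (susp (homological (rbl_positive scale)))
          (susp_diff (homological_diff (rbl_diff scale lam br T)))
          (rbl_space scale deg0)
          (twisted_diff (pair_scale scale) (rbl_op scale lam)
             (tilde_bracket br, tilde_operator T)))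
     \<and>
     (maurer_cartan (pair_scale scale) (rbl_space scale deg0) (rbl_op scale lam)
        (tilde_bracket br, 0) \<and>
      twist_converges (pair_scale scale) (rbl_space scale deg0) (rbl_op scale lam)
        (tilde_bracket br, 0) \<and>
      (\<forall>zs. zs \<noteq> [] \<and> homs (rblo_space scale deg0) zs \<longrightarrow>
         twist (pair_scale scale) (rbl_op scale lam) (tilde_bracket br, 0) (map rblo_incl zs)
           = (0, rblo_op scale lam br zs)) \<and>
      dg_lie_algebra (fun_scale scale) (rblo_space scale deg0) (rblo_op scale lam br) \<and>
      bij_betw tilde_operator
        {T. rota_baxter_operator scale lam br T}
        {\<tau>. maurer_cartan (fun_scale scale) (rblo_space scale deg0) (rblo_op scale lam br) \<tau>} \<and>
      (\<forall>T. rota_baxter_operator scale lam br T \<longrightarrow>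
         twist_converges (fun_scale scale) (rblo_space scale deg0) (rblo_op scale lam br)
           (tilde_operator T) \<and>
         complex_iso (fun_scale scale) (fun_scale scale) ident
           (homological (rblo_positive scale))
           (homological_diff (rblo_diff scale lam br T))
           (rblo_space scale deg0)
           (twisted_diff (fun_scale scale) (rblo_op scale lam br) (tilde_operator T))))"
proof -
  interpret lie_alg scale br
    by (rule lie_alg.intro) (rule assms)
  have 0: "lin (\<lambda>_. 0)"
    by (rule rota_baxter_lin[OF zero_rota_baxter])
  have conv: "twist_converges (pair_scale scale) (rbl_space scale deg0) (rbl_op scale lam)
      (tilde_bracket br, tilde_operator T)" if "lin T" for T
    unfolding tilde_bracket_ident tilde_operator_opc[OF that] by (rule twist_converges_rbl[OF that])
  show ?thesis
    using maurer_cartan_rbl conv complex_iso_rbl rota_baxter_lin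
      maurer_cartan_rbl[OF zero_rota_baxter, unfolded tilde_operator_0]
      conv[OF 0, unfolded tilde_operator_0] twist_rblo_incl dg_lie_rblo bij_betw_rbo_mc
      twist_converges_rblo complex_iso_rblo
    by (intro conjI allI impI; (elim conjE)?) (simp_all only:)
qed

end
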